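(* Let $(E,\rho)$ be a weighted space and $(P(t))_{t\ge0}$ a generalized Feller semigroup on $\mathscr{B}^\rho(E)$ such that $P(t)1=1$ for all $t\ge0$. Then for every probability measure $\nu\in\mathcal{M}^\rho(E)$ there exist a probability measure $\mathbb{P}_\nu$ on the measurable space $(E^{\mathbb{R}_+},\mathcal{B}(E)^{\mathbb{R}_+})$ (product σ-algebra) and a complete, right-continuous filtration $(\mathcal{F}_t)_{t\ge0}$ containing the natural filtration of the canonical (coordinate) process $(\lambda_t)_{t\ge0}$, such that $(\lambda_t)$ is $(\mathcal{F}_t)$-adapted, $\mathbb{P}_\nu\circ\lambda_0^{-1}=\nu$, and for all $t\ge s\ge0$ and all $f\in\mathscr{B}^\rho(E)$, $$\mathbb{E}_\nu[f(\lambda_t)\mid\mathcal{F}_s]=P(t-s)f(\lambda_s)\quad \mathbb{P}_\nu\text{-a.s.}$$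
   Context: A weighted space is a pair $(E,\rho)$ where $E$ is a completely regular Hausdorff topological space and $\rho:E\to(0,\infty)$ is an admissible weight function, meaning that for every $R\ge 0$ the sublevel set $K_R:=\{x\in E:\rho(x)\le R\}$ is compact. For $f:E\to\mathbb{R}$ put $\|f\|_\rho:=\sup_{x\in E}|f(x)|/\rho(x)$; $\mathscr{B}^\rho(E)$ denotes the closure of $C_b(E)$ with respect to $\|\cdot\|_\rho$ inside $\{f:E\to\mathbb{R}:\|f\|_\rho<\infty\}$. A generalized Feller semigroup on $\mathscr{B}^\rho(E)$ is a family $(P(t))_{t\ge0}$ of bounded linear operators on $\mathscr{B}^\rho(E)$ such that (P1) $P(0)=\mathrm{Id}$; (P2) $P(t+s)=P(s)P(t)$ for all $s,t\ge0$; (P3) $\lim_{t\downarrow0}P(t)f(x)=f(x)$ for all $f\in\mathscr{B}^\rho(E)$, $x\in E$; (P4) there exist $\varepsilon>0$, $C<\infty$ with $\|P(t)\|_{L(\mathscr{B}^\rho(E))}\le C$ for all $t\in[0,\varepsilon]$; (P5) each $P(t)$ is a positive operator. $\mathcal{M}^\rho(E)$ denotes the set of signed Radon measures $\mu$ on the Borel σ-algebra $\mathcal{B}(E)$ with $\int_E\rho\,d|\mu|<\infty$. $\mathcal{B}(E)$ is the Borel σ-algebra of $E$. *)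

theory Defs
  imports "HOL-Analysis.Analysis" "HOL-Probability.Probability"
begin

definition weighted_space :: "('a::topological_space \<Rightarrow> real) \<Rightarrow> bool" where
  "weighted_space \<rho> \<longleftrightarrow>
     completely_regular_space (euclidean :: 'a topology) \<and>
     Hausdorff_space (euclidean :: 'a topology) \<and>
     (\<forall>x. \<rho> x > 0) \<and>
     (\<forall>R\<ge>0. compact {x. \<rho> x \<le> R})"

text \<open>The weighted sup-norm (meaningful when the set below is bounded above).\<close>
definition wnorm :: "('a \<Rightarrow> real) \<Rightarrow> ('a \<Rightarrow> real) \<Rightarrow> real" where
  "wnorm \<rho> f = (SUP x. \<bar>f x\<bar> / \<rho> x)"

definition wbounded :: "('a \<Rightarrow> real) \<Rightarrow> ('a \<Rightarrow> real) \<Rightarrow> bool" where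
  "wbounded \<rho> f \<longleftrightarrow> bdd_above (range (\<lambda>x. \<bar>f x\<bar> / \<rho> x))"

definition Brho :: "('a::topological_space \<Rightarrow> real) \<Rightarrow> ('a \<Rightarrow> real) set" where
  "Brho \<rho> = {f. wbounded \<rho> f \<and>
      (\<forall>\<epsilon>>0. \<exists>g. continuous_on UNIV g \<and> bounded (range g) \<and>
                  wnorm \<rho> (\<lambda>x. f x - g x) < \<epsilon>)}"

definition gen_feller_semigroup ::
  "('a::topological_space \<Rightarrow> real) \<Rightarrow> (real \<Rightarrow> ('a \<Rightarrow> real) \<Rightarrow> ('a \<Rightarrow> real)) \<Rightarrow> bool" where
  "gen_feller_semigroup \<rho> P \<longleftrightarrow>
     \<comment> \<open>each P(t), t \<ge> 0, is a bounded linear operator on B^rho(E)\<close>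
     (\<forall>t\<ge>0. (\<forall>f\<in>Brho \<rho>. P t f \<in> Brho \<rho>) \<and>
        (\<forall>f\<in>Brho \<rho>. \<forall>g\<in>Brho \<rho>. P t (\<lambda>x. f x + g x) = (\<lambda>x. P t f x + P t g x)) \<and>
        (\<forall>f\<in>Brho \<rho>. \<forall>c. P t (\<lambda>x. c * f x) = (\<lambda>x. c * P t f x)) \<and>
        (\<exists>C. \<forall>f\<in>Brho \<rho>. wnorm \<rho> (P t f) \<le> C * wnorm \<rho> f)) \<and>
     \<comment> \<open>(P1)\<close>
     (\<forall>f\<in>Brho \<rho>. P 0 f = f) \<and>
     \<comment> \<open>(P2)\<close>
     (\<forall>s\<ge>0. \<forall>t\<ge>0. \<forall>f\<in>Brho \<rho>. P (t + s) f = P s (P t f)) \<and>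
     \<comment> \<open>(P3)\<close>
     (\<forall>f\<in>Brho \<rho>. \<forall>x. ((\<lambda>t. P t f x) \<longlongrightarrow> f x) (at_right 0)) \<and>
     \<comment> \<open>(P4)\<close>
     (\<exists>\<epsilon>>0. \<exists>C. \<forall>t\<in>{0..\<epsilon>}. \<forall>f\<in>Brho \<rho>. wnorm \<rho> (P t f) \<le> C * wnorm \<rho> f) \<and>
     \<comment> \<open>(P5)\<close>
     (\<forall>t\<ge>0. \<forall>f\<in>Brho \<rho>. (\<forall>x. f x \<ge> 0) \<longrightarrow> (\<forall>x. P t f x \<ge> 0))"

definition prob_in_Mrho :: "('a::topological_space \<Rightarrow> real) \<Rightarrow> 'a measure \<Rightarrow> bool" where
  "prob_in_Mrho \<rho> \<nu> \<longleftrightarrow>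
     sets \<nu> = sets borel \<and> prob_space \<nu> \<and>
     (\<forall>A\<in>sets borel. emeasure \<nu> A = (SUP K\<in>{K. compact K \<and> K \<subseteq> A}. emeasure \<nu> K)) \<and>
     integrable \<nu> \<rho>"

end

theory Submission
  imports Defs
begin

text \<open>
  The Riesz representation theorem turns \<open>f \<mapsto> P t f x\<close> into integration against a Radon probability
  measure \<open>kernel t x\<close>. Since \<open>E\<close> need not be metrizable, measurability in \<open>x\<close>, the Chapman-Kolmogorov equation
  on Borel sets and the Radon property of the one-dimensional laws are not automatic: all three follow from
  \<open>\<tau>\<close>-additivity, that is, Radon measures commute with directed suprema of \<open>[0,1]\<close>-valued functions that are
  continuous on every sublevel set of \<open>\<rho>\<close>. The Radon marginals make finite-dimensional laws inner regular with
  respect to compact sets, and Tychonoff's theorem gives the Kolmogorov extension.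

  The Markov property for the natural filtration must be passed on to its right-continuous completion without
  continuity of paths. Pointwise right continuity of \<open>t \<mapsto> P t f x\<close> makes the process right continuous in mean.
  It also makes the orbit \<open>t \<mapsto> P t f\<close> norm separable, so that every interval to the left of \<open>T\<close> contains two
  times with nearby values; boundedness of the operators then gives \<open>h \<down> 0\<close> with \<open>P (T - h) f \<rightarrow> P T f\<close> in norm.
  Hence \<open>P (t - u) f (\<lambda>\<^sub>u)\<close> tends to \<open>P (t - s) f (\<lambda>\<^sub>s)\<close> in mean along a sequence \<open>u \<down> s\<close>.
\<close>

section \<open>Cutoff functions on completely regular spaces\<close>

definition Cb :: "('a::topological_space \<Rightarrow> real) set" where
  "Cb = {f. continuous_on UNIV f \<and> bounded (range f)}"

lemma CbI: "continuous_on UNIV f \<Longrightarrow> (\<And>x. \<bar>f x\<bar> \<le> B) \<Longrightarrow> f \<in> Cb"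
  unfolding Cb_def bounded_iff by auto

lemma Cb_continuous_on: "f \<in> Cb \<Longrightarrow> continuous_on S f"
  by (auto simp: Cb_def intro: continuous_on_subset)

lemma Cb_boundedE:
  assumes "f \<in> Cb" obtains B where "B > 0" "\<And>x. \<bar>f x\<bar> \<le> B"
  using assms by (auto simp: Cb_def bounded_pos)

lemma Cb_borel: "f \<in> Cb \<Longrightarrow> f \<in> borel_measurable borel"
  by (intro borel_measurable_continuous_onI Cb_continuous_on)

lemma Cb_const: "(\<lambda>x. c) \<in> Cb"
  by (rule CbI[of _ "\<bar>c\<bar>"]) auto

lemma Cb_add: "f \<in> Cb \<Longrightarrow> g \<in> Cb \<Longrightarrow> (\<lambda>x. f x + g x) \<in> Cb"
  unfolding Cb_def using bounded_plus_comp[of f UNIV g] by (auto intro!: continuous_intros)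

lemma Cb_power2:
  assumes "f \<in> Cb" shows "(\<lambda>x. (f x)\<^sup>2) \<in> Cb"
proof -
  obtain B where "\<And>x. \<bar>f x\<bar> \<le> B" using Cb_boundedE[OF assms] by blast
  then have "\<bar>(f x)\<^sup>2\<bar> \<le> B\<^sup>2" for x
    using abs_le_square_iff[of "f x" B] by (simp add: order_trans[OF _ abs_ge_self])
  then show ?thesis by (intro CbI[of _ "B\<^sup>2"] continuous_intros Cb_continuous_on[OF assms])
qed

definition cutoffs :: "'a::topological_space set \<Rightarrow> ('a \<Rightarrow> real) set" where
  "cutoffs U = {f. continuous_on UNIV f \<and> (\<forall>x. 0 \<le> f x \<and> f x \<le> indicator U x)}"

lemma cutoffsI:
  "continuous_on UNIV f \<Longrightarrow> (\<And>x. 0 \<le> f x) \<Longrightarrow> (\<And>x. f x \<le> 1) \<Longrightarrow> (\<And>x. x \<notin> U \<Longrightarrow> f x = 0) \<Longrightarrow> f \<in> cutoffs U"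
  by (auto simp: cutoffs_def indicator_def)

lemma cutoffs_continuous_on: "f \<in> cutoffs U \<Longrightarrow> continuous_on S f"
  by (auto simp: cutoffs_def intro: continuous_on_subset)

lemma cutoffs_nonneg: "f \<in> cutoffs U \<Longrightarrow> 0 \<le> f x"
  and cutoffs_le_indicator: "f \<in> cutoffs U \<Longrightarrow> f x \<le> indicator U x"
  by (auto simp: cutoffs_def)

lemma cutoffs_le_1: "f \<in> cutoffs U \<Longrightarrow> f x \<le> 1"
  using cutoffs_le_indicator[of f U x] indicator_le_1[of U x] by (rule order_trans)

lemma cutoffs_eq_0: "f \<in> cutoffs U \<Longrightarrow> x \<notin> U \<Longrightarrow> f x = 0"
  using cutoffs_nonneg[of f U x] cutoffs_le_indicator[of f U x] by simp

lemma cutoffs_abs_le_1: "f \<in> cutoffs U \<Longrightarrow> \<bar>f x\<bar> \<le> 1"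
  by (simp add: cutoffs_nonneg cutoffs_le_1)

lemma cutoffs_Cb: "f \<in> cutoffs U \<Longrightarrow> f \<in> Cb"
  by (intro CbI[of _ 1] cutoffs_continuous_on cutoffs_abs_le_1)

lemma cutoffs_mono: "U \<subseteq> V \<Longrightarrow> cutoffs U \<subseteq> cutoffs V"
  by (auto intro!: cutoffsI intro: cutoffs_continuous_on cutoffs_nonneg cutoffs_le_1 cutoffs_eq_0)

lemma zero_in_cutoffs: "(\<lambda>x. 0) \<in> cutoffs U"
  by (rule cutoffsI) auto

lemma cutoffs_nonempty: "cutoffs U \<noteq> {}"
  using zero_in_cutoffs by blast

lemma cutoffs_max: "f \<in> cutoffs U \<Longrightarrow> g \<in> cutoffs U \<Longrightarrow> (\<lambda>x. max (f x) (g x)) \<in> cutoffs U"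
  by (auto simp: cutoffs_def intro!: continuous_intros simp: le_max_iff_disj)

lemma cutoffs_min_1_sum:
  assumes "\<And>i. i \<in> I \<Longrightarrow> f i \<in> cutoffs U" and "c \<ge> 0"
  shows "(\<lambda>x. min 1 (\<Sum>i\<in>I. c * f i x)) \<in> cutoffs U"
proof (rule cutoffsI)
  show "continuous_on UNIV (\<lambda>x. min 1 (\<Sum>i\<in>I. c * f i x))"
    using assms(1) by (intro continuous_intros cutoffs_continuous_on)
  show "0 \<le> min 1 (\<Sum>i\<in>I. c * f i x)" for x
    using assms cutoffs_nonneg by (auto intro!: sum_nonneg mult_nonneg_nonneg)
  show "min 1 (\<Sum>i\<in>I. c * f i x) = 0" if "x \<notin> U" for x
    using cutoffs_eq_0[OF assms(1) that] by simp
qed simp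

lemma bounded_affine_cutoff:
  assumes "f \<in> Cb" "B > 0" "\<And>x. \<bar>f x\<bar> \<le> B"
  shows "(\<lambda>x. 1 / (2 * B) * f x + 1 / 2) \<in> cutoffs UNIV"
proof (rule cutoffsI)
  fix x
  have "- B \<le> f x" "f x \<le> B" using assms(3)[of x] by auto
  then show "0 \<le> 1 / (2 * B) * f x + 1 / 2" "1 / (2 * B) * f x + 1 / 2 \<le> 1"
    using assms(2) by (auto simp: field_simps)
qed (use assms in \<open>auto intro!: continuous_intros simp: Cb_continuous_on\<close>)

lemma completely_regular_cutoff:
  fixes x :: "'a::topological_space"
  assumes "completely_regular_space (euclidean :: 'a topology)" "open U" "x \<in> U"
  obtains f where "f \<in> cutoffs U" "f x = 1"
proof -
  have "closedin euclidean (-U)" using assms by auto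
  then obtain g where g: "continuous_map euclidean (top_of_set {0..1}) g" "g x = (0::real)"
    "g ` (-U) \<subseteq> {1}"
    using assms(1,3) unfolding completely_regular_space_def
    by (metis Compl_iff Diff_iff UNIV_I topspace_euclidean)
  then have "continuous_on UNIV g" "\<And>y. g y \<in> {0..1}"
    by (auto simp: continuous_map_in_subtopology)
  then have "(\<lambda>y. 1 - g y) \<in> cutoffs U"
    using g(3) by (intro cutoffsI continuous_intros) (auto simp: image_subset_iff)
  then show thesis using g(2) that by fastforce
qed

lemma SUP_cutoffs_eq_indicator:
  fixes x :: "'a::topological_space"
  assumes "completely_regular_space (euclidean :: 'a topology)" "open U"
  shows "(SUP f\<in>cutoffs U. f x) = indicator U x"
proof (cases "x \<in> U")
  case True
  then obtain f where f: "f \<in> cutoffs U" "f x = 1"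
    using completely_regular_cutoff[OF assms] by blast
  have "(SUP f\<in>cutoffs U. f x) = 1"
    by (intro cSup_eq_maximum rev_image_eqI[OF f(1)]) (auto simp: f(2) intro: cutoffs_le_1)
  then show ?thesis using True by simp
next
  case False
  then have "(\<lambda>f. f x) ` cutoffs U = {0}" using cutoffs_eq_0 zero_in_cutoffs by fastforce
  then show ?thesis using False by simp
qed

lemma compact_cover_cutoffs:
  fixes U :: "nat \<Rightarrow> 'a::topological_space set"
  assumes regular: "completely_regular_space (euclidean :: 'a topology)"
    and compact: "compact C" "C \<subseteq> (\<Union>n. U n)" and open_U: "\<And>n. open (U n)"
  obtains N g where "\<And>n. g n \<in> cutoffs (U n)" "\<And>x. x \<in> C \<Longrightarrow> 1 \<le> (\<Sum>n<N. g n x)"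
proof -
  have "\<exists>n h. h \<in> cutoffs (U n) \<and> h x = 1" if "x \<in> C" for x
    using that compact(2) completely_regular_cutoff[OF regular open_U] by blast
  then obtain \<nu> h where h: "\<And>x. x \<in> C \<Longrightarrow> h x \<in> cutoffs (U (\<nu> x))" "\<And>x. x \<in> C \<Longrightarrow> h x x = 1"
    by metis
  have "open {y. 1/2 < h x y}" if "x \<in> C" for x
    by (intro open_Collect_less continuous_on_const cutoffs_continuous_on[OF h(1)[OF that]])
  moreover have "C \<subseteq> (\<Union>x\<in>C. {y. 1/2 < h x y})" using h(2) by force
  ultimately obtain D where D: "D \<subseteq> C" "finite D" "C \<subseteq> (\<Union>x\<in>D. {y. 1/2 < h x y})"
    using compactE_image[OF compact(1), of C "\<lambda>x. {y. 1/2 < h x y}"] by auto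
  define g where "g n y = min 1 (\<Sum>x\<in>{x\<in>D. \<nu> x = n}. 2 * h x y)" for n y
  define N where "N = Suc (Max (insert 0 (\<nu> ` D)))"
  have g: "g n \<in> cutoffs (U n)" for n
    unfolding g_def[abs_def] using D(1) h(1) by (intro cutoffs_min_1_sum) auto
  moreover have "1 \<le> (\<Sum>n<N. g n y)" if "y \<in> C" for y
  proof -
    obtain x where x: "x \<in> D" "1/2 < h x y" using D(3) \<open>y \<in> C\<close> by auto
    have "2 * h x y \<le> (\<Sum>z\<in>{z\<in>D. \<nu> z = \<nu> x}. 2 * h z y)"
      using D(1,2) x(1) cutoffs_nonneg[OF h(1)] by (intro member_le_sum[of x]) auto
    then have "1 \<le> g (\<nu> x) y" using x(2) by (auto simp: g_def)
    also have "\<dots> \<le> (\<Sum>n<N. g n y)"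
      using x(1) D(2) cutoffs_nonneg[OF g]
      by (intro member_le_sum) (auto simp: N_def less_Suc_eq_le)
    finally show ?thesis .
  qed
  ultimately show thesis by (rule that)
qed

lemma Hausdorff_compact_imp_closed:
  fixes S :: "'a::topological_space set"
  assumes "Hausdorff_space (euclidean :: 'a topology)" "compact S" shows "closed S"
  using compactin_imp_closedin[OF assms(1), of S] assms(2) by simp

section \<open>Weighted spaces\<close>

locale weighted =
  fixes \<rho> :: "'a::topological_space \<Rightarrow> real"
  assumes weighted_space: "weighted_space \<rho>"
begin

lemma Hausdorff: "Hausdorff_space (euclidean :: 'a topology)"
  and completely_regular: "completely_regular_space (euclidean :: 'a topology)"
  and rho_pos: "\<rho> x > 0"
  using weighted_space by (auto simp: weighted_space_def)

lemma rho_nonneg: "0 \<le> \<rho> x"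
  using rho_pos[of x] by simp

lemma compact_sublevel: "compact {x. \<rho> x \<le> R}"
proof (cases "R \<ge> 0")
  case False
  then have "{x. \<rho> x \<le> R} = {}" using less_trans[OF _ rho_pos] by (auto simp: not_le)
  then show ?thesis by simp
qed (use weighted_space in \<open>auto simp: weighted_space_def\<close>)

lemmas compact_imp_closed_weighted = Hausdorff_compact_imp_closed[OF Hausdorff]

lemma closed_sublevel: "closed {x. \<rho> x \<le> R}"
  by (intro compact_imp_closed_weighted compact_sublevel)

lemma open_superlevel: "open {x. R < \<rho> x}"
  using closed_sublevel[of R] by (simp add: closed_def Collect_neg_eq[symmetric] not_le)

lemma rho_borel[measurable]: "\<rho> \<in> borel_measurable borel"
  by (rule borel_measurableI_le) (use closed_sublevel in auto)

lemma rho_bounded_below: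
  obtains c where "c > 0" "\<And>x. c \<le> \<rho> x"
proof -
  have "{x. \<rho> x \<le> 1} \<subseteq> (\<Union>n. {x. 1 / real (Suc n) < \<rho> x})"
    using reals_Archimedean[OF rho_pos] by (auto simp: inverse_eq_divide)
  then obtain N where N: "finite N" "{x. \<rho> x \<le> 1} \<subseteq> (\<Union>n\<in>N. {x. 1 / real (Suc n) < \<rho> x})"
    using compactE_image[OF compact_sublevel[of 1], of UNIV "\<lambda>n. {x. 1 / real (Suc n) < \<rho> x}"]
        open_superlevel
    by auto
  define c where "c = 1 / real (Suc (Max (insert 0 N)))"
  have c_le: "c \<le> 1 / real (Suc n)" if "n = 0 \<or> n \<in> N" for n
    unfolding c_def using that N(1) by (intro frac_le) auto
  have "c \<le> \<rho> x" for x
  proof (cases "\<rho> x \<le> 1")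
    case True
    then obtain n where "n \<in> N" "1 / real (Suc n) < \<rho> x" using N(2) by blast
    then show ?thesis using c_le[of n] by simp
  qed (use c_le[of 0] in simp)
  then show thesis by (rule that[rotated]) (simp add: c_def)
qed

definition rho_min :: real where
  "rho_min = (INF x. \<rho> x)"

lemma rho_min_le: "rho_min \<le> \<rho> x"
  unfolding rho_min_def using rho_nonneg by (intro cINF_lower bdd_belowI[of _ 0]) auto

lemma rho_min_pos: "rho_min > 0"
proof -
  obtain c where c: "c > 0" "\<And>x. c \<le> \<rho> x" by (rule rho_bounded_below) blast
  then have "c \<le> rho_min" unfolding rho_min_def by (intro cINF_greatest) auto
  with c(1) show ?thesis by simp
qed

lemma le_weight_if_nonneg: "B \<ge> 0 \<Longrightarrow> B \<le> B / rho_min * \<rho> x"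
  using rho_min_pos mult_left_mono[OF rho_min_le[of x], of B] by (simp add: field_simps)

lemma wnorm_bound:
  assumes "wbounded \<rho> f" shows "\<bar>f x\<bar> \<le> wnorm \<rho> f * \<rho> x"
proof -
  have "\<bar>f x\<bar> / \<rho> x \<le> wnorm \<rho> f"
    using assms unfolding wbounded_def wnorm_def by (intro cSUP_upper) auto
  then show ?thesis using rho_pos[of x] by (simp add: divide_le_eq)
qed

lemma wnorm_le:
  assumes "\<And>x. \<bar>f x\<bar> \<le> M * \<rho> x" shows "wnorm \<rho> f \<le> M"
  unfolding wnorm_def using assms rho_pos by (intro cSUP_least) (auto simp: divide_le_eq)

lemma wbounded_iff: "wbounded \<rho> f \<longleftrightarrow> (\<exists>M. \<forall>x. \<bar>f x\<bar> \<le> M * \<rho> x)"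
  using rho_pos by (auto simp: wbounded_def bdd_above_def divide_le_eq)

lemma wbounded_add:
  assumes "wbounded \<rho> f" "wbounded \<rho> g" shows "wbounded \<rho> (\<lambda>x. f x + g x)"
proof -
  obtain M N where "\<And>x. \<bar>f x\<bar> \<le> M * \<rho> x" "\<And>x. \<bar>g x\<bar> \<le> N * \<rho> x"
    using assms unfolding wbounded_iff by blast
  then have "\<bar>f x + g x\<bar> \<le> (M + N) * \<rho> x" for x
    by (smt (verit) abs_triangle_ineq distrib_right)
  then show ?thesis unfolding wbounded_iff by blast
qed

lemma Cb_wbounded:
  assumes "f \<in> Cb" shows "wbounded \<rho> f"
proof -
  obtain B where "B > 0" "\<And>x. \<bar>f x\<bar> \<le> B" using Cb_boundedE[OF assms] by blast
  then have "\<bar>f x\<bar> \<le> B / rho_min * \<rho> x" for x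
    using le_weight_if_nonneg[of B x] by (meson less_imp_le order_trans)
  then show ?thesis unfolding wbounded_iff by blast
qed

lemma Brho_iff:
  "f \<in> Brho \<rho> \<longleftrightarrow> (\<forall>\<epsilon>>0. \<exists>g\<in>Cb. \<forall>x. \<bar>f x - g x\<bar> \<le> \<epsilon> * \<rho> x)" (is "_ = ?approximable")
proof
  assume f: "f \<in> Brho \<rho>"
  show ?approximable
  proof (intro allI impI)
    fix \<epsilon> :: real assume "\<epsilon> > 0"
    then obtain g where g: "g \<in> Cb" "wnorm \<rho> (\<lambda>x. f x - g x) < \<epsilon>"
      using f unfolding Brho_def Cb_def by blast
    have "(\<lambda>x. - g x) \<in> Cb"
      using g(1) by (auto simp: Cb_def bounded_iff intro!: continuous_intros)
    then have "wbounded \<rho> (\<lambda>x. f x - g x)"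
      using f wbounded_add[OF _ Cb_wbounded, of f "\<lambda>x. - g x"] by (simp add: Brho_def)
    then have "\<bar>f x - g x\<bar> \<le> wnorm \<rho> (\<lambda>x. f x - g x) * \<rho> x" for x by (rule wnorm_bound)
    moreover have "wnorm \<rho> (\<lambda>x. f x - g x) * \<rho> x \<le> \<epsilon> * \<rho> x" for x
      using g(2) rho_nonneg by (intro mult_right_mono) auto
    ultimately show "\<exists>g\<in>Cb. \<forall>x. \<bar>f x - g x\<bar> \<le> \<epsilon> * \<rho> x" using g(1) by (meson order_trans)
  qed
next
  assume approx: ?approximable
  then obtain g where g: "g \<in> Cb" "\<And>x. \<bar>f x - g x\<bar> \<le> 1 * \<rho> x" using zero_less_one by blast
  have "wbounded \<rho> (\<lambda>x. f x - g x)" unfolding wbounded_iff using g(2) by blast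
  from wbounded_add[OF this Cb_wbounded[OF g(1)]] have "wbounded \<rho> f" by simp
  moreover have "\<exists>g. continuous_on UNIV g \<and> bounded (range g) \<and> wnorm \<rho> (\<lambda>x. f x - g x) < \<epsilon>"
    if "\<epsilon> > 0" for \<epsilon>
  proof -
    obtain g where g: "g \<in> Cb" "\<And>x. \<bar>f x - g x\<bar> \<le> \<epsilon> / 2 * \<rho> x"
      using approx \<open>\<epsilon> > 0\<close> half_gt_zero by blast
    with wnorm_le[OF g(2)] \<open>\<epsilon> > 0\<close> show ?thesis by (intro exI[of _ g]) (auto simp: Cb_def)
  qed
  ultimately show "f \<in> Brho \<rho>" unfolding Brho_def by simp
qed

lemma Brho_approx:
  assumes "f \<in> Brho \<rho>" "\<epsilon> > 0"
  obtains g where "g \<in> Cb" "\<And>x. \<bar>f x - g x\<bar> \<le> \<epsilon> * \<rho> x"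
  using assms Brho_iff by blast

lemma Brho_bound: "f \<in> Brho \<rho> \<Longrightarrow> \<bar>f x\<bar> \<le> wnorm \<rho> f * \<rho> x"
  using wnorm_bound by (auto simp: Brho_def)

lemma wnorm_nonneg: "f \<in> Brho \<rho> \<Longrightarrow> 0 \<le> wnorm \<rho> f"
  using Brho_bound[of f undefined] rho_pos[of undefined] abs_ge_zero[of "f undefined"]
  by (meson order_trans zero_le_mult_iff not_le)

lemma Cb_Brho: "f \<in> Cb \<Longrightarrow> f \<in> Brho \<rho>"
  unfolding Brho_iff using rho_nonneg by (auto intro!: bexI[of _ f])

lemma cutoffs_Brho: "f \<in> cutoffs U \<Longrightarrow> f \<in> Brho \<rho>"
  by (intro Cb_Brho cutoffs_Cb)

lemma Brho_const: "(\<lambda>x. c) \<in> Brho \<rho>"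
  by (intro Cb_Brho Cb_const)

lemma Brho_add:
  assumes "f \<in> Brho \<rho>" "g \<in> Brho \<rho>" shows "(\<lambda>x. f x + g x) \<in> Brho \<rho>"
  unfolding Brho_iff
proof (intro allI impI)
  fix \<epsilon> :: real assume "\<epsilon> > 0"
  then obtain a b where ab: "a \<in> Cb" "b \<in> Cb" "\<And>x. \<bar>f x - a x\<bar> \<le> \<epsilon>/2 * \<rho> x"
    "\<And>x. \<bar>g x - b x\<bar> \<le> \<epsilon>/2 * \<rho> x"
    using Brho_approx assms half_gt_zero by metis
  have "\<bar>f x + g x - (a x + b x)\<bar> \<le> \<epsilon> * \<rho> x" for x
    using ab(3)[of x] ab(4)[of x] by linarith
  then show "\<exists>h\<in>Cb. \<forall>x. \<bar>f x + g x - h x\<bar> \<le> \<epsilon> * \<rho> x"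
    using Cb_add[OF ab(1,2)] by (intro bexI[of _ "\<lambda>x. a x + b x"]) auto
qed

lemma Brho_lipschitz_compose:
  assumes f: "f \<in> Brho \<rho>" and \<phi>: "L-lipschitz_on UNIV (\<phi> :: real \<Rightarrow> real)"
  shows "(\<lambda>x. \<phi> (f x)) \<in> Brho \<rho>"
  unfolding Brho_iff
proof (intro allI impI)
  fix \<epsilon> :: real assume "\<epsilon> > 0"
  have L: "L \<ge> 0" and lipschitz: "\<bar>\<phi> x - \<phi> y\<bar> \<le> L * \<bar>x - y\<bar>" for x y
    using \<phi> by (auto simp: lipschitz_on_def dist_real_def)
  obtain g where g: "g \<in> Cb" "\<And>x. \<bar>f x - g x\<bar> \<le> \<epsilon> / (L + 1) * \<rho> x"
    using Brho_approx[OF f, of "\<epsilon> / (L + 1)"] \<open>\<epsilon> > 0\<close> L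
    by (metis add_nonneg_pos divide_pos_pos zero_less_one)
  obtain B where B: "B > 0" "\<And>x. \<bar>g x\<bar> \<le> B" using Cb_boundedE[OF g(1)] by blast
  have "\<bar>\<phi> (g x)\<bar> \<le> \<bar>\<phi> 0\<bar> + L * B" for x
    using lipschitz[of "g x" 0] mult_left_mono[OF B(2)[of x] L] by (simp; linarith)
  then have "(\<lambda>x. \<phi> (g x)) \<in> Cb"
    using continuous_on_compose2[OF lipschitz_on_continuous_on[OF \<phi>] Cb_continuous_on[OF g(1)]]
    by (intro CbI) auto
  moreover have "\<bar>\<phi> (f x) - \<phi> (g x)\<bar> \<le> \<epsilon> * \<rho> x" for x
  proof -
    have "\<bar>\<phi> (f x) - \<phi> (g x)\<bar> \<le> L * (\<epsilon> / (L + 1) * \<rho> x)"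
      using lipschitz[of "f x" "g x"] mult_left_mono[OF g(2)[of x] L] by linarith
    also have "\<dots> = L / (L + 1) * (\<epsilon> * \<rho> x)" by simp
    also have "\<dots> \<le> 1 * (\<epsilon> * \<rho> x)"
      using L \<open>\<epsilon> > 0\<close> rho_nonneg[of x] by (intro mult_right_mono) auto
    finally show ?thesis by simp
  qed
  ultimately show "\<exists>h\<in>Cb. \<forall>x. \<bar>\<phi> (f x) - h x\<bar> \<le> \<epsilon> * \<rho> x"
    by (intro bexI[of _ "\<lambda>x. \<phi> (g x)"]) auto
qed

lemma Brho_cmult: "f \<in> Brho \<rho> \<Longrightarrow> (\<lambda>x. c * f x) \<in> Brho \<rho>"
  by (rule Brho_lipschitz_compose[of f "\<bar>c\<bar>"])
     (auto intro!: lipschitz_onI simp: dist_real_def simp flip: abs_mult right_diff_distrib)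

lemma Brho_diff: "f \<in> Brho \<rho> \<Longrightarrow> g \<in> Brho \<rho> \<Longrightarrow> (\<lambda>x. f x - g x) \<in> Brho \<rho>"
  using Brho_add[of f "\<lambda>x. (-1) * g x"] Brho_cmult[of g "-1"] by simp

lemma Brho_pos_part: "f \<in> Brho \<rho> \<Longrightarrow> (\<lambda>x. max 0 (f x)) \<in> Brho \<rho>"
  by (rule Brho_lipschitz_compose[of f 1]) (auto intro!: lipschitz_onI simp: dist_real_def max_def)

lemma Brho_sum: "(\<And>i. i \<in> A \<Longrightarrow> f i \<in> Brho \<rho>) \<Longrightarrow> (\<lambda>x. \<Sum>i\<in>A. f i x) \<in> Brho \<rho>"
  by (induction A rule: infinite_finite_induct) (auto simp: Brho_const intro: Brho_add)

definition sublevel_continuous :: "('a \<Rightarrow> real) \<Rightarrow> bool" where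
  "sublevel_continuous f \<longleftrightarrow> (\<forall>R. continuous_on {x. \<rho> x \<le> R} f)"

lemma Brho_sublevel_continuous:
  assumes f: "f \<in> Brho \<rho>" shows "sublevel_continuous f"
  unfolding sublevel_continuous_def
proof
  fix R
  have "\<exists>g. \<forall>\<epsilon>>0. g \<epsilon> \<in> Cb \<and> (\<forall>x. \<bar>f x - g \<epsilon> x\<bar> \<le> \<epsilon> * \<rho> x)"
    using f unfolding Brho_iff by (intro choice) blast
  then obtain g where g: "\<And>\<epsilon>. \<epsilon> > 0 \<Longrightarrow> g \<epsilon> \<in> Cb" "\<And>\<epsilon> x. \<epsilon> > 0 \<Longrightarrow> \<bar>f x - g \<epsilon> x\<bar> \<le> \<epsilon> * \<rho> x"
    by blast
  have "uniform_limit {x. \<rho> x \<le> R} g f (at_right 0)"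
    unfolding uniform_limit_iff
  proof (intro allI impI)
    fix e :: real assume "e > 0"
    show "\<forall>\<^sub>F \<epsilon> in at_right 0. \<forall>x\<in>{x. \<rho> x \<le> R}. dist (g \<epsilon> x) (f x) < e"
    proof (rule eventually_at_rightI[of 0 "e / (\<bar>R\<bar> + 1)"], safe)
      fix \<epsilon> x assume \<epsilon>: "\<epsilon> \<in> {0<..<e / (\<bar>R\<bar> + 1)}" and "\<rho> x \<le> R"
      have "\<bar>f x - g \<epsilon> x\<bar> \<le> \<epsilon> * \<rho> x" using \<epsilon> by (intro g) simp
      also have "\<dots> \<le> \<epsilon> * (\<bar>R\<bar> + 1)" using \<epsilon> \<open>\<rho> x \<le> R\<close> by (intro mult_left_mono) auto
      also have "\<dots> < e" using \<epsilon> by (simp add: pos_less_divide_eq)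
      finally show "dist (g \<epsilon> x) (f x) < e" by (simp add: dist_real_def abs_minus_commute)
    qed (use \<open>e > 0\<close> in auto)
  qed
  moreover have "\<forall>\<^sub>F \<epsilon> in at_right 0. continuous_on {x. \<rho> x \<le> R} (g \<epsilon>)"
    using g(1) by (intro eventually_at_rightI[of 0 1] Cb_continuous_on) auto
  ultimately show "continuous_on {x. \<rho> x \<le> R} f"
    by (intro uniform_limit_theorem) auto
qed

lemma sublevel_continuous_openE:
  assumes "sublevel_continuous f"
  obtains W where "open W" "\<And>x. \<rho> x \<le> R \<Longrightarrow> x \<in> W \<longleftrightarrow> r < f x"
proof -
  obtain W where "open W" "W \<inter> {x. \<rho> x \<le> R} = f -` {r<..} \<inter> {x. \<rho> x \<le> R}"
    using assms continuous_on_open_invariant[of "{x. \<rho> x \<le> R}" f]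
    unfolding sublevel_continuous_def by (metis open_greaterThan)
  then show thesis by (intro that) auto
qed

lemma borel_measurable_SUP_sublevel_continuous:
  assumes cont: "\<And>i. i \<in> I \<Longrightarrow> sublevel_continuous (f i)"
    and "I \<noteq> {}" and bdd: "\<And>x. bdd_above ((\<lambda>i. f i x) ` I)"
  shows "(\<lambda>x. SUP i\<in>I. f i x) \<in> borel_measurable borel"
proof (rule borel_measurableI_greater)
  fix r
  have "{x. \<rho> x \<le> R \<and> (\<exists>i\<in>I. r < f i x)} \<in> sets borel" for R
  proof -
    have "\<exists>W. open W \<and> (\<forall>x. \<rho> x \<le> R \<longrightarrow> (x \<in> W \<longleftrightarrow> r < f i x))" if "i \<in> I" for i
      using sublevel_continuous_openE[OF cont[OF that]] by metis
    then obtain W where W: "\<And>i. i \<in> I \<Longrightarrow> open (W i)"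
      "\<And>i x. i \<in> I \<Longrightarrow> \<rho> x \<le> R \<Longrightarrow> x \<in> W i \<longleftrightarrow> r < f i x"
      by metis
    have "{x. \<rho> x \<le> R \<and> (\<exists>i\<in>I. r < f i x)} = (\<Union>i\<in>I. W i) \<inter> {x. \<rho> x \<le> R}"
      using W(2) by blast
    also have "\<dots> \<in> sets borel"
      using W(1) closed_sublevel by (intro sets.Int borel_open borel_closed) auto
    finally show ?thesis .
  qed
  then have "(\<Union>n. {x. \<rho> x \<le> real n \<and> (\<exists>i\<in>I. r < f i x)}) \<in> sets borel" by blast
  also have "(\<Union>n. {x. \<rho> x \<le> real n \<and> (\<exists>i\<in>I. r < f i x)}) = {x \<in> space borel. r < (SUP i\<in>I. f i x)}"
    using real_arch_simple by (auto simp: less_cSUP_iff[OF \<open>I \<noteq> {}\<close> bdd])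
  finally show "{x \<in> space borel. r < (SUP i\<in>I. f i x)} \<in> sets borel" .
qed

lemma sublevel_continuous_borel: "sublevel_continuous f \<Longrightarrow> f \<in> borel_measurable borel"
  using borel_measurable_SUP_sublevel_continuous[of "{()}" "\<lambda>_. f"] by simp

lemma Brho_borel[measurable]: "f \<in> Brho \<rho> \<Longrightarrow> f \<in> borel_measurable borel"
  by (intro sublevel_continuous_borel Brho_sublevel_continuous)

lemma Brho_measurable: "sets \<nu> = sets borel \<Longrightarrow> f \<in> Brho \<rho> \<Longrightarrow> f \<in> borel_measurable \<nu>"
  using Brho_borel by (simp add: measurable_cong_sets[of \<nu> borel])

end

section \<open>Riesz representation of positive functionals\<close>

definition staircase :: "real \<Rightarrow> nat \<Rightarrow> real \<Rightarrow> real" where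
  "staircase \<delta> n y = (\<Sum>i<n. if real i * \<delta> < y then \<delta> else 0)"

lemma staircase_nonneg: "0 \<le> \<delta> \<Longrightarrow> 0 \<le> staircase \<delta> n y"
  by (auto simp: staircase_def intro: sum_nonneg)

lemma staircase_le:
  assumes "0 \<le> y" "0 < \<delta>" shows "staircase \<delta> n y \<le> y + \<delta>"
proof -
  have "staircase \<delta> n y \<le> y + \<delta> \<and> staircase \<delta> n y \<le> real n * \<delta>"
    using assms by (induction n) (auto simp: staircase_def algebra_simps)
  then show ?thesis ..
qed

lemma min_le_staircase:
  assumes "0 \<le> y" "0 < \<delta>" shows "min y (real n * \<delta>) \<le> staircase \<delta> n y"
  using assms by (induction n) (auto simp: staircase_def algebra_simps min_def split: if_splits)

lemma slice_sum:
  fixes y \<delta> :: real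
  assumes "0 \<le> y" "0 < \<delta>"
  shows "(\<Sum>i<n. max 0 (min (y - real i * \<delta>) \<delta>)) = min y (real n * \<delta>)"
  using assms by (induction n) (auto simp: algebra_simps min_def max_def)

context prob_space
begin

lemma
  assumes f[measurable]: "f \<in> borel_measurable M"
  shows integrable_staircase: "integrable M (\<lambda>x. staircase \<delta> n (f x))"
    and integral_staircase: "(\<integral>x. staircase \<delta> n (f x) \<partial>M) =
        (\<Sum>i<n. \<delta> * measure M {x\<in>space M. real i * \<delta> < f x})"
proof -
  define S where "S x = (\<Sum>i<n. \<delta> * indicator {x\<in>space M. real i * \<delta> < f x} x)" for x
  have step: "integrable M (\<lambda>x. \<delta> * indicator {x\<in>space M. real i * \<delta> < f x} x)" for i
    by (intro integrable_mult_right) (auto simp: emeasure_eq_measure)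
  have eq: "staircase \<delta> n (f x) = S x" if "x \<in> space M" for x
    unfolding staircase_def S_def using that by (intro sum.cong) auto
  have "integrable M S" unfolding S_def by (intro Bochner_Integration.integrable_sum step)
  then show "integrable M (\<lambda>x. staircase \<delta> n (f x))"
    by (simp add: eq cong: Bochner_Integration.integrable_cong)
  have "(\<integral>x. S x \<partial>M) = (\<Sum>i<n. \<delta> * measure M {x\<in>space M. real i * \<delta> < f x})"
    unfolding S_def by (subst Bochner_Integration.integral_sum[OF step])
      (simp add: emeasure_eq_measure)
  then show "(\<integral>x. staircase \<delta> n (f x) \<partial>M) = (\<Sum>i<n. \<delta> * measure M {x\<in>space M. real i * \<delta> < f x})"
    by (simp add: eq cong: Bochner_Integration.integral_cong)
qed

lemma
  assumes f: "f \<in> borel_measurable M" and unit: "\<And>x. 0 \<le> f x" "\<And>x. f x \<le> (1::real)"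
    and \<delta>: "\<delta> > 0"
  shows layer_sum_le_integral: "(\<Sum>i<n. \<delta> * measure M {x\<in>space M. real i * \<delta> < f x}) \<le>
      (\<integral>x. f x \<partial>M) + \<delta>"
    and integral_le_layer_sum: "real n * \<delta> = 1 \<Longrightarrow> (\<integral>x. f x \<partial>M) \<le>
        (\<Sum>i<n. \<delta> * measure M {x\<in>space M. real i * \<delta> < f x})"
proof -
  have int: "integrable M f" using f unit by (intro integrable_const_bound[of _ 1]) auto
  have "(\<integral>x. staircase \<delta> n (f x) \<partial>M) \<le> (\<integral>x. f x + \<delta> \<partial>M)"
    using int by (intro integral_mono integrable_staircase f staircase_le unit \<delta>) auto
  then show "(\<Sum>i<n. \<delta> * measure M {x\<in>space M. real i * \<delta> < f x}) \<le> (\<integral>x. f x \<partial>M) + \<delta>"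
    using int by (simp add: integral_staircase[OF f] prob_space)
  assume "real n * \<delta> = 1"
  then have "f x \<le> staircase \<delta> n (f x)" for x
    using min_le_staircase[OF unit(1)[of x] \<delta>, of n] unit(2)[of x] by simp
  then have "(\<integral>x. f x \<partial>M) \<le> (\<integral>x. staircase \<delta> n (f x) \<partial>M)"
    by (intro integral_mono int integrable_staircase f)
  then show "(\<integral>x. f x \<partial>M) \<le> (\<Sum>i<n. \<delta> * measure M {x\<in>space M. real i * \<delta> < f x})"
    by (simp add: integral_staircase[OF f])
qed

lemma nn_integral_le_if_layer_sums_le:
  assumes f: "f \<in> borel_measurable M" and nonneg: "\<And>x. 0 \<le> f x" and \<delta>: "\<delta> > 0"
    and bound: "\<And>n. (\<Sum>i<n. \<delta> * measure M {x\<in>space M. real i * \<delta> < f x}) \<le> B"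
  shows "(\<integral>\<^sup>+x. ennreal (f x) \<partial>M) \<le> ennreal B"
proof -
  have "incseq (\<lambda>n. staircase \<delta> n y)" for y
    using \<delta> by (intro incseq_SucI) (simp add: staircase_def)
  then have incseq: "incseq (\<lambda>n x. ennreal (staircase \<delta> n (f x)))"
    by (auto simp: incseq_def le_fun_def intro: ennreal_leI)
  have "ennreal (f x) \<le> (SUP n. ennreal (staircase \<delta> n (f x)))" for x
  proof -
    obtain n where "f x / \<delta> \<le> real n" using real_arch_simple by blast
    then have "f x \<le> staircase \<delta> n (f x)"
      using min_le_staircase[OF nonneg \<delta>, of x n] \<delta> by (simp add: pos_divide_le_eq)
    then show ?thesis by (intro SUP_upper2[of n] ennreal_leI) auto
  qed
  then have "(\<integral>\<^sup>+x. ennreal (f x) \<partial>M) \<le> (\<integral>\<^sup>+x. (SUP n. ennreal (staircase \<delta> n (f x))) \<partial>M)"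
    by (rule nn_integral_mono)
  also have "\<dots> = (SUP n. \<integral>\<^sup>+x. ennreal (staircase \<delta> n (f x)) \<partial>M)"
    using borel_measurable_integrable[OF integrable_staircase[OF f]]
    by (intro nn_integral_monotone_convergence_SUP incseq) auto
  also have "\<dots> \<le> ennreal B"
  proof (rule SUP_least)
    fix n
    have "(\<integral>\<^sup>+x. ennreal (staircase \<delta> n (f x)) \<partial>M) = ennreal (\<integral>x. staircase \<delta> n (f x) \<partial>M)"
      using \<delta> by (intro nn_integral_eq_integral integrable_staircase f AE_I2 staircase_nonneg) simp
    also have "\<dots> \<le> ennreal B" using bound[of n] by (simp add: integral_staircase[OF f] ennreal_leI)
    finally show "(\<integral>\<^sup>+x. ennreal (staircase \<delta> n (f x)) \<partial>M) \<le> ennreal B" .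
  qed
  finally show ?thesis .
qed

end

locale weighted_functional = weighted \<rho> for \<rho> :: "'a::topological_space \<Rightarrow> real" +
  fixes L :: "('a \<Rightarrow> real) \<Rightarrow> real" and c :: real
  assumes L_add: "\<And>f g. f \<in> Brho \<rho> \<Longrightarrow> g \<in> Brho \<rho> \<Longrightarrow> L (\<lambda>x. f x + g x) = L f + L g"
    and L_cmult: "\<And>f a. f \<in> Brho \<rho> \<Longrightarrow> L (\<lambda>x. a * f x) = a * L f"
    and L_nonneg: "\<And>f. f \<in> Brho \<rho> \<Longrightarrow> (\<And>x. 0 \<le> f x) \<Longrightarrow> 0 \<le> L f"
    and L_one: "L (\<lambda>x. 1) = 1"
    and L_le_wnorm: "\<And>f. f \<in> Brho \<rho> \<Longrightarrow> L f \<le> c * wnorm \<rho> f"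
    and c_nonneg: "c \<ge> 0"
begin

lemma L_diff: "f \<in> Brho \<rho> \<Longrightarrow> g \<in> Brho \<rho> \<Longrightarrow> L (\<lambda>x. f x - g x) = L f - L g"
  using L_add[of f "\<lambda>x. (-1) * g x"] Brho_cmult[of g "-1"] L_cmult[of g "-1"] by simp

lemma L_mono: "f \<in> Brho \<rho> \<Longrightarrow> g \<in> Brho \<rho> \<Longrightarrow> (\<And>x. f x \<le> g x) \<Longrightarrow> L f \<le> L g"
  using L_nonneg[of "\<lambda>x. g x - f x"] L_diff[of g f] Brho_diff[of g f] by simp

lemma L_const: "L (\<lambda>x. a) = a"
  using L_cmult[OF Brho_const[of 1], of a] L_one by simp

lemma L_sum: "(\<And>i. i \<in> A \<Longrightarrow> f i \<in> Brho \<rho>) \<Longrightarrow> L (\<lambda>x. \<Sum>i\<in>A. f i x) = (\<Sum>i\<in>A. L (f i))"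
  by (induction A rule: infinite_finite_induct) (auto simp: L_const L_add Brho_sum)

lemma L_le_if_le_weight:
  assumes f: "f \<in> Brho \<rho>" and M: "M \<ge> 0" "\<And>x. f x \<le> M * \<rho> x"
  shows "L f \<le> c * M"
proof -
  have "L f \<le> L (\<lambda>x. max 0 (f x))" by (intro L_mono Brho_pos_part f) auto
  also have "\<dots> \<le> c * wnorm \<rho> (\<lambda>x. max 0 (f x))" by (intro L_le_wnorm Brho_pos_part f)
  also have "\<dots> \<le> c * M"
    using M rho_nonneg by (intro mult_left_mono wnorm_le c_nonneg) (auto simp: max_def)
  finally show ?thesis .
qed

lemma L_diff_le_if_diff_le_weight:
  assumes "f \<in> Brho \<rho>" "g \<in> Brho \<rho>" "\<epsilon> \<ge> 0" "\<And>x. \<bar>f x - g x\<bar> \<le> \<epsilon> * \<rho> x"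
  shows "\<bar>L f - L g\<bar> \<le> c * \<epsilon>"
proof -
  have "L (\<lambda>x. f x - g x) \<le> c * \<epsilon>" "L (\<lambda>x. g x - f x) \<le> c * \<epsilon>"
    using assms(4)[THEN abs_le_D1] assms(4)[THEN abs_le_D2] assms
    by (auto intro!: L_le_if_le_weight Brho_diff)
  then show ?thesis using L_diff[OF assms(1,2)] L_diff[OF assms(2,1)] by linarith
qed

lemma L_cutoff: assumes "f \<in> cutoffs U" shows "0 \<le> L f" "L f \<le> 1"
  using L_nonneg[OF cutoffs_Brho[OF assms]] L_mono[OF cutoffs_Brho[OF assms] Brho_const[of 1]]
    cutoffs_nonneg[OF assms] cutoffs_le_1[OF assms] L_one by auto

definition inner_content :: "'a set \<Rightarrow> ennreal" where
  "inner_content U = (SUP f\<in>cutoffs U. ennreal (L f))"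

definition outer_content :: "'a set \<Rightarrow> ennreal" where
  "outer_content A = (INF U\<in>{U. open U \<and> A \<subseteq> U}. inner_content U)"

lemma inner_content_le_1: "inner_content U \<le> 1"
  unfolding inner_content_def using L_cutoff(2) by (auto intro!: SUP_least)

lemma inner_content_mono: "U \<subseteq> V \<Longrightarrow> inner_content U \<le> inner_content V"
  unfolding inner_content_def by (intro SUP_subset_mono cutoffs_mono order_refl)

lemma L_le_inner_content: "f \<in> cutoffs U \<Longrightarrow> ennreal (L f) \<le> inner_content U"
  unfolding inner_content_def by (rule SUP_upper)

lemma inner_content_approx:
  assumes "e > 0" obtains f where "f \<in> cutoffs U" "inner_content U \<le> ennreal (L f + e)"
proof -
  have "\<exists>f\<in>cutoffs U. inner_content U < ennreal (L f) + ennreal e"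
    using inner_content_le_1[of U] zero_in_cutoffs[of U]
    by (intro SUP_approx_ennreal[OF assms]) (auto simp: inner_content_def[symmetric] top_unique)
  then show thesis using L_cutoff(1) assms that by (auto simp: ennreal_plus intro: less_imp_le)
qed

lemma cutoff_UN_le_sum:
  fixes U :: "nat \<Rightarrow> 'a set"
  assumes f: "f \<in> cutoffs (\<Union>n. U n)" and open_U: "\<And>n. open (U n)" and e: "e > 0" "\<epsilon> > 0"
  obtains N g where "\<And>n. g n \<in> cutoffs (U n)" "\<And>x. f x \<le> e + (\<Sum>n<N. g n x) + \<epsilon> * \<rho> x"
proof -
  define C where "C = {x. \<rho> x \<le> 1 / \<epsilon>} \<inter> {x. e \<le> f x}"
  have compact: "compact C" unfolding C_def
    by (intro compact_Int_closed compact_sublevel closed_Collect_le continuous_on_const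
        cutoffs_continuous_on[OF f])
  have subset: "C \<subseteq> (\<Union>n. U n)" using cutoffs_eq_0[OF f] e(1) by (force simp: C_def)
  obtain N g where g: "\<And>n. g n \<in> cutoffs (U n)" "\<And>x. x \<in> C \<Longrightarrow> 1 \<le> (\<Sum>n<N. g n x)"
    by (rule compact_cover_cutoffs[OF completely_regular compact subset open_U]) blast
  have "f x \<le> e + (\<Sum>n<N. g n x) + \<epsilon> * \<rho> x" for x
  proof -
    have sum_nonneg: "0 \<le> (\<Sum>n<N. g n x)" using cutoffs_nonneg[OF g(1)] by (intro sum_nonneg) auto
    have weight_nonneg: "0 \<le> \<epsilon> * \<rho> x" using e rho_nonneg by simp
    consider (in_C) "x \<in> C" | (large_weight) "\<rho> x > 1 / \<epsilon>" | (small_value) "f x < e"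
      using linorder_le_less_linear[of "\<rho> x" "1 / \<epsilon>"] linorder_le_less_linear[of e "f x"]
      by (auto simp: C_def)
    then show ?thesis
    proof cases
      case in_C
      with g(2)[OF in_C] cutoffs_le_1[OF f, of x] weight_nonneg e show ?thesis by linarith
    next
      case large_weight
      then have "1 \<le> \<epsilon> * \<rho> x" using e by (simp add: field_simps)
      with cutoffs_le_1[OF f, of x] sum_nonneg e show ?thesis by linarith
    qed (use sum_nonneg weight_nonneg in linarith)
  qed
  with g(1) show thesis by (rule that)
qed

lemma L_cutoff_UN_le_sum:
  fixes U :: "nat \<Rightarrow> 'a set"
  assumes f: "f \<in> cutoffs (\<Union>n. U n)" and open_U: "\<And>n. open (U n)" and e: "e > 0"
  obtains N g where "\<And>n. g n \<in> cutoffs (U n)" "L f \<le> (\<Sum>n<N. L (g n)) + e"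
proof -
  define \<epsilon> where "\<epsilon> = e / (2 * (c + 1))"
  have \<epsilon>: "\<epsilon> > 0" "c * \<epsilon> \<le> e / 2" using e c_nonneg by (auto simp: \<epsilon>_def field_simps)
  obtain N g where g: "\<And>n. g n \<in> cutoffs (U n)" "\<And>x. f x \<le> e / 2 + (\<Sum>n<N. g n x) + \<epsilon> * \<rho> x"
    by (rule cutoff_UN_le_sum[OF f open_U half_gt_zero[OF e] \<epsilon>(1)]) blast
  define s where "s x = e / 2 + (\<Sum>n<N. g n x)" for x
  have gB: "g n \<in> Brho \<rho>" for n by (rule cutoffs_Brho[OF g(1)])
  have sB: "s \<in> Brho \<rho>" unfolding s_def by (intro Brho_add Brho_const Brho_sum gB)
  have "L f - L s = L (\<lambda>x. f x - s x)" by (intro L_diff[symmetric] cutoffs_Brho[OF f] sB)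
  also have "\<dots> \<le> c * \<epsilon>"
    using g(2) \<epsilon>(1) by (intro L_le_if_le_weight Brho_diff cutoffs_Brho[OF f] sB)
      (auto simp: s_def algebra_simps)
  finally have "L f \<le> L s + e / 2" using \<epsilon>(2) by simp
  also have "L s = e / 2 + (\<Sum>n<N. L (g n))"
    unfolding s_def by (simp add: L_add[OF Brho_const Brho_sum[OF gB]] L_const L_sum[OF gB])
  finally have "L f \<le> (\<Sum>n<N. L (g n)) + e" by simp
  with g(1) show thesis by (rule that)
qed

lemma inner_content_subadditive:
  assumes "\<And>n. open (U n)"
  shows "inner_content (\<Union>n. U n) \<le> (\<Sum>n. inner_content (U n))"
  unfolding inner_content_def[of "\<Union>n. U n"]
proof (rule SUP_least, rule ennreal_le_epsilon)
  fix f and e :: real assume f: "f \<in> cutoffs (\<Union>n. U n)" and "e > 0"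
  obtain N g where g: "\<And>n. g n \<in> cutoffs (U n)" "L f \<le> (\<Sum>n<N. L (g n)) + e"
    by (rule L_cutoff_UN_le_sum[OF f assms \<open>e > 0\<close>]) blast
  have "ennreal (L f) \<le> ennreal (\<Sum>n<N. L (g n)) + ennreal e"
    using g(2) \<open>e > 0\<close> L_cutoff(1)[OF g(1)]
    by (subst ennreal_plus[symmetric]) (auto intro!: sum_nonneg ennreal_leI)
  also have "ennreal (\<Sum>n<N. L (g n)) = (\<Sum>n<N. ennreal (L (g n)))"
    using L_cutoff(1)[OF g(1)] by (intro sum_ennreal[symmetric]) auto
  also have "\<dots> \<le> (\<Sum>n<N. inner_content (U n))" by (intro sum_mono L_le_inner_content g)
  also have "\<dots> \<le> (\<Sum>n. inner_content (U n))" by (intro sum_le_suminf) auto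
  finally show "ennreal (L f) \<le> (\<Sum>n. inner_content (U n)) + ennreal e" by (simp add: add_mono)
qed

lemma cutoffs_glue:
  assumes f: "f \<in> cutoffs U" and e: "e > 0" and h: "h \<in> cutoffs (U - {x. e \<le> f x})"
  shows "(\<lambda>x. max 0 (f x - e) + h x) \<in> cutoffs U"
proof (rule cutoffsI)
  show "continuous_on UNIV (\<lambda>x. max 0 (f x - e) + h x)"
    by (intro continuous_intros cutoffs_continuous_on[OF f] cutoffs_continuous_on[OF h])
  show "0 \<le> max 0 (f x - e) + h x" for x using cutoffs_nonneg[OF h] by simp
  show "max 0 (f x - e) + h x \<le> 1" for x
    using cutoffs_eq_0[OF h, of x] cutoffs_le_1[OF f, of x] cutoffs_le_1[OF h, of x] e
    by (cases "e \<le> f x") auto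
  show "max 0 (f x - e) + h x = 0" if "x \<notin> U" for x
    using cutoffs_eq_0[OF h, of x] cutoffs_eq_0[OF f, of x] that e by simp
qed

lemma L_add_le_inner_content:
  assumes f: "f \<in> cutoffs U" and e: "e > 0" and h: "h \<in> cutoffs (U - {x. e \<le> f x})"
  shows "ennreal (L f + L h) \<le> inner_content U + ennreal e"
proof -
  define k where "k x = max 0 (f x - e) + h x" for x
  have k: "k \<in> cutoffs U" unfolding k_def by (rule cutoffs_glue[OF f e h])
  have fe: "(\<lambda>x. f x - e) \<in> Brho \<rho>" by (intro Brho_diff Brho_const cutoffs_Brho[OF f])
  have "L f - e = L (\<lambda>x. f x - e)"
    using L_diff[OF cutoffs_Brho[OF f] Brho_const[of e]] L_const by simp
  also have "\<dots> \<le> L (\<lambda>x. max 0 (f x - e))" by (intro L_mono fe Brho_pos_part) simp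
  finally have "L f + L h \<le> L k + e"
    using L_add[OF Brho_pos_part[OF fe] cutoffs_Brho[OF h]] by (simp add: k_def[abs_def])
  then have "ennreal (L f + L h) \<le> ennreal (L k) + ennreal e"
    using L_cutoff(1)[OF k] e by (simp add: ennreal_leI flip: ennreal_plus)
  also have "\<dots> \<le> inner_content U + ennreal e" by (intro add_right_mono L_le_inner_content k)
  finally show ?thesis .
qed

lemma outer_content_open: "open U \<Longrightarrow> outer_content U = inner_content U"
  unfolding outer_content_def
  by (intro antisym INF_lower2[of U] INF_greatest inner_content_mono) auto

lemma outer_content_mono: "A \<subseteq> B \<Longrightarrow> outer_content A \<le> outer_content B"
  unfolding outer_content_def by (intro INF_superset_mono) auto

lemma outer_content_le_1: "outer_content A \<le> 1"
  using outer_content_mono[of A UNIV] inner_content_le_1[of UNIV] outer_content_open[of UNIV]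
  by auto

lemma outer_content_approx:
  assumes "e > 0" obtains U where "open U" "A \<subseteq> U" "inner_content U \<le> outer_content A + ennreal e"
proof -
  have "\<exists>U\<in>{U. open U \<and> A \<subseteq> U}. inner_content U < outer_content A + ennreal e"
    using outer_content_le_1[of A]
    by (intro INF_approx_ennreal[OF assms]) (auto simp: outer_content_def[symmetric] top_unique)
  then show thesis using that by (auto intro: less_imp_le)
qed

lemma outer_content_empty: "outer_content {} = 0"
proof -
  have "f = (\<lambda>x. 0)" if "f \<in> cutoffs {}" for f using cutoffs_eq_0[OF that] by auto
  then have "cutoffs {} = {\<lambda>x::'a. 0}" using zero_in_cutoffs by auto
  then have "inner_content {} = 0" by (simp add: inner_content_def L_const)
  then show ?thesis by (simp add: outer_content_open)
qed

lemma outer_content_subadditive: "outer_content (\<Union>n. A n) \<le> (\<Sum>n. outer_content (A (n::nat)))"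
proof (rule ennreal_le_epsilon)
  fix e :: real assume e: "e > 0"
  have "\<exists>U. open U \<and> A n \<subseteq> U \<and> inner_content U \<le> outer_content (A n) + e * (1/2)^Suc n" for n
    using outer_content_approx[of "e * (1/2)^Suc n" "A n"] e
    by (metis mult_pos_pos zero_less_power half_gt_zero zero_less_one)
  then obtain U where U: "\<And>n. open (U n)" "\<And>n. A n \<subseteq> U n"
     "\<And>n. inner_content (U n) \<le> outer_content (A n) + e * (1/2)^Suc n" by metis
  have "outer_content (\<Union>n. A n) \<le> outer_content (\<Union>n. U n)"
    using U(2) by (intro outer_content_mono) blast
  also have "\<dots> = inner_content (\<Union>n. U n)" using U(1) by (intro outer_content_open) auto
  also have "\<dots> \<le> (\<Sum>n. inner_content (U n))" by (rule inner_content_subadditive) fact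
  also have "\<dots> \<le> (\<Sum>n. outer_content (A n) + e * (1/2) ^ Suc n)"
    by (intro suminf_le U) auto
  also have "\<dots> = (\<Sum>n. outer_content (A n)) + (\<Sum>n. ennreal e * ennreal ((1/2) ^ Suc n))"
    using e by (subst suminf_add[symmetric])
               (auto simp del: ennreal_suminf_cmult simp add: ennreal_mult[symmetric])
  also have "\<dots> = (\<Sum>n. outer_content (A n)) + e"
    unfolding ennreal_suminf_cmult
    by (subst suminf_ennreal_eq[OF zero_le_power power_half_series]) auto
  finally show "outer_content (\<Union>n. A n) \<le> (\<Sum>n. outer_content (A n)) + e" .
qed

lemma outer_content_Un: "outer_content (A \<union> B) \<le> outer_content A + outer_content B"
proof -
  have "outer_content (A \<union> B) = outer_content (\<Union>n. binaryset A B n)" by (simp add: UN_binaryset_eq)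
  also have "\<dots> \<le> (\<Sum>n. outer_content (binaryset A B n))" by (rule outer_content_subadditive)
  also have "\<dots> = outer_content A + outer_content B"
    using suminf_binaryset_eq[of outer_content A B] outer_content_empty by simp
  finally show ?thesis .
qed

lemma inner_content_split:
  assumes U: "open U"
  shows "inner_content (U \<inter> V) + outer_content (U - V) \<le> inner_content U"
proof (rule ennreal_le_epsilon)
  fix e' :: real assume "e' > 0"
  define e where "e = e' / 3"
  have e: "e > 0" using \<open>e' > 0\<close> by (simp add: e_def)
  obtain f where f: "f \<in> cutoffs (U \<inter> V)" "inner_content (U \<inter> V) \<le> ennreal (L f + e)"
    by (rule inner_content_approx[OF e])
  define F where "F = {x. e \<le> f x}"
  have F: "closed F" "F \<subseteq> V"
    using cutoffs_continuous_on[OF f(1)] cutoffs_eq_0[OF f(1)] e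
    by (force simp: F_def intro!: closed_Collect_le)+
  obtain h where h: "h \<in> cutoffs (U - F)" "inner_content (U - F) \<le> ennreal (L h + e)"
    by (rule inner_content_approx[OF e])
  have "outer_content (U - V) \<le> inner_content (U - F)"
    using U F by (subst outer_content_open[symmetric]) (auto intro!: outer_content_mono)
  then have "inner_content (U \<inter> V) + outer_content (U - V) \<le> ennreal (L f + e) + ennreal (L h + e)"
    using f(2) h(2) by (intro add_mono) auto
  also have "\<dots> = ennreal (L f + L h) + ennreal (2 * e)"
    using L_cutoff(1)[OF f(1)] L_cutoff(1)[OF h(1)] e by (simp flip: ennreal_plus)
  also have "\<dots> \<le> (inner_content U + ennreal e) + ennreal (2 * e)"
  proof (rule add_right_mono, rule L_add_le_inner_content[OF _ e])
    show "f \<in> cutoffs U" using f(1) cutoffs_mono[of "U \<inter> V" U] by auto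
    show "h \<in> cutoffs (U - {x. e \<le> f x})" using h(1) by (simp add: F_def)
  qed
  also have "\<dots> = inner_content U + ennreal e'"
    using e by (simp add: add.assoc e_def flip: ennreal_plus)
  finally show "inner_content (U \<inter> V) + outer_content (U - V) \<le> inner_content U + ennreal e'" .
qed

lemma outer_content_split_open:
  assumes V: "open V"
  shows "outer_content (A \<inter> V) + outer_content (A - V) \<le> outer_content A"
  unfolding outer_content_def[of A]
proof (rule INF_greatest)
  fix U assume "U \<in> {U. open U \<and> A \<subseteq> U}"
  then have U: "open U" "A \<subseteq> U" by auto
  have "outer_content (A \<inter> V) + outer_content (A - V) \<le>
      outer_content (U \<inter> V) + outer_content (U - V)"
    using U by (intro add_mono outer_content_mono) auto
  also have "\<dots> \<le> inner_content U"
    using inner_content_split[OF U(1)] U(1) V by (simp add: outer_content_open open_Int)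
  finally show "outer_content (A \<inter> V) + outer_content (A - V) \<le> inner_content U" .
qed

definition riesz_measure :: "'a measure" where
  "riesz_measure = measure_of UNIV (sets borel) outer_content"

lemma sets_riesz[simp, measurable_cong]: "sets riesz_measure = sets borel"
  unfolding riesz_measure_def
  by (metis sets.sigma_sets_eq sets_measure_of space_borel subset_UNIV Pow_UNIV)

lemma space_riesz[simp]: "space riesz_measure = UNIV"
  using sets_eq_imp_space_eq[OF sets_riesz] by simp

lemma emeasure_riesz: assumes "A \<in> sets borel" shows "emeasure riesz_measure A = outer_content A"
proof -
  interpret P: sigma_algebra UNIV "UNIV :: 'a set set" by (metis Pow_UNIV sigma_algebra_Pow)
  define S where "S = lambda_system UNIV UNIV outer_content"
  have "outer_measure_space UNIV outer_content"
    unfolding outer_measure_space_def positive_def increasing_def countably_subadditive_def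
    using outer_content_empty outer_content_mono outer_content_subadditive by auto
  then have caratheodory: "measure_space UNIV S outer_content"
    unfolding S_def by (rule P.caratheodory_lemma)
  then interpret S: sigma_algebra UNIV S by (simp add: measure_space_def)
  have "V \<in> S" if "open V" for V
    unfolding S_def P.lambda_system_eq
    using outer_content_split_open[OF that] outer_content_Un[of "x \<inter> V" "x - V" for x]
    by (auto intro!: antisym simp: Int_Diff_Un)
  then have borel_subset: "sets borel \<subseteq> S"
    unfolding borel_def by (auto intro!: S.sigma_sets_subset)
  show ?thesis
  proof (rule emeasure_measure_of[OF riesz_measure_def])
    show "positive (sets riesz_measure) outer_content"
      using outer_content_empty by (simp add: positive_def)
    show "countably_additive (sets riesz_measure) outer_content"
      using caratheodory borel_subset unfolding measure_space_def countably_additive_def sets_riesz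
      by blast
  qed (use assms in auto)
qed

lemma emeasure_riesz_open: "open U \<Longrightarrow> emeasure riesz_measure U = inner_content U"
  by (simp add: emeasure_riesz outer_content_open)

lemma prob_space_riesz: "prob_space riesz_measure"
proof
  have "(\<lambda>x. 1) \<in> cutoffs (UNIV :: 'a set)" by (rule cutoffsI) auto
  from L_le_inner_content[OF this] have "1 \<le> inner_content UNIV" by (simp add: L_one)
  then show "emeasure riesz_measure (space riesz_measure) = 1"
    using inner_content_le_1[of UNIV] by (simp add: emeasure_riesz_open)
qed

sublocale riesz: prob_space riesz_measure by (rule prob_space_riesz)

lemma L_le_measure_riesz: assumes "open U" "f \<in> cutoffs U" shows "L f \<le> measure riesz_measure U"
  using L_le_inner_content[OF assms(2)] assms(1)
  by (simp add: riesz.emeasure_eq_measure flip: emeasure_riesz_open)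

lemma measure_riesz_open_approx:
  assumes "open U" "e > 0" obtains f where "f \<in> cutoffs U" "measure riesz_measure U \<le> L f + e"
proof -
  obtain f where f: "f \<in> cutoffs U" "inner_content U \<le> ennreal (L f + e)"
    by (rule inner_content_approx[OF assms(2)])
  have "measure riesz_measure U \<le> L f + e"
    using f(2) assms L_cutoff(1)[OF f(1)]
    by (simp add: riesz.emeasure_eq_measure del: ennreal_plus flip: emeasure_riesz_open)
  with f(1) show thesis by (rule that)
qed

lemma bdd_above_L_cutoffs: "bdd_above (L ` cutoffs U)"
  using L_cutoff(2) by (auto intro!: bdd_aboveI[of _ 1])

lemma measure_riesz_open:
  assumes U: "open U" shows "measure riesz_measure U = (SUP f\<in>cutoffs U. L f)"
proof (rule antisym)
  show "(SUP f\<in>cutoffs U. L f) \<le> measure riesz_measure U"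
    by (intro cSUP_least cutoffs_nonempty L_le_measure_riesz[OF U])
  show "measure riesz_measure U \<le> (SUP f\<in>cutoffs U. L f)"
  proof (rule field_le_epsilon)
    fix e :: real assume "e > 0"
    then obtain f where f: "f \<in> cutoffs U" "measure riesz_measure U \<le> L f + e"
      using measure_riesz_open_approx[OF U] by blast
    then show "measure riesz_measure U \<le> (SUP f\<in>cutoffs U. L f) + e"
      using cSUP_upper[OF f(1) bdd_above_L_cutoffs] by simp
  qed
qed

lemma integrable_riesz_Cb: assumes "f \<in> Cb" shows "integrable riesz_measure f"
proof -
  obtain B where "\<And>x. \<bar>f x\<bar> \<le> B" using Cb_boundedE[OF assms] by blast
  then show ?thesis using Cb_borel[OF assms] by (intro riesz.integrable_const_bound[of _ B]) auto
qed

lemma L_le_integral_riesz: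
  assumes f: "f \<in> cutoffs UNIV" shows "L f \<le> (\<integral>x. f x \<partial>riesz_measure)"
proof (rule field_le_epsilon)
  fix e :: real assume "e > 0"
  then obtain k where k: "1 / real (Suc k) < e"
    using reals_Archimedean by (auto simp: inverse_eq_divide)
  define \<delta> where "\<delta> = 1 / real (Suc k)"
  have \<delta>: "\<delta> > 0" "real (Suc k) * \<delta> = 1" by (auto simp: \<delta>_def)
  define s where "s i x = max 0 (min (f x - real i * \<delta>) \<delta>)" for i x
  have cutoff: "(\<lambda>x. 1 / \<delta> * s i x) \<in> cutoffs {x. real i * \<delta> < f x}" for i
    unfolding s_def using \<delta>(1)
    by (intro cutoffsI continuous_intros cutoffs_continuous_on[OF f])
      (auto simp: max_def min_def divide_simps)
  have sB: "s i \<in> Brho \<rho>" for i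
    using Brho_cmult[OF cutoffs_Brho[OF cutoff[of i]], of \<delta>] \<delta>(1) by simp
  have L_slice: "L (s i) \<le> \<delta> * measure riesz_measure {x. real i * \<delta> < f x}" for i
  proof -
    have "open {x. real i * \<delta> < f x}"
      by (intro open_Collect_less continuous_on_const cutoffs_continuous_on[OF f])
    from L_le_measure_riesz[OF this cutoff]
    have "1 / \<delta> * L (s i) \<le> measure riesz_measure {x. real i * \<delta> < f x}"
      unfolding L_cmult[OF sB] .
    then show ?thesis using \<delta>(1) by (simp add: divide_le_eq mult.commute)
  qed
  have "(\<Sum>i<Suc k. s i x) = f x" for x
    unfolding s_def slice_sum[OF cutoffs_nonneg[OF f] \<delta>(1)] \<delta>(2)
    by (rule min_absorb1[OF cutoffs_le_1[OF f]])
  then have "L f = (\<Sum>i<Suc k. L (s i))" using L_sum[of "{..<Suc k}" s] sB by presburger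
  also have "\<dots> \<le> (\<Sum>i<Suc k. \<delta> * measure riesz_measure {x. real i * \<delta> < f x})"
    by (intro sum_mono L_slice)
  also have "\<dots> \<le> (\<integral>x. f x \<partial>riesz_measure) + \<delta>"
    using riesz.layer_sum_le_integral[OF
        borel_measurable_integrable[OF integrable_riesz_Cb[OF cutoffs_Cb[OF f]]]
        cutoffs_nonneg[OF f] cutoffs_le_1[OF f] \<delta>(1), of "Suc k"] by simp
  finally show "L f \<le> (\<integral>x. f x \<partial>riesz_measure) + e" using k by (simp add: \<delta>_def)
qed

lemma integral_riesz_cutoff:
  assumes f: "f \<in> cutoffs UNIV" shows "(\<integral>x. f x \<partial>riesz_measure) = L f"
proof (rule antisym)
  have "(\<lambda>x. 1 - f x) \<in> cutoffs UNIV"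
    by (intro cutoffsI continuous_intros cutoffs_continuous_on[OF f])
      (auto simp: cutoffs_nonneg[OF f] cutoffs_le_1[OF f])
  from L_le_integral_riesz[OF this] show "(\<integral>x. f x \<partial>riesz_measure) \<le> L f"
    using L_diff[OF Brho_const[of 1] cutoffs_Brho[OF f]] L_one
        integrable_riesz_Cb[OF cutoffs_Cb[OF f]]
    by (simp add: riesz.prob_space[simplified])
qed (rule L_le_integral_riesz[OF f])

lemma integral_riesz_Cb:
  assumes f: "f \<in> Cb" shows "(\<integral>x. f x \<partial>riesz_measure) = L f"
proof -
  obtain B where B: "B > 0" "\<And>x. \<bar>f x\<bar> \<le> B" using Cb_boundedE[OF f] by blast
  have "1 / (2 * B) * (\<integral>x. f x \<partial>riesz_measure) + 1 / 2 =
      (\<integral>x. 1 / (2 * B) * f x + 1 / 2 \<partial>riesz_measure)"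
    using integrable_riesz_Cb[OF f] by (simp add: riesz.prob_space[simplified])
  also have "\<dots> = L (\<lambda>x. 1 / (2 * B) * f x + 1 / 2)"
    by (rule integral_riesz_cutoff[OF bounded_affine_cutoff[OF f B]])
  also have "\<dots> = 1 / (2 * B) * L f + 1 / 2"
    unfolding L_add[OF Brho_cmult[OF Cb_Brho[OF f]] Brho_const] L_cmult[OF Cb_Brho[OF f]] L_const ..
  finally show ?thesis using B(1) by simp
qed

lemma layer_sum_rho_riesz_le:
  assumes \<delta>: "\<delta> > 0"
  shows "(\<Sum>i<n. \<delta> * measure riesz_measure {x. real i * \<delta> < \<rho> x}) \<le> c * (1 + \<delta> / rho_min)"
proof (rule field_le_epsilon)
  fix e :: real assume "e > 0"
  define d where "d = e / (real n * \<delta> + 1)"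
  have d: "d > 0" "real n * \<delta> * d \<le> e"
    using \<open>e > 0\<close> \<delta> by (auto simp: d_def field_simps add_pos_nonneg)
  have "\<exists>f. f \<in> cutoffs {x. real i * \<delta> < \<rho> x} \<and>
      measure riesz_measure {x. real i * \<delta> < \<rho> x} \<le> L f + d" for i
    using measure_riesz_open_approx[OF open_superlevel d(1)] by blast
  then obtain f where f: "\<And>i. f i \<in> cutoffs {x. real i * \<delta> < \<rho> x}"
    "\<And>i. measure riesz_measure {x. real i * \<delta> < \<rho> x} \<le> L (f i) + d" by metis
  have fB: "f i \<in> Brho \<rho>" for i by (rule cutoffs_Brho[OF f(1)])
  have "(\<Sum>i<n. \<delta> * f i x) \<le> (1 + \<delta> / rho_min) * \<rho> x" for x
  proof -
    have "(\<Sum>i<n. \<delta> * f i x) \<le> staircase \<delta> n (\<rho> x)"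
      unfolding staircase_def using cutoffs_le_1[OF f(1)] cutoffs_eq_0[OF f(1)] \<delta>
      by (intro sum_mono) auto
    also have "\<dots> \<le> \<rho> x + \<delta>" by (rule staircase_le[OF rho_nonneg \<delta>])
    also have "\<dots> \<le> (1 + \<delta> / rho_min) * \<rho> x"
      using le_weight_if_nonneg[of \<delta> x] \<delta> by (simp add: ring_distribs)
    finally show ?thesis .
  qed
  then have "L (\<lambda>x. \<Sum>i<n. \<delta> * f i x) \<le> c * (1 + \<delta> / rho_min)"
    using \<delta> rho_min_pos by (intro L_le_if_le_weight Brho_sum Brho_cmult fB) auto
  then have L_sum_le: "(\<Sum>i<n. \<delta> * L (f i)) \<le> c * (1 + \<delta> / rho_min)"
    by (simp add: L_sum[OF Brho_cmult[OF fB]] L_cmult[OF fB])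
  have "(\<Sum>i<n. \<delta> * measure riesz_measure {x. real i * \<delta> < \<rho> x}) \<le> (\<Sum>i<n. \<delta> * (L (f i) + d))"
    using f(2) \<delta> by (intro sum_mono mult_left_mono) auto
  also have "\<dots> = (\<Sum>i<n. \<delta> * L (f i)) + real n * \<delta> * d" by (simp add: ring_distribs sum.distrib)
  also have "\<dots> \<le> c * (1 + \<delta> / rho_min) + e" using L_sum_le d(2) by (rule add_mono)
  finally show "(\<Sum>i<n. \<delta> * measure riesz_measure {x. real i * \<delta> < \<rho> x}) \<le>
      c * (1 + \<delta> / rho_min) + e" .
qed

lemma nn_integral_rho_riesz: "(\<integral>\<^sup>+x. ennreal (\<rho> x) \<partial>riesz_measure) \<le> ennreal c"
proof (rule ennreal_le_epsilon)
  fix e :: real assume "e > 0"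
  define \<delta> where "\<delta> = e * rho_min / (c + 1)"
  have \<delta>: "\<delta> > 0" using \<open>e > 0\<close> rho_min_pos c_nonneg by (simp add: \<delta>_def)
  have "\<delta> / rho_min = e / (c + 1)" using rho_min_pos by (simp add: \<delta>_def)
  then have "c * (1 + \<delta> / rho_min) = c + c / (c + 1) * e" by (simp add: distrib_left)
  also have "\<dots> \<le> c + 1 * e" using c_nonneg \<open>e > 0\<close> by (intro add_left_mono mult_right_mono) auto
  finally have bound: "c * (1 + \<delta> / rho_min) \<le> c + e" by simp
  have "(\<integral>\<^sup>+x. ennreal (\<rho> x) \<partial>riesz_measure) \<le> ennreal (c * (1 + \<delta> / rho_min))"
    using layer_sum_rho_riesz_le[OF \<delta>]
    by (intro riesz.nn_integral_le_if_layer_sums_le[OF _ rho_nonneg \<delta>]) auto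
  also have "\<dots> \<le> ennreal (c + e)" using bound by (rule ennreal_leI)
  also have "\<dots> = ennreal c + ennreal e" using c_nonneg \<open>e > 0\<close> by (simp add: ennreal_plus)
  finally show "(\<integral>\<^sup>+x. ennreal (\<rho> x) \<partial>riesz_measure) \<le> ennreal c + ennreal e" .
qed

lemma integrable_rho_riesz: "integrable riesz_measure \<rho>"
  using nn_integral_rho_riesz rho_nonneg
  by (intro integrableI_nonneg) (auto intro: le_less_trans[OF _ ennreal_less_top])

end

section \<open>Inner regularity\<close>

definition inner_regular_wrt :: "'a measure \<Rightarrow> 'a set set \<Rightarrow> 'a set \<Rightarrow> bool" where
  "inner_regular_wrt M \<K> A \<longleftrightarrow> (\<forall>e>0. \<exists>K\<in>\<K>. K \<subseteq> A \<and> measure M (A - K) < e)"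

lemma inner_regular_wrtI:
  "(\<And>e. e > 0 \<Longrightarrow> \<exists>K\<in>\<K>. K \<subseteq> A \<and> measure M (A - K) < e) \<Longrightarrow> inner_regular_wrt M \<K> A"
  by (simp add: inner_regular_wrt_def)

lemma inner_regular_wrtE:
  assumes "inner_regular_wrt M \<K> A" "e > 0"
  obtains K where "K \<in> \<K>" "K \<subseteq> A" "measure M (A - K) < e"
  using assms by (auto simp: inner_regular_wrt_def)

context finite_measure
begin

lemma emeasure_eq_SUP_if_inner_regular_wrt:
  assumes \<K>: "\<K> \<subseteq> sets M" and A: "A \<in> sets M" and regular: "inner_regular_wrt M \<K> A"
  shows "emeasure M A = (SUP K\<in>{K\<in>\<K>. K \<subseteq> A}. emeasure M K)"
proof (rule ennreal_approx_SUP)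
  show "emeasure M K \<le> emeasure M A" if "K \<in> {K\<in>\<K>. K \<subseteq> A}" for K
    using that A by (auto intro!: emeasure_mono)
  fix e :: real assume "e > 0"
  then obtain K where K: "K \<in> \<K>" "K \<subseteq> A" "measure M (A - K) < e"
    by (rule inner_regular_wrtE[OF regular])
  then have "measure M A \<le> measure M K + e"
    using finite_measure_Diff[of A K] A \<K> by auto
  then have "emeasure M A \<le> emeasure M K + ennreal e"
    using \<open>e > 0\<close> by (simp add: emeasure_eq_measure ennreal_leI flip: ennreal_plus)
  then show "\<exists>K\<in>{K\<in>\<K>. K \<subseteq> A}. emeasure M A \<le> emeasure M K + ennreal e" using K by blast
qed

lemma inner_regular_wrt_if_emeasure_eq_SUP:
  assumes \<K>: "\<K> \<subseteq> sets M" "{} \<in> \<K>" and A: "A \<in> sets M"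
    and SUP: "emeasure M A = (SUP K\<in>{K\<in>\<K>. K \<subseteq> A}. emeasure M K)"
  shows "inner_regular_wrt M \<K> A"
proof (rule inner_regular_wrtI)
  fix e :: real assume "e > 0"
  have "\<exists>K\<in>{K\<in>\<K>. K \<subseteq> A}. emeasure M A < emeasure M K + ennreal e"
    using \<K>(2) by (intro SUP_approx_ennreal[OF \<open>e > 0\<close> _ SUP]) (auto simp: emeasure_eq_measure)
  then obtain K where K: "K \<in> \<K>" "K \<subseteq> A" "emeasure M A < emeasure M K + ennreal e" by auto
  have "ennreal (measure M A) < ennreal (measure M K + e)"
    using K(3) \<open>e > 0\<close> by (simp add: emeasure_eq_measure)
  then have "measure M A < measure M K + e" using \<open>e > 0\<close> by (subst (asm) ennreal_less_iff) auto
  then have "measure M (A - K) < e"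
    using finite_measure_Diff[of A K] K A \<K>(1) by auto
  with K show "\<exists>K\<in>\<K>. K \<subseteq> A \<and> measure M (A - K) < e" by blast
qed

lemma measure_UN_le_geometric:
  assumes "\<And>i. D i \<in> sets M" and le: "\<And>i. measure M (D i) \<le> e * (1/2)^Suc i"
  shows "measure M (\<Union>i. D i) \<le> e"
proof -
  have geometric: "(\<lambda>i. e * (1/2)^Suc i) sums e" using sums_mult[OF power_half_series, of e] by simp
  have summable: "summable (\<lambda>i. measure M (D i))"
    using le by (intro summable_comparison_test'[OF sums_summable[OF geometric], of 0]) auto
  have "measure M (\<Union>i. D i) \<le> (\<Sum>i. measure M (D i))"
    using assms(1) summable by (intro finite_measure_subadditive_countably) auto
  also have "\<dots> \<le> (\<Sum>i. e * (1/2)^Suc i)" by (intro suminf_le le summable sums_summable[OF geometric])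
  also have "\<dots> = e" using geometric by (simp only: sums_iff)
  finally show ?thesis .
qed

end

locale paving = finite_measure M for M :: "'a measure" +
  fixes \<K> :: "'a set set"
  assumes paving_sets: "\<K> \<subseteq> sets M"
    and paving_empty: "{} \<in> \<K>"
    and paving_Un: "\<And>A B. A \<in> \<K> \<Longrightarrow> B \<in> \<K> \<Longrightarrow> A \<union> B \<in> \<K>"
    and paving_INT: "\<And>K. range K \<subseteq> \<K> \<Longrightarrow> (\<Inter>n::nat. K n) \<in> \<K>"
begin

lemma paving_finite_UN:
  fixes K :: "nat \<Rightarrow> 'a set"
  assumes "\<And>i. K i \<in> \<K>" shows "(\<Union>i<n. K i) \<in> \<K>"
  using assms by (induction n) (auto simp: lessThan_Suc intro: paving_empty paving_Un)

lemma inner_regular_wrt_empty: "inner_regular_wrt M \<K> {}"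
  using paving_empty by (intro inner_regular_wrtI) auto

lemma inner_regular_wrt_sequenceE:
  assumes A: "\<And>i. A i \<in> sets M" "\<And>i::nat. inner_regular_wrt M \<K> (A i)" and e: "e > 0"
  obtains K where "\<And>i. K i \<in> \<K>" "\<And>i. K i \<in> sets M" "\<And>i. K i \<subseteq> A i" "measure M (\<Union>i. A i - K i) < e"
proof -
  have "\<exists>K. K \<in> \<K> \<and> K \<subseteq> A i \<and> measure M (A i - K) < e / 2 * (1/2)^Suc i" for i
    by (rule inner_regular_wrtE[OF A(2)[of i], of "e / 2 * (1/2)^Suc i"]) (use e in auto)
  then obtain K where K: "\<And>i. K i \<in> \<K>" "\<And>i. K i \<subseteq> A i"
    "\<And>i. measure M (A i - K i) < e / 2 * (1/2)^Suc i"
    by metis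
  have sets: "K i \<in> sets M" for i using K(1) paving_sets by blast
  have "measure M (\<Union>i. A i - K i) \<le> e / 2"
    by (intro measure_UN_le_geometric sets.Diff A sets less_imp_le K(3))
  then have "measure M (\<Union>i. A i - K i) < e" using e by simp
  with K(1) sets K(2) show thesis by (rule that)
qed

lemma inner_regular_wrt_UN:
  assumes A: "\<And>i::nat. A i \<in> sets M" "\<And>i. inner_regular_wrt M \<K> (A i)"
  shows "inner_regular_wrt M \<K> (\<Union>i. A i)"
proof (rule inner_regular_wrtI)
  fix e :: real assume "e > 0"
  then obtain K where K: "\<And>i. K i \<in> \<K>" "\<And>i. K i \<in> sets M" "\<And>i. K i \<subseteq> A i"
    "measure M (\<Union>i. A i - K i) < e"
    by (rule inner_regular_wrt_sequenceE[where A = A, OF A]) blast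
  have "measure M ((\<Union>i. A i) - (\<Union>i. K i)) \<le> measure M (\<Union>i. A i - K i)"
    using A(1) K(2) by (intro finite_measure_mono) auto
  with K(4) have limit_less: "measure M ((\<Union>i. A i) - (\<Union>i. K i)) < e" by simp
  have "(\<lambda>n. measure M ((\<Union>i. A i) - (\<Union>i<n. K i))) \<longlonglongrightarrow> measure M (\<Inter>n. (\<Union>i. A i) - (\<Union>i<n. K i))"
    using A(1) K(2) by (intro finite_Lim_measure_decseq) (auto simp: decseq_def)
  also have "(\<Inter>n. (\<Union>i. A i) - (\<Union>i<n. K i)) = (\<Union>i. A i) - (\<Union>i. K i)" by blast
  finally have "(\<lambda>n. measure M ((\<Union>i. A i) - (\<Union>i<n. K i))) \<longlonglongrightarrow> measure M ((\<Union>i. A i) - (\<Union>i. K i))" .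
  from order_tendstoD(2)[OF this limit_less]
  have "\<forall>\<^sub>F n in sequentially. measure M ((\<Union>i. A i) - (\<Union>i<n. K i)) < e" .
  then obtain n where "measure M ((\<Union>i. A i) - (\<Union>i<n. K i)) < e"
    using eventually_happens by force
  moreover have "(\<Union>i<n. K i) \<subseteq> (\<Union>i. A i)" using K(3) by blast
  ultimately show "\<exists>K\<in>\<K>. K \<subseteq> (\<Union>i. A i) \<and> measure M ((\<Union>i. A i) - K) < e"
    using paving_finite_UN[of K n, OF K(1)] by blast
qed

lemma inner_regular_wrt_INT:
  assumes A: "\<And>i::nat. A i \<in> sets M" "\<And>i. inner_regular_wrt M \<K> (A i)"
  shows "inner_regular_wrt M \<K> (\<Inter>i. A i)"
proof (rule inner_regular_wrtI)
  fix e :: real assume "e > 0"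
  then obtain K where K: "\<And>i. K i \<in> \<K>" "\<And>i. K i \<in> sets M" "\<And>i. K i \<subseteq> A i"
    "measure M (\<Union>i. A i - K i) < e"
    by (rule inner_regular_wrt_sequenceE[where A = A, OF A]) blast
  have "measure M ((\<Inter>i. A i) - (\<Inter>i. K i)) \<le> measure M (\<Union>i. A i - K i)"
    using A(1) K(2) by (intro finite_measure_mono) auto
  then have "measure M ((\<Inter>i. A i) - (\<Inter>i. K i)) < e" using K(4) by simp
  moreover have "(\<Inter>i. K i) \<subseteq> (\<Inter>i. A i)" using K(3) by blast
  moreover have "(\<Inter>i. K i) \<in> \<K>" using K(1) by (intro paving_INT) blast
  ultimately show "\<exists>K\<in>\<K>. K \<subseteq> (\<Inter>i. A i) \<and> measure M ((\<Inter>i. A i) - K) < e" by blast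
qed

lemma inner_regular_wrt_sigma_sets:
  assumes sets: "sets M = sigma_sets (space M) G"
    and space: "inner_regular_wrt M \<K> (space M)"
    and gen: "\<And>A. A \<in> G \<Longrightarrow> inner_regular_wrt M \<K> A" "\<And>A. A \<in> G \<Longrightarrow> inner_regular_wrt M \<K> (space M - A)"
    and A: "A \<in> sets M"
  shows "inner_regular_wrt M \<K> A"
proof -
  have "A \<in> sigma_sets (space M) G" using A sets by simp
  then have "inner_regular_wrt M \<K> A \<and> inner_regular_wrt M \<K> (space M - A)"
  proof induction
    case (Basic A)
    then show ?case using gen by blast
  next
    case Empty
    then show ?case using space inner_regular_wrt_empty by simp
  next
    case (Compl A)
    then have "space M - (space M - A) = A"
      using sets sets.sets_into_space[of A M] by (auto simp: double_diff)
    then show ?case using Compl.IH by simp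
  next
    case (Union A)
    then have A: "A i \<in> sets M" for i using sets by simp
    have "inner_regular_wrt M \<K> (\<Inter>i. space M - A i)"
      using Union.IH A by (intro inner_regular_wrt_INT) auto
    moreover have "(\<Inter>i. space M - A i) = space M - (\<Union>i. A i)" by blast
    ultimately show ?case using inner_regular_wrt_UN[OF A] Union.IH by simp
  qed
  then show ?thesis ..
qed

end

section \<open>Radon probability measures on weighted spaces\<close>

locale weighted_prob = weighted \<rho> + prob_space \<nu>
  for \<rho> :: "'a::topological_space \<Rightarrow> real" and \<nu> :: "'a measure" +
  assumes sets_nu[measurable_cong]: "sets \<nu> = sets borel"
    and integrable_rho: "integrable \<nu> \<rho>"
begin

lemma space_nu: "space \<nu> = UNIV"
  using sets_eq_imp_space_eq[OF sets_nu] by simp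

lemma integral_rho_nonneg: "0 \<le> (\<integral>x. \<rho> x \<partial>\<nu>)"
  using rho_nonneg by (intro integral_nonneg_AE AE_I2)

lemma Brho_integrable:
  assumes "f \<in> Brho \<rho>" shows "integrable \<nu> f"
proof (rule Bochner_Integration.integrable_bound)
  show "integrable \<nu> (\<lambda>x. wnorm \<rho> f * \<rho> x)" using integrable_rho by simp
  show "AE x in \<nu>. norm (f x) \<le> norm (wnorm \<rho> f * \<rho> x)"
    using Brho_bound[OF assms] by (intro AE_I2) (auto intro: order_trans[OF _ abs_ge_self])
qed (rule Brho_measurable[OF sets_nu assms])

lemma integral_abs_diff_le:
  assumes "f \<in> Brho \<rho>" "g \<in> Brho \<rho>" "\<And>x. \<bar>f x - g x\<bar> \<le> \<epsilon> * \<rho> x"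
  shows "(\<integral>x. \<bar>f x - g x\<bar> \<partial>\<nu>) \<le> \<epsilon> * (\<integral>x. \<rho> x \<partial>\<nu>)"
proof -
  have "(\<integral>x. \<bar>f x - g x\<bar> \<partial>\<nu>) \<le> (\<integral>x. \<epsilon> * \<rho> x \<partial>\<nu>)"
    using assms integrable_rho by (intro integral_mono) (auto simp: Brho_integrable)
  then show ?thesis by simp
qed

lemma tight_sublevel:
  assumes "e > 0"
  obtains R where "R > 0" "measure \<nu> {x. R < \<rho> x} < e"
proof -
  define R where "R = ((\<integral>x. \<rho> x \<partial>\<nu>) + 1) / e"
  have R: "R > 0" "(\<integral>x. \<rho> x \<partial>\<nu>) / R < e"
    using integral_rho_nonneg assms by (auto simp: R_def field_simps add_nonneg_pos)
  have "measure \<nu> {x. R < \<rho> x} \<le> measure \<nu> {x \<in> space \<nu>. R \<le> \<rho> x}"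
    by (intro finite_measure_mono) (auto simp: space_nu)
  also have "\<dots> \<le> (\<integral>x. \<rho> x \<partial>\<nu>) / R"
    using integrable_rho rho_nonneg R(1)
    by (intro integral_Markov_inequality_measure[of _ _ "{}"]) auto
  finally show thesis using R that by simp
qed

lemma paving_compact: "paving \<nu> (Collect compact)"
proof unfold_locales
  show "Collect compact \<subseteq> sets \<nu>"
    using compact_imp_closed_weighted sets_nu by auto
  fix K :: "nat \<Rightarrow> 'a set" assume "range K \<subseteq> Collect compact"
  then have K: "compact (K n)" for n by auto
  have "compact (K 0 \<inter> (\<Inter>n. K n))"
    using K compact_imp_closed_weighted by (intro compact_Int_closed closed_INT) auto
  moreover have "K 0 \<inter> (\<Inter>n. K n) = (\<Inter>n. K n)" by blast
  ultimately show "(\<Inter>n. K n) \<in> Collect compact" by simp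
qed auto

interpretation compact_paving: paving \<nu> "Collect compact" by (rule paving_compact)

lemma inner_regular_closed:
  assumes "closed F" shows "inner_regular_wrt \<nu> (Collect compact) F"
proof (rule inner_regular_wrtI)
  fix e :: real assume "e > 0"
  then obtain R where R: "measure \<nu> {x. R < \<rho> x} < e" by (rule tight_sublevel)
  have "measure \<nu> (F - {x. \<rho> x \<le> R} \<inter> F) \<le> measure \<nu> {x. R < \<rho> x}"
    using open_superlevel by (intro finite_measure_mono) (auto simp: sets_nu)
  then show "\<exists>K\<in>Collect compact. K \<subseteq> F \<and> measure \<nu> (F - K) < e"
    using R compact_Int_closed[OF compact_sublevel[of R] assms]
    by (intro bexI[of _ "{x. \<rho> x \<le> R} \<inter> F"]) auto
qed

lemma inner_regular_open:
  assumes U: "open U" and approx: "\<And>e. e > 0 \<Longrightarrow> \<exists>f\<in>cutoffs U. measure \<nu> U \<le> (\<integral>x. f x \<partial>\<nu>) + e"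
  shows "inner_regular_wrt \<nu> (Collect compact) U"
proof (rule inner_regular_wrtI)
  fix e' :: real assume "e' > 0"
  define e where "e = e' / 3"
  have e: "e > 0" using \<open>e' > 0\<close> by (simp add: e_def)
  obtain f where f: "f \<in> cutoffs U" "measure \<nu> U \<le> (\<integral>x. f x \<partial>\<nu>) + e" using approx[OF e] by blast
  obtain R where R: "measure \<nu> {x. R < \<rho> x} < e" using tight_sublevel[OF e] by blast
  define K where "K = {x. \<rho> x \<le> R} \<inter> {x. e \<le> f x}"
  have K: "compact K" unfolding K_def
    by (intro compact_Int_closed compact_sublevel closed_Collect_le continuous_on_const
        cutoffs_continuous_on[OF f(1)])
  have "K \<subseteq> U" using cutoffs_eq_0[OF f(1)] e by (force simp: K_def)
  have sets: "K \<in> sets \<nu>" "{x. R < \<rho> x} \<in> sets \<nu>"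
    using K open_superlevel compact_imp_closed_weighted by (auto simp: sets_nu)
  have int: "integrable \<nu> (indicator K :: _ \<Rightarrow> real)"
    "integrable \<nu> (indicator {x. R < \<rho> x} :: _ \<Rightarrow> real)"
    using sets by (auto simp: emeasure_eq_measure)
  have "(\<integral>x. f x \<partial>\<nu>) \<le> (\<integral>x. e + (indicator K x + indicator {x. R < \<rho> x} x) \<partial>\<nu>)"
  proof (rule integral_mono[OF Brho_integrable[OF cutoffs_Brho[OF f(1)]]])
    show "integrable \<nu> (\<lambda>x. e + (indicator K x + indicator {x. R < \<rho> x} x))"
      by (intro Bochner_Integration.integrable_add integrable_const int)
    show "f x \<le> e + (indicator K x + indicator {x. R < \<rho> x} x)" for x
      using cutoffs_le_1[OF f(1), of x] e by (auto simp: indicator_def K_def)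
  qed
  also have "\<dots> = e + (measure \<nu> K + measure \<nu> {x. R < \<rho> x})"
    using int prob_space by (simp add: space_nu)
  finally have "measure \<nu> U - measure \<nu> K < e'" using f(2) R by (simp add: e_def)
  then have "measure \<nu> (U - K) < e'"
    using finite_measure_Diff[of U K] U sets \<open>K \<subseteq> U\<close> by (simp add: sets_nu)
  with K \<open>K \<subseteq> U\<close> show "\<exists>K\<in>Collect compact. K \<subseteq> U \<and> measure \<nu> (U - K) < e'" by blast
qed

lemma prob_in_MrhoI:
  assumes "\<And>U e. open U \<Longrightarrow> e > 0 \<Longrightarrow> \<exists>f\<in>cutoffs U. measure \<nu> U \<le> (\<integral>x. f x \<partial>\<nu>) + e"
  shows "prob_in_Mrho \<rho> \<nu>"
proof -
  have "inner_regular_wrt \<nu> (Collect compact) A" if "A \<in> sets borel" for A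
  proof (rule compact_paving.inner_regular_wrt_sigma_sets[where G = "Collect open"])
    show "sets \<nu> = sigma_sets (space \<nu>) (Collect open)" by (simp add: sets_nu space_nu borel_def)
    show "inner_regular_wrt \<nu> (Collect compact) (space \<nu>)"
      by (auto simp: space_nu intro: inner_regular_closed)
    show "inner_regular_wrt \<nu> (Collect compact) U" if "U \<in> Collect open" for U
      using that assms by (intro inner_regular_open) auto
    show "inner_regular_wrt \<nu> (Collect compact) (space \<nu> - U)" if "U \<in> Collect open" for U
      using that by (intro inner_regular_closed) (auto simp: space_nu)
  qed (use that in \<open>simp add: sets_nu\<close>)
  then have "\<forall>A\<in>sets borel. emeasure \<nu> A = (SUP K\<in>{K. compact K \<and> K \<subseteq> A}. emeasure \<nu> K)"
    using emeasure_eq_SUP_if_inner_regular_wrt[OF compact_paving.paving_sets] by (simp add: sets_nu)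
  then show ?thesis using sets_nu prob_space_axioms integrable_rho by (simp add: prob_in_Mrho_def)
qed

end

lemma (in weighted) weighted_prob_if_prob_in_Mrho: "prob_in_Mrho \<rho> \<nu> \<Longrightarrow> weighted_prob \<rho> \<nu>"
  using weighted_axioms by (simp add: weighted_prob_def weighted_prob_axioms_def prob_in_Mrho_def)

lemma (in weighted) inner_regular_if_prob_in_Mrho:
  assumes "prob_in_Mrho \<rho> \<nu>" "A \<in> sets borel"
  shows "inner_regular_wrt \<nu> (Collect compact) A"
proof -
  interpret weighted_prob \<rho> \<nu> by (rule weighted_prob_if_prob_in_Mrho[OF assms(1)])
  interpret paving \<nu> "Collect compact" by (rule paving_compact)
  show ?thesis
    using assms by (intro inner_regular_wrt_if_emeasure_eq_SUP paving_sets paving_empty)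
      (auto simp: sets_nu prob_in_Mrho_def)
qed

context weighted_functional
begin

sublocale riesz: weighted_prob \<rho> riesz_measure
  by unfold_locales (rule sets_riesz integrable_rho_riesz)+

lemma integral_riesz:
  assumes f: "f \<in> Brho \<rho>" shows "(\<integral>x. f x \<partial>riesz_measure) = L f"
proof -
  define I where "I = (\<integral>x. \<rho> x \<partial>riesz_measure)"
  have I: "I \<ge> 0" unfolding I_def by (rule riesz.integral_rho_nonneg)
  have "\<bar>(\<integral>x. f x \<partial>riesz_measure) - L f\<bar> \<le> 0 + e" if "e > 0" for e
  proof -
    define \<epsilon> where "\<epsilon> = e / (I + c + 1)"
    have \<epsilon>: "\<epsilon> > 0" "\<epsilon> * (I + c) \<le> e" using I c_nonneg \<open>e > 0\<close> by (auto simp: \<epsilon>_def field_simps)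
    obtain g where g: "g \<in> Cb" "\<And>x. \<bar>f x - g x\<bar> \<le> \<epsilon> * \<rho> x" using Brho_approx[OF f \<epsilon>(1)] by blast
    have "\<bar>(\<integral>x. f x \<partial>riesz_measure) - (\<integral>x. g x \<partial>riesz_measure)\<bar> = \<bar>\<integral>x. f x - g x \<partial>riesz_measure\<bar>"
      by (simp add: riesz.Brho_integrable f Cb_Brho g(1))
    also have "\<dots> \<le> (\<integral>x. \<bar>f x - g x\<bar> \<partial>riesz_measure)" by (rule integral_abs_bound)
    also have "\<dots> \<le> \<epsilon> * I"
      unfolding I_def by (rule riesz.integral_abs_diff_le[OF f Cb_Brho[OF g(1)] g(2)])
    finally show ?thesis
      using L_diff_le_if_diff_le_weight[OF f Cb_Brho[OF g(1)] less_imp_le[OF \<epsilon>(1)] g(2)]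
          integral_riesz_Cb[OF g(1)] \<epsilon>(2)
      by (simp add: algebra_simps)
  qed
  then have "\<bar>(\<integral>x. f x \<partial>riesz_measure) - L f\<bar> \<le> 0" by (rule field_le_epsilon)
  then show ?thesis by simp
qed

lemma prob_in_Mrho_riesz: "prob_in_Mrho \<rho> riesz_measure"
proof (rule riesz.prob_in_MrhoI)
  fix U :: "'a set" and e :: real assume "open U" "e > 0"
  then obtain f where "f \<in> cutoffs U" "measure riesz_measure U \<le> L f + e"
    by (rule measure_riesz_open_approx)
  then show "\<exists>f\<in>cutoffs U. measure riesz_measure U \<le> (\<integral>x. f x \<partial>riesz_measure) + e"
    using integral_riesz[OF cutoffs_Brho] by auto
qed

end

section \<open>Integrals of directed suprema\<close>

definition upward_directed :: "'a::order set \<Rightarrow> bool" where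
  "upward_directed A \<longleftrightarrow> A \<noteq> {} \<and> (\<forall>a\<in>A. \<forall>b\<in>A. \<exists>c\<in>A. a \<le> c \<and> b \<le> c)"

lemma upward_directed_finite_bound:
  assumes directed: "upward_directed A" and "finite D" "D \<subseteq> A"
  obtains u where "u \<in> A" "\<And>a. a \<in> D \<Longrightarrow> a \<le> u"
proof -
  have "\<exists>u\<in>A. \<forall>a\<in>D. a \<le> u"
    using assms(2,3)
  proof (induction D rule: finite_induct)
    case empty
    then show ?case using directed by (auto simp: upward_directed_def)
  next
    case (insert a D)
    then obtain u where "u \<in> A" "\<forall>a\<in>D. a \<le> u" by auto
    moreover obtain v where "v \<in> A" "a \<le> v" "u \<le> v"
      using directed insert.prems \<open>u \<in> A\<close> unfolding upward_directed_def by blast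
    ultimately show ?case by (intro bexI[of _ v]) (auto intro: order_trans)
  qed
  then show thesis using that by blast
qed

lemma upward_directed_cutoffs: "upward_directed (cutoffs U)"
  unfolding upward_directed_def
proof (intro conjI ballI)
  show "cutoffs U \<noteq> {}" by (rule cutoffs_nonempty)
  show "\<exists>h\<in>cutoffs U. f \<le> h \<and> g \<le> h" if "f \<in> cutoffs U" "g \<in> cutoffs U" for f g
    by (intro bexI[OF _ cutoffs_max[OF that]]) (simp add: le_fun_def)
qed

lemma upward_directed_image_mono:
  assumes "upward_directed A" "\<And>a b. a \<in> A \<Longrightarrow> b \<in> A \<Longrightarrow> a \<le> b \<Longrightarrow> f a \<le> f b"
  shows "upward_directed (f ` A)"
proof -
  have "\<exists>u\<in>f ` A. f a \<le> u \<and> f b \<le> u" if ab: "a \<in> A" "b \<in> A" for a b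
  proof -
    obtain u where "u \<in> A" "a \<le> u" "b \<le> u" using assms(1) ab unfolding upward_directed_def by blast
    then show ?thesis using assms(2) ab by blast
  qed
  then show ?thesis using assms(1) by (auto simp: upward_directed_def)
qed

locale directed_family = weighted_prob \<rho> \<nu>
  for \<rho> :: "'a::topological_space \<Rightarrow> real" and \<nu> :: "'a measure" +
  fixes \<F> :: "('a \<Rightarrow> real) set"
  assumes radon: "prob_in_Mrho \<rho> \<nu>"
    and continuous: "\<And>f. f \<in> \<F> \<Longrightarrow> sublevel_continuous f"
    and nonneg: "\<And>f x. f \<in> \<F> \<Longrightarrow> 0 \<le> f x"
    and le_1: "\<And>f x. f \<in> \<F> \<Longrightarrow> f x \<le> 1"
    and directed: "upward_directed \<F>"
begin

definition sup_fun :: "'a \<Rightarrow> real" where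
  "sup_fun x = (SUP f\<in>\<F>. f x)"

lemma nonempty: "\<F> \<noteq> {}"
  using directed by (simp add: upward_directed_def)

lemma bdd_above_values: "bdd_above ((\<lambda>f. f x) ` \<F>)"
  using le_1 by (auto intro!: bdd_aboveI[of _ 1])

lemma less_sup_fun_iff: "r < sup_fun x \<longleftrightarrow> (\<exists>f\<in>\<F>. r < f x)"
  unfolding sup_fun_def by (rule less_cSUP_iff[OF nonempty bdd_above_values])

lemma le_sup_fun: "f \<in> \<F> \<Longrightarrow> f x \<le> sup_fun x"
  unfolding sup_fun_def by (rule cSUP_upper[OF _ bdd_above_values])

lemma sup_fun_nonneg: "0 \<le> sup_fun x"
  using nonempty nonneg le_sup_fun by (meson all_not_in_conv order_trans)

lemma sup_fun_le_1: "sup_fun x \<le> 1"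
  unfolding sup_fun_def by (intro cSUP_least nonempty le_1)

lemma measurable_sup_fun[measurable]: "sup_fun \<in> borel_measurable \<nu>"
  using borel_measurable_SUP_sublevel_continuous[of \<F> "\<lambda>f. f", OF continuous nonempty
      bdd_above_values]
  by (simp add: sup_fun_def[abs_def])

lemma measurable_member[measurable]: "f \<in> \<F> \<Longrightarrow> f \<in> borel_measurable \<nu>"
  using sublevel_continuous_borel[OF continuous] by simp

lemma integrable_member: "f \<in> \<F> \<Longrightarrow> integrable \<nu> f"
  using nonneg le_1 by (intro integrable_const_bound[of _ 1]) auto

lemma compact_superlevel_subset:
  assumes "compact C" "C \<subseteq> {x. \<rho> x \<le> R}" and less: "\<And>x. x \<in> C \<Longrightarrow> r < sup_fun x"
  obtains f where "f \<in> \<F>" "\<And>x. x \<in> C \<Longrightarrow> r < f x"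
proof -
  have "\<exists>W. open W \<and> (\<forall>x. \<rho> x \<le> R \<longrightarrow> (x \<in> W \<longleftrightarrow> r < f x))" if "f \<in> \<F>" for f
    using sublevel_continuous_openE[OF continuous[OF that]] by metis
  then obtain W where W: "\<And>f. f \<in> \<F> \<Longrightarrow> open (W f)"
    "\<And>f x. f \<in> \<F> \<Longrightarrow> \<rho> x \<le> R \<Longrightarrow> x \<in> W f \<longleftrightarrow> r < f x"
    by metis
  have "C \<subseteq> (\<Union>f\<in>\<F>. W f)"
    using less assms(2) W(2) by (auto simp: less_sup_fun_iff subset_iff)
  then obtain \<D> where \<D>: "\<D> \<subseteq> \<F>" "finite \<D>" "C \<subseteq> (\<Union>f\<in>\<D>. W f)"
    using compactE_image[OF assms(1), of \<F> W] W(1) by auto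
  obtain h where h: "h \<in> \<F>" "\<And>f. f \<in> \<D> \<Longrightarrow> f \<le> h"
    by (rule upward_directed_finite_bound[OF directed \<D>(2,1)]) blast
  have "r < h x" if x: "x \<in> C" for x
  proof -
    obtain f where f: "f \<in> \<D>" "x \<in> W f" using \<D>(3) x by auto
    then have "r < f x" using W(2) \<D>(1) assms(2) x by blast
    also have "f x \<le> h x" using h(2)[OF f(1)] by (rule le_funD)
    finally show ?thesis .
  qed
  with h(1) show thesis by (rule that)
qed

lemma measure_superlevel_approx:
  assumes e: "e > 0"
  shows "\<exists>f\<in>\<F>. measure \<nu> {x\<in>space \<nu>. r < sup_fun x} \<le> measure \<nu> {x\<in>space \<nu>. r < f x} + e"
proof -
  define A where "A = {x\<in>space \<nu>. r < sup_fun x}"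
  have A: "A \<in> sets \<nu>" unfolding A_def by measurable
  have e2: "e / 2 > 0" using e by simp
  have "inner_regular_wrt \<nu> (Collect compact) A"
    using inner_regular_if_prob_in_Mrho[OF radon] A by (simp add: sets_nu)
  then obtain K where K: "compact K" "K \<subseteq> A" "measure \<nu> (A - K) < e / 2"
    using e2 by (rule inner_regular_wrtE) simp
  obtain R where R: "measure \<nu> {x. R < \<rho> x} < e / 2" using tight_sublevel[OF e2] by blast
  have "compact (K \<inter> {x. \<rho> x \<le> R})" by (intro compact_Int_closed K closed_sublevel)
  then obtain f where f: "f \<in> \<F>" "\<And>x. x \<in> K \<inter> {x. \<rho> x \<le> R} \<Longrightarrow> r < f x"
    by (rule compact_superlevel_subset[where R = R and r = r]) (use K(2) in \<open>auto simp: A_def\<close>)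
  have sets: "A - K \<in> sets \<nu>" "{x. R < \<rho> x} \<in> sets \<nu>" "{x\<in>space \<nu>. r < f x} \<in> sets \<nu>"
    using A compact_imp_closed_weighted[OF K(1)] open_superlevel measurable_member[OF f(1)]
    by (auto simp: sets_nu)
  have "A \<subseteq> {x\<in>space \<nu>. r < f x} \<union> ((A - K) \<union> {x. R < \<rho> x})"
    using f(2) by (auto simp: space_nu not_le)
  then have "measure \<nu> A \<le> measure \<nu> ({x\<in>space \<nu>. r < f x} \<union> ((A - K) \<union> {x. R < \<rho> x}))"
    using sets by (intro finite_measure_mono) auto
  also have "\<dots> \<le> measure \<nu> {x\<in>space \<nu>. r < f x} + (measure \<nu> (A - K) + measure \<nu> {x. R < \<rho> x})"
    using sets by (intro order_trans[OF measure_Un_le] add_left_mono measure_Un_le) auto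
  finally show ?thesis using K(3) R f(1) unfolding A_def by (intro bexI[of _ f]) auto
qed

lemma integral_sup_fun_approx:
  assumes e: "e > 0"
  shows "\<exists>f\<in>\<F>. (\<integral>x. sup_fun x \<partial>\<nu>) \<le> (\<integral>x. f x \<partial>\<nu>) + e"
proof -
  obtain k where k: "1 / real (Suc k) < e / 2"
    using reals_Archimedean[OF half_gt_zero[OF e]] unfolding inverse_eq_divide by blast
  define \<delta> where "\<delta> = 1 / real (Suc k)"
  define level where "level g i = measure \<nu> {x\<in>space \<nu>. real i * \<delta> < g x}"
    for g :: "'a \<Rightarrow> real" and i
  have \<delta>: "\<delta> > 0" "real (Suc k) * \<delta> = 1" by (auto simp: \<delta>_def)
  have "\<exists>f\<in>\<F>. level sup_fun i \<le> level f i + e / 2" for i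
    unfolding level_def by (rule measure_superlevel_approx[OF half_gt_zero[OF e]])
  then obtain F where F: "\<And>i. F i \<in> \<F>" "\<And>i. level sup_fun i \<le> level (F i) i + e / 2" by metis
  obtain h where h: "h \<in> \<F>" "\<And>g. g \<in> F ` {..<Suc k} \<Longrightarrow> g \<le> h"
    by (rule upward_directed_finite_bound[OF directed, of "F ` {..<Suc k}"]) (use F(1) in auto)
  have level_le: "level sup_fun i \<le> level h i + e / 2" if "i < Suc k" for i
  proof -
    have "level (F i) i \<le> level h i"
      unfolding level_def using h that measurable_member[OF h(1)]
      by (intro finite_measure_mono) (auto simp: le_fun_def intro: less_le_trans)
    with F(2)[of i] show ?thesis by simp
  qed
  have "(\<integral>x. sup_fun x \<partial>\<nu>) \<le> (\<Sum>i<Suc k. \<delta> * level sup_fun i)"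
    unfolding level_def
    by (intro integral_le_layer_sum measurable_sup_fun sup_fun_nonneg sup_fun_le_1 \<delta>)
  also have "\<dots> \<le> (\<Sum>i<Suc k. \<delta> * (level h i + e / 2))"
    using \<delta>(1) level_le by (intro sum_mono mult_left_mono) auto
  also have "\<dots> = (\<Sum>i<Suc k. \<delta> * level h i) + real (Suc k) * \<delta> * (e / 2)"
    by (simp add: ring_distribs sum.distrib del: sum.lessThan_Suc)
  also have "\<dots> = (\<Sum>i<Suc k. \<delta> * level h i) + e / 2" by (simp only: \<delta>(2) mult_1)
  also have "(\<Sum>i<Suc k. \<delta> * level h i) \<le> (\<integral>x. h x \<partial>\<nu>) + \<delta>"
    unfolding level_def
    by (intro layer_sum_le_integral measurable_member[OF h(1)] nonneg le_1 h(1) \<delta>)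
  finally show ?thesis using k h(1) by (intro bexI[of _ h]) (auto simp: \<delta>_def)
qed

lemma integral_directed_SUP: "(\<integral>x. (SUP f\<in>\<F>. f x) \<partial>\<nu>) = (SUP f\<in>\<F>. \<integral>x. f x \<partial>\<nu>)"
proof (rule antisym)
  have sup_integrable: "integrable \<nu> sup_fun"
    using sup_fun_nonneg sup_fun_le_1 by (intro integrable_const_bound[of _ 1]) auto
  have le: "(\<integral>x. f x \<partial>\<nu>) \<le> (\<integral>x. sup_fun x \<partial>\<nu>)" if "f \<in> \<F>" for f
    by (intro integral_mono integrable_member that sup_integrable le_sup_fun)
  then have bdd: "bdd_above ((\<lambda>f. \<integral>x. f x \<partial>\<nu>) ` \<F>)" by (auto intro!: bdd_aboveI)
  show "(SUP f\<in>\<F>. \<integral>x. f x \<partial>\<nu>) \<le> (\<integral>x. (SUP f\<in>\<F>. f x) \<partial>\<nu>)"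
    using le by (intro cSUP_least nonempty) (simp add: sup_fun_def)
  show "(\<integral>x. (SUP f\<in>\<F>. f x) \<partial>\<nu>) \<le> (SUP f\<in>\<F>. \<integral>x. f x \<partial>\<nu>)"
  proof (rule field_le_epsilon)
    fix e :: real assume "e > 0"
    then obtain f where f: "f \<in> \<F>" "(\<integral>x. sup_fun x \<partial>\<nu>) \<le> (\<integral>x. f x \<partial>\<nu>) + e"
      using integral_sup_fun_approx by blast
    then show "(\<integral>x. (SUP f\<in>\<F>. f x) \<partial>\<nu>) \<le> (SUP f\<in>\<F>. \<integral>x. f x \<partial>\<nu>) + e"
      using cSUP_upper[OF f(1) bdd] by (simp add: sup_fun_def)
  qed
qed

end

section \<open>Transition kernels of a generalized Feller semigroup\<close>

locale feller = weighted \<rho> for \<rho> :: "'a::topological_space \<Rightarrow> real" +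
  fixes P :: "real \<Rightarrow> ('a \<Rightarrow> real) \<Rightarrow> ('a \<Rightarrow> real)"
  assumes gen_feller: "gen_feller_semigroup \<rho> P"
    and P_one: "\<And>t. t \<ge> 0 \<Longrightarrow> P t (\<lambda>x. 1) = (\<lambda>x. 1)"
begin

lemma
  assumes "t \<ge> 0" "f \<in> Brho \<rho>"
  shows P_Brho: "P t f \<in> Brho \<rho>"
    and P_add: "g \<in> Brho \<rho> \<Longrightarrow> P t (\<lambda>x. f x + g x) = (\<lambda>x. P t f x + P t g x)"
    and P_cmult: "P t (\<lambda>x. c * f x) = (\<lambda>x. c * P t f x)"
    and P_semigroup: "s \<ge> 0 \<Longrightarrow> P (t + s) f = P s (P t f)"
    and P_nonneg: "(\<And>x. 0 \<le> f x) \<Longrightarrow> 0 \<le> P t f x"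
  using gen_feller assms unfolding gen_feller_semigroup_def by simp_all

lemma
  assumes "f \<in> Brho \<rho>"
  shows P_0: "P 0 f = f"
    and P_tendsto_at_0: "((\<lambda>t. P t f x) \<longlongrightarrow> f x) (at_right 0)"
  using gen_feller assms unfolding gen_feller_semigroup_def by simp_all

lemma P_wnorm_locally_bounded:
  "\<exists>\<epsilon>>0. \<exists>C. \<forall>t\<in>{0..\<epsilon>}. \<forall>f\<in>Brho \<rho>. wnorm \<rho> (P t f) \<le> C * wnorm \<rho> f"
  using gen_feller unfolding gen_feller_semigroup_def by simp_all

definition operator_bound :: "real \<Rightarrow> real \<Rightarrow> bool" where
  "operator_bound t C \<longleftrightarrow> C \<ge> 0 \<and> (\<forall>f\<in>Brho \<rho>. wnorm \<rho> (P t f) \<le> C * wnorm \<rho> f)"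

lemma operator_boundI:
  assumes "\<And>f. f \<in> Brho \<rho> \<Longrightarrow> wnorm \<rho> (P t f) \<le> C * wnorm \<rho> f" "C \<le> D" "0 \<le> D"
  shows "operator_bound t D"
  unfolding operator_bound_def
proof (intro conjI ballI)
  fix f assume f: "f \<in> Brho \<rho>"
  have "C * wnorm \<rho> f \<le> D * wnorm \<rho> f" using wnorm_nonneg[OF f] assms(2) by (intro mult_right_mono)
  then show "wnorm \<rho> (P t f) \<le> D * wnorm \<rho> f" using assms(1)[OF f] by simp
qed fact

lemma operator_bound_add:
  assumes "operator_bound s C" "operator_bound t D" "s \<ge> 0" "t \<ge> 0"
  shows "operator_bound (s + t) (D * C)"
proof (rule operator_boundI[OF _ order_refl])
  show "0 \<le> D * C" using assms by (simp add: operator_bound_def)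
  fix f assume f: "f \<in> Brho \<rho>"
  have "wnorm \<rho> (P t (P s f)) \<le> D * wnorm \<rho> (P s f)"
    using assms P_Brho[OF assms(3) f] by (simp add: operator_bound_def)
  also have "\<dots> \<le> D * (C * wnorm \<rho> f)"
    using assms f by (intro mult_left_mono) (auto simp: operator_bound_def)
  finally show "wnorm \<rho> (P (s + t) f) \<le> D * C * wnorm \<rho> f"
    using P_semigroup[OF assms(3) f assms(4)] by (simp add: mult.assoc)
qed

lemma operator_bound_Icc:
  obtains C where "\<And>t. t \<in> {0..T} \<Longrightarrow> operator_bound t C"
proof -
  obtain \<epsilon> C where \<epsilon>: "\<epsilon> > 0"
    and C: "\<And>t f. t \<in> {0..\<epsilon>} \<Longrightarrow> f \<in> Brho \<rho> \<Longrightarrow> wnorm \<rho> (P t f) \<le> C * wnorm \<rho> f"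
    using P_wnorm_locally_bounded by blast
  define D where "D = max 1 C"
  have short: "operator_bound t D" if "t \<in> {0..\<epsilon>}" for t
    using C[OF that] by (rule operator_boundI) (auto simp: D_def)
  have long: "operator_bound t (D ^ Suc n)" if "t \<in> {0..real (Suc n) * \<epsilon>}" for t n
    using that
  proof (induction n arbitrary: t)
    case 0
    then show ?case using short by simp
  next
    case (Suc n)
    define s where "s = t / real (Suc (Suc n))"
    have s: "0 \<le> s" "s \<le> \<epsilon>" using Suc.prems by (auto simp: s_def pos_divide_le_eq mult.commute)
    have "real (Suc (Suc n)) * s = t" by (simp add: s_def)
    then have t: "t = s + real (Suc n) * s" by (simp add: algebra_simps)
    have "operator_bound (real (Suc n) * s) (D ^ Suc n)"
      using s by (intro Suc.IH) (auto intro: mult_left_mono)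
    from operator_bound_add[OF short this] s t show ?case by (simp add: mult.commute)
  qed
  obtain n where "T / \<epsilon> \<le> real n" using real_arch_simple by blast
  then have "T \<le> real (Suc n) * \<epsilon>" using \<epsilon> by (simp add: pos_divide_le_eq algebra_simps)
  then have "operator_bound t (D ^ Suc n)" if "t \<in> {0..T}" for t using that by (intro long) auto
  then show thesis by (rule that)
qed

lemma operator_bound_exists: "t \<ge> 0 \<Longrightarrow> \<exists>C. operator_bound t C"
  using operator_bound_Icc[of t] by (metis atLeastAtMost_iff order_refl)

lemma P_weighted_functional:
  assumes t: "t \<ge> 0" and C: "operator_bound t C"
  shows "weighted_functional \<rho> (\<lambda>f. P t f x) (C * \<rho> x)"
proof unfold_locales
  fix f assume f: "f \<in> Brho \<rho>"
  have "P t f x \<le> wnorm \<rho> (P t f) * \<rho> x" using Brho_bound[OF P_Brho[OF t f], of x] by linarith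
  also have "\<dots> \<le> (C * wnorm \<rho> f) * \<rho> x"
    using C f rho_nonneg[of x] by (intro mult_right_mono) (auto simp: operator_bound_def)
  finally show "P t f x \<le> C * \<rho> x * wnorm \<rho> f" by (simp add: mult_ac)
next
  show "0 \<le> C * \<rho> x" using C rho_nonneg[of x] by (simp add: operator_bound_def)
qed (simp_all add: P_add P_cmult P_nonneg P_one t)

lemma P_weighted_functional_exists: "t \<ge> 0 \<Longrightarrow> \<exists>c. weighted_functional \<rho> (\<lambda>f. P t f x) c"
  using operator_bound_exists P_weighted_functional by metis

lemma P_mono:
  assumes "t \<ge> 0" "f \<in> Brho \<rho>" "g \<in> Brho \<rho>" "\<And>x. f x \<le> g x" shows "P t f x \<le> P t g x"
  using P_weighted_functional_exists[OF assms(1), of x]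
  by (rule exE) (rule weighted_functional.L_mono[OF _ assms(2-4)])

lemma P_const: assumes "t \<ge> 0" shows "P t (\<lambda>x. a) x = a"
  using P_weighted_functional_exists[OF assms, of x]
  by (rule exE) (rule weighted_functional.L_const)

lemma P_diff:
  assumes "t \<ge> 0" "f \<in> Brho \<rho>" "g \<in> Brho \<rho>" shows "P t (\<lambda>x. f x - g x) x = P t f x - P t g x"
  using P_weighted_functional_exists[OF assms(1), of x]
  by (rule exE) (rule weighted_functional.L_diff[OF _ assms(2,3)])

lemma P_diff_le_weight:
  assumes "t \<ge> 0" "operator_bound t C" "f \<in> Brho \<rho>" "g \<in> Brho \<rho>" "\<epsilon> \<ge> 0" "\<And>x. \<bar>f x - g x\<bar> \<le> \<epsilon> * \<rho> x"
  shows "\<bar>P t f x - P t g x\<bar> \<le> C * \<epsilon> * \<rho> x"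
  using weighted_functional.L_diff_le_if_diff_le_weight[OF P_weighted_functional[OF assms(1,2)]
      assms(3-6)]
  by (simp add: mult_ac)

lemma P_bounded:
  assumes t: "t \<ge> 0" and f: "f \<in> Brho \<rho>" and B: "\<And>x. \<bar>f x\<bar> \<le> B"
  shows "\<bar>P t f x\<bar> \<le> B"
proof -
  have "f y \<le> B" "- B \<le> f y" for y using B[of y] by auto
  then show ?thesis
    using P_mono[OF t f Brho_const, of B x] P_mono[OF t Brho_const f, of "- B" x] P_const[OF t]
    by auto
qed

definition kernel :: "real \<Rightarrow> 'a \<Rightarrow> 'a measure" where
  "kernel t x = weighted_functional.riesz_measure (\<lambda>f. P t f x)"

lemma
  assumes "t \<ge> 0"
  shows prob_in_Mrho_kernel: "prob_in_Mrho \<rho> (kernel t x)"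
    and integral_kernel: "f \<in> Brho \<rho> \<Longrightarrow> (\<integral>y. f y \<partial>kernel t x) = P t f x"
    and measure_kernel_open: "open U \<Longrightarrow> measure (kernel t x) U = (SUP f\<in>cutoffs U. P t f x)"
proof -
  obtain c where "weighted_functional \<rho> (\<lambda>f. P t f x) c"
    using P_weighted_functional_exists[OF assms, of x] by (rule exE)
  then interpret weighted_functional \<rho> "\<lambda>f. P t f x" c .
  show "prob_in_Mrho \<rho> (kernel t x)" unfolding kernel_def by (rule prob_in_Mrho_riesz)
  show "f \<in> Brho \<rho> \<Longrightarrow> (\<integral>y. f y \<partial>kernel t x) = P t f x"
    unfolding kernel_def by (rule integral_riesz)
  show "open U \<Longrightarrow> measure (kernel t x) U = (SUP f\<in>cutoffs U. P t f x)"
    unfolding kernel_def by (rule measure_riesz_open)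
qed

lemma weighted_prob_kernel: "t \<ge> 0 \<Longrightarrow> weighted_prob \<rho> (kernel t x)"
  by (intro weighted_prob_if_prob_in_Mrho prob_in_Mrho_kernel)

lemma sets_kernel[simp]: "t \<ge> 0 \<Longrightarrow> sets (kernel t x) = sets borel"
  by (rule weighted_prob.sets_nu[OF weighted_prob_kernel])

lemma prob_space_kernel: "t \<ge> 0 \<Longrightarrow> prob_space (kernel t x)"
  using weighted_prob_kernel by (simp add: weighted_prob_def)

lemma nn_integral_rho_kernel:
  assumes "t \<ge> 0" "operator_bound t C"
  shows "(\<integral>\<^sup>+y. ennreal (\<rho> y) \<partial>kernel t x) \<le> ennreal (C * \<rho> x)"
  unfolding kernel_def
  by (rule weighted_functional.nn_integral_rho_riesz[OF P_weighted_functional[OF assms]])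

lemma nn_integral_kernel_Brho:
  assumes "t \<ge> 0" "f \<in> Brho \<rho>" "\<And>x. 0 \<le> f x"
  shows "(\<integral>\<^sup>+y. ennreal (f y) \<partial>kernel t x) = ennreal (P t f x)"
proof -
  have "integrable (kernel t x) f"
    by (rule weighted_prob.Brho_integrable[OF weighted_prob_kernel[OF assms(1)] assms(2)])
  then show ?thesis
    using assms(3) by (subst nn_integral_eq_integral) (auto simp: integral_kernel[OF assms(1,2)])
qed

lemma
  assumes t: "t \<ge> 0" and f: "f \<in> cutoffs U"
  shows P_cutoff_nonneg: "0 \<le> P t f x"
    and P_cutoff_le_1: "P t f x \<le> 1"
    and P_cutoff_sublevel_continuous: "sublevel_continuous (P t f)"
proof -
  show "0 \<le> P t f x" by (intro P_nonneg t cutoffs_Brho[OF f] cutoffs_nonneg[OF f])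
  show "P t f x \<le> 1"
    using P_bounded[OF t cutoffs_Brho[OF f] cutoffs_abs_le_1[OF f], of x] by simp
  show "sublevel_continuous (P t f)"
    by (intro Brho_sublevel_continuous P_Brho t cutoffs_Brho[OF f])
qed

lemma kernel_measurable[measurable]:
  assumes t: "t \<ge> 0" shows "kernel t \<in> borel \<rightarrow>\<^sub>M prob_algebra borel"
proof (rule measurable_prob_algebra_generated[where \<Omega> = UNIV and G = "Collect open"])
  fix U :: "'a set" assume U: "U \<in> Collect open"
  have "(\<lambda>x. SUP f\<in>cutoffs U. P t f x) \<in> borel_measurable borel"
    using P_cutoff_le_1[OF t]
    by (intro borel_measurable_SUP_sublevel_continuous P_cutoff_sublevel_continuous[OF t]
        cutoffs_nonempty)
      (auto intro!: bdd_aboveI[of _ 1])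
  then have "(\<lambda>x. ennreal (measure (kernel t x) U)) \<in> borel_measurable borel"
    using U by (simp add: measure_kernel_open[OF t])
  moreover have "emeasure (kernel t x) U = ennreal (measure (kernel t x) U)" for x
    using prob_space_kernel[OF t] by (simp add: prob_space_def finite_measure.emeasure_eq_measure)
  ultimately show "(\<lambda>x. emeasure (kernel t x) U) \<in> borel_measurable borel" by simp
qed (use t prob_space_kernel in \<open>auto simp: borel_def Int_stable_def\<close>)

lemma measure_eqI_open:
  fixes M N :: "'a measure"
  assumes M: "sets M = sets borel" "prob_space M" and N: "sets N = sets borel" "prob_space N"
    and eq: "\<And>U. open U \<Longrightarrow> measure M U = measure N U"
  shows "M = N"
proof (rule measure_eqI_generator_eq[where E = "Collect open" and \<Omega> = UNIV and A = "\<lambda>_. UNIV"])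
  interpret M: prob_space M by fact
  interpret N: prob_space N by fact
  show "emeasure M X = emeasure N X" if "X \<in> Collect open" for X
    using eq that by (simp add: M.emeasure_eq_measure N.emeasure_eq_measure)
  show "emeasure M UNIV \<noteq> \<infinity>" by simp
qed (use M N in \<open>auto simp: Int_stable_def borel_def\<close>)

lemma kernel_0: "kernel 0 x = return borel x"
proof (rule measure_eqI_open)
  show "prob_space (kernel 0 x)" "prob_space (return borel x)"
    using prob_space_kernel[of 0 x] prob_space_return[of x borel] by simp_all
  fix U :: "'a set" assume U: "open U"
  have "measure (kernel 0 x) U = (SUP f\<in>cutoffs U. f x)"
    using measure_kernel_open[OF order_refl U, of x] P_0[OF cutoffs_Brho] by (simp cong: SUP_cong)
  also have "\<dots> = indicator U x" by (rule SUP_cutoffs_eq_indicator[OF completely_regular U])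
  finally show "measure (kernel 0 x) U = measure (return borel x) U"
    using U by (simp add: measure_return)
qed auto

context
  fixes \<nu> :: "'a measure" and t :: real
  assumes \<nu>: "prob_in_Mrho \<rho> \<nu>" and t: "t \<ge> 0"
begin

interpretation weighted_prob \<rho> \<nu> by (rule weighted_prob_if_prob_in_Mrho[OF \<nu>])

lemma kernel_measurable_nu: "kernel t \<in> \<nu> \<rightarrow>\<^sub>M subprob_algebra borel"
  using measurable_prob_algebraD[OF kernel_measurable[OF t]]
  by (simp add: measurable_cong_sets[OF sets_nu refl])

lemma nn_integral_rho_bind_kernel:
  assumes C: "operator_bound t C"
  shows "(\<integral>\<^sup>+x. ennreal (\<rho> x) \<partial>(\<nu> \<bind> kernel t)) \<le> ennreal (C * (\<integral>x. \<rho> x \<partial>\<nu>))"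
proof -
  have "(\<integral>\<^sup>+x. ennreal (\<rho> x) \<partial>(\<nu> \<bind> kernel t)) = (\<integral>\<^sup>+x. (\<integral>\<^sup>+y. ennreal (\<rho> y) \<partial>kernel t x) \<partial>\<nu>)"
    by (intro nn_integral_bind[where B = borel] kernel_measurable_nu) simp
  also have "\<dots> \<le> (\<integral>\<^sup>+x. ennreal (C * \<rho> x) \<partial>\<nu>)"
    by (intro nn_integral_mono nn_integral_rho_kernel t C)
  also have "\<dots> = ennreal (\<integral>x. C * \<rho> x \<partial>\<nu>)"
    using C rho_nonneg integrable_rho
    by (intro nn_integral_eq_integral) (auto simp: operator_bound_def)
  finally show ?thesis by simp
qed

lemma weighted_prob_bind_kernel: "weighted_prob \<rho> (\<nu> \<bind> kernel t)"
proof (intro weighted_prob.intro weighted_prob_axioms.intro weighted_axioms)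
  have \<nu>_prob: "\<nu> \<in> space (prob_algebra borel)"
    using sets_nu prob_space_axioms by (simp add: space_prob_algebra)
  show sets: "sets (\<nu> \<bind> kernel t) = sets borel"
    by (rule sets_bind'[OF \<nu>_prob kernel_measurable[OF t]])
  show "prob_space (\<nu> \<bind> kernel t)" by (rule prob_space_bind'[OF \<nu>_prob kernel_measurable[OF t]])
  obtain C where "operator_bound t C" using operator_bound_exists[OF t] by blast
  from nn_integral_rho_bind_kernel[OF this] show "integrable (\<nu> \<bind> kernel t) \<rho>"
    using rho_nonneg by (intro integrableI_nonneg)
      (auto simp: measurable_cong_sets[OF sets refl] intro: le_less_trans)
qed

lemma integral_rho_bind_kernel_le:
  assumes C: "operator_bound t C"
  shows "(\<integral>x. \<rho> x \<partial>(\<nu> \<bind> kernel t)) \<le> C * (\<integral>x. \<rho> x \<partial>\<nu>)"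
proof -
  interpret bind: weighted_prob \<rho> "\<nu> \<bind> kernel t" by (rule weighted_prob_bind_kernel)
  have "ennreal (\<integral>x. \<rho> x \<partial>(\<nu> \<bind> kernel t)) = (\<integral>\<^sup>+x. ennreal (\<rho> x) \<partial>(\<nu> \<bind> kernel t))"
    using rho_nonneg by (intro nn_integral_eq_integral[symmetric] bind.integrable_rho) simp
  also have "\<dots> \<le> ennreal (C * (\<integral>x. \<rho> x \<partial>\<nu>))" by (rule nn_integral_rho_bind_kernel[OF C])
  finally show ?thesis
    using C integral_rho_nonneg by (subst (asm) ennreal_le_iff) (auto simp: operator_bound_def)
qed

lemma integral_bind_kernel_cutoff:
  assumes f: "f \<in> cutoffs U"
  shows "(\<integral>y. f y \<partial>(\<nu> \<bind> kernel t)) = (\<integral>x. P t f x \<partial>\<nu>)"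
proof -
  have "(\<integral>y. f y \<partial>(\<nu> \<bind> kernel t)) = (\<integral>x. (\<integral>y. f y \<partial>kernel t x) \<partial>\<nu>)"
    using cutoffs_abs_le_1[OF f] Brho_borel[OF cutoffs_Brho[OF f]]
        prob_space.emeasure_space_1[OF prob_space_kernel[OF t]]
    by (intro integral_bind[where K = borel and B = 1 and B' = 1] kernel_measurable_nu
        finite_measure_axioms) auto
  then show ?thesis using integral_kernel[OF t cutoffs_Brho[OF f]] by simp
qed

lemma measure_bind_kernel_open:
  assumes U: "open U"
  shows "measure (\<nu> \<bind> kernel t) U = (SUP f\<in>cutoffs U. \<integral>x. P t f x \<partial>\<nu>)"
proof -
  have "upward_directed (P t ` cutoffs U)"
    using upward_directed_cutoffs
    by (rule upward_directed_image_mono) (auto simp: le_fun_def intro!: P_mono t cutoffs_Brho)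
  then interpret directed_family \<rho> \<nu> "P t ` cutoffs U"
    using \<nu> P_cutoff_nonneg[OF t] P_cutoff_le_1[OF t] P_cutoff_sublevel_continuous[OF t]
    by unfold_locales auto
  have "measure (\<nu> \<bind> kernel t) U = (\<integral>x. measure (kernel t x) U \<partial>\<nu>)"
    using U by (intro measure_bind[OF kernel_measurable_nu]) simp
  also have "\<dots> = (SUP f\<in>cutoffs U. \<integral>x. P t f x \<partial>\<nu>)"
    using integral_directed_SUP by (simp add: measure_kernel_open[OF t U] image_image)
  finally show ?thesis .
qed

lemma prob_in_Mrho_bind_kernel: "prob_in_Mrho \<rho> (\<nu> \<bind> kernel t)"
proof (rule weighted_prob.prob_in_MrhoI[OF weighted_prob_bind_kernel])
  fix U :: "'a set" and e :: real assume U: "open U" and e: "e > 0"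
  show "\<exists>f\<in>cutoffs U. measure (\<nu> \<bind> kernel t) U \<le> (\<integral>y. f y \<partial>(\<nu> \<bind> kernel t)) + e"
  proof (rule ccontr)
    assume "\<not> ?thesis"
    then have "(\<integral>x. P t f x \<partial>\<nu>) \<le> measure (\<nu> \<bind> kernel t) U - e" if "f \<in> cutoffs U" for f
      using that by (fastforce simp: integral_bind_kernel_cutoff)
    then have "measure (\<nu> \<bind> kernel t) U \<le> measure (\<nu> \<bind> kernel t) U - e"
      by (intro order_trans[OF eq_refl[OF measure_bind_kernel_open[OF U]]] cSUP_least
          cutoffs_nonempty)
    with e show False by simp
  qed
qed

end

lemma chapman_kolmogorov:
  assumes s: "s \<ge> 0" and t: "t \<ge> 0"
  shows "kernel s x \<bind> kernel t = kernel (s + t) x"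
proof (rule measure_eqI_open)
  interpret bind: weighted_prob \<rho> "kernel s x \<bind> kernel t"
    by (intro weighted_prob_bind_kernel prob_in_Mrho_kernel s t)
  show "sets (kernel s x \<bind> kernel t) = sets borel" by (rule bind.sets_nu)
  show "prob_space (kernel s x \<bind> kernel t)" by (rule bind.prob_space_axioms)
  show "sets (kernel (s + t) x) = sets borel" "prob_space (kernel (s + t) x)"
    using s t prob_space_kernel by auto
  fix U :: "'a set" assume U: "open U"
  have "(\<integral>y. P t f y \<partial>kernel s x) = P (s + t) f x" if "f \<in> cutoffs U" for f
    using integral_kernel[OF s P_Brho[OF t cutoffs_Brho[OF that]]]
        P_semigroup[OF t cutoffs_Brho[OF that] s]
    by (simp add: add.commute)
  then show "measure (kernel s x \<bind> kernel t) U = measure (kernel (s + t) x) U"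
    using measure_bind_kernel_open[OF prob_in_Mrho_kernel[OF s] t U]
        measure_kernel_open[of "s + t" U x] s t U
    by (simp cong: SUP_cong)
qed

end

section \<open>Kolmogorov extension with compactly inner regular marginals\<close>

abbreviation (input) borel_PiM :: "'i set \<Rightarrow> ('i \<Rightarrow> 'a::topological_space) measure" where
  "borel_PiM I \<equiv> PiM I (\<lambda>_. borel)"

abbreviation (input) powertop :: "'i set \<Rightarrow> ('i \<Rightarrow> 'a::topological_space) topology" where
  "powertop I \<equiv> product_topology (\<lambda>_. euclidean) I"

lemma continuous_map_restrict_powertop:
  assumes "J \<subseteq> I" shows "continuous_map (powertop I) (powertop J) (\<lambda>w. restrict w J)"
  using assms by (subst continuous_map_componentwise)
    (auto intro!: continuous_map_product_projection simp: Pi_iff)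

lemma Hausdorff_powertop:
  "Hausdorff_space (euclidean :: 'a::topological_space topology) \<Longrightarrow>
      Hausdorff_space (powertop J :: ('i \<Rightarrow> 'a) topology)"
  by (simp add: Hausdorff_space_product_topology)

definition first_index :: "(nat \<Rightarrow> 'i set) \<Rightarrow> 'i \<Rightarrow> nat" where
  "first_index J i = (LEAST n. i \<in> J n)"

lemma first_index:
  assumes "i \<in> J n" shows "i \<in> J (first_index J i)" "first_index J i \<le> n"
  unfolding first_index_def using assms by (auto intro: LeastI Least_le)

definition coordinate_range :: "(nat \<Rightarrow> 'i set) \<Rightarrow> (nat \<Rightarrow> ('i \<Rightarrow> 'a) set) \<Rightarrow> 'i \<Rightarrow> 'a set" where
  "coordinate_range J Z i = (if \<exists>n. i \<in> J n then (\<lambda>w. w i) ` Z (first_index J i) else {undefined})"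

lemma compact_coordinate_range:
  assumes "\<And>n. compactin (powertop (J n)) (Z n)" shows "compact (coordinate_range J Z i)"
proof (cases "\<exists>n. i \<in> J n")
  case True
  then obtain n where "i \<in> J n" by blast
  then have "i \<in> J (first_index J i)" by (rule first_index(1)[where J = J])
  then have "compactin euclidean ((\<lambda>w. w i) ` Z (first_index J i))"
    by (intro image_compactin[OF assms continuous_map_product_projection])
  then show ?thesis using True by (simp add: coordinate_range_def)
qed (simp add: coordinate_range_def)

lemma extend_into_coordinate_ranges:
  assumes J: "\<And>n. J n \<subseteq> I" "incseq J" and Z: "\<And>n. Z n \<noteq> {}"
    and w: "\<And>m. m \<le> n \<Longrightarrow> restrict w (J m) \<in> Z m"
  obtains v where "v \<in> (\<Pi>\<^sub>E i\<in>I. coordinate_range J Z i)" "\<And>m. m \<le> n \<Longrightarrow> restrict v (J m) \<in> Z m"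
proof -
  define v where "v = (\<lambda>i\<in>I. if i \<in> J n then w i else (SOME x. x \<in> coordinate_range J Z i))"
  have "coordinate_range J Z i \<noteq> {}" for i using Z by (simp add: coordinate_range_def)
  then have some: "(SOME x. x \<in> coordinate_range J Z i) \<in> coordinate_range J Z i" for i
    by (simp add: some_in_eq)
  have "w i \<in> coordinate_range J Z i" if i: "i \<in> J n" for i
  proof -
    have "restrict w (J (first_index J i)) i \<in> (\<lambda>w. w i) ` Z (first_index J i)"
      by (intro imageI w first_index(2)[where J = J, OF i])
    then show ?thesis using i first_index(1)[where J = J, OF i] by (auto simp: coordinate_range_def)
  qed
  then have "v \<in> (\<Pi>\<^sub>E i\<in>I. coordinate_range J Z i)" using some by (auto simp: v_def)
  moreover have "restrict v (J m) \<in> Z m" if "m \<le> n" for m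
  proof -
    have "J m \<subseteq> J n" using J(2) that by (auto simp: incseq_def)
    then have "restrict v (J m) = restrict w (J m)"
      using J(1)[of n] by (intro ext) (auto simp: v_def restrict_def)
    then show ?thesis using w[OF that] by simp
  qed
  ultimately show thesis by (rule that)
qed

lemma compact_restrictions_common_point:
  fixes Z :: "nat \<Rightarrow> ('i \<Rightarrow> 'a::topological_space) set"
  assumes Hausdorff: "Hausdorff_space (euclidean :: 'a topology)"
    and J: "\<And>n. J n \<subseteq> I" "incseq J" and Z: "\<And>n. compactin (powertop (J n)) (Z n)"
    and consistent: "\<And>n. \<exists>w. \<forall>m\<le>n. restrict w (J m) \<in> Z m"
  obtains w where "w \<in> extensional I" "\<And>n. restrict w (J n) \<in> Z n"
proof -
  define box where "box = (\<Pi>\<^sub>E i\<in>I. coordinate_range J Z i)"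
  define D where "D n = {w \<in> topspace (powertop I). restrict w (J n) \<in> Z n}" for n
  have nonempty: "Z n \<noteq> {}" for n using consistent[of n] by auto
  have compact_box: "compactin (powertop I) box"
    unfolding box_def using compact_coordinate_range[OF Z] by (simp add: compactin_PiE)
  have closed_D: "closedin (powertop I) (D n)" for n
    unfolding D_def using compactin_imp_closedin[OF Hausdorff_powertop[OF Hausdorff] Z] J(1)
    by (intro closedin_continuous_map_preimage[OF continuous_map_restrict_powertop]) auto
  have fip: "box \<inter> \<Inter>\<F> \<noteq> {}" if \<F>: "finite \<F>" "\<F> \<subseteq> range D" for \<F>
  proof -
    obtain S where S: "finite S" "\<F> = D ` S" using finite_subset_image[OF \<F>] by blast
    obtain n where n: "\<And>m. m \<in> S \<Longrightarrow> m \<le> n" using S(1)[unfolded finite_nat_set_iff_bounded_le] by auto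
    obtain w where w: "\<And>m. m \<le> n \<Longrightarrow> restrict w (J m) \<in> Z m" using consistent[of n] by blast
    obtain v where "v \<in> box" "\<And>m. m \<le> n \<Longrightarrow> restrict v (J m) \<in> Z m"
      unfolding box_def
      by (rule extend_into_coordinate_ranges[where J = J and n = n, OF J nonempty w]) blast+
    then have "v \<in> box \<inter> \<Inter>\<F>" using n by (auto simp: S(2) D_def box_def PiE_iff)
    then show ?thesis by blast
  qed
  have "box \<inter> \<Inter>(range D) \<noteq> {}"
    using compact_box[unfolded compactin_fip, THEN conjunct2, rule_format, of "range D"]
      closed_D fip by blast
  then obtain w where w: "w \<in> D n" for n by blast
  show thesis
  proof (rule that)
    show "w \<in> extensional I" using w[of 0] by (simp add: D_def PiE_iff)
    show "restrict w (J n) \<in> Z n" for n using w[of n] by (simp add: D_def)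
  qed
qed

locale regular_projective_family = projective_family I P "\<lambda>_. borel"
  for I :: "'i set" and P :: "'i set \<Rightarrow> ('i \<Rightarrow> 'a::topological_space) measure" +
  assumes Hausdorff: "Hausdorff_space (euclidean :: 'a topology)"
    and regular: "\<And>i A. i \<in> I \<Longrightarrow> A \<in> sets borel \<Longrightarrow>
      inner_regular_wrt (distr (P {i}) borel (\<lambda>w. w i)) (Collect compact) A"
begin

lemma compact_borel: "compact (K :: 'a set) \<Longrightarrow> K \<in> sets borel"
  using Hausdorff_compact_imp_closed[OF Hausdorff] by auto

lemma space_P_PiE: "finite J \<Longrightarrow> J \<subseteq> I \<Longrightarrow> space (P J) = (\<Pi>\<^sub>E i\<in>J. UNIV)"
  by (simp add: space_P space_PiM)

definition measurable_compacts :: "'i set \<Rightarrow> ('i \<Rightarrow> 'a) set set" where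
  "measurable_compacts J = {C \<in> sets (borel_PiM J). compactin (powertop J) C}"

context
  fixes J :: "'i set" assumes J: "finite J" "J \<subseteq> I"
begin

interpretation PJ: prob_space "P J" by (rule prob_space_P[OF J])

lemmas [measurable_cong] = sets_P[OF J]

lemma coordinate_measurable_P: "i \<in> J \<Longrightarrow> (\<lambda>w. w i) \<in> P J \<rightarrow>\<^sub>M borel"
  by measurable

lemma distr_P_coordinate:
  assumes i: "i \<in> J" shows "distr (P J) borel (\<lambda>w. w i) = distr (P {i}) borel (\<lambda>w. w i)"
proof -
  have "distr (P {i}) borel (\<lambda>w. w i) =
      distr (distr (P J) (borel_PiM {i}) (\<lambda>w. restrict w {i})) borel (\<lambda>w. w i)"
    using P[of "{i}" J] i J by simp
  also have "\<dots> = distr (P J) borel ((\<lambda>w. w i) \<circ> (\<lambda>w. restrict w {i}))"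
    using i measurable_restrict_subset[of "{i}" J "\<lambda>_. borel"]
    by (intro distr_distr) (auto simp: measurable_cong_sets[OF sets_P[OF J] refl])
  also have "\<dots> = distr (P J) borel (\<lambda>w. w i)" by (simp add: comp_def)
  finally show ?thesis ..
qed

lemma coordinate_compact_approx:
  assumes i: "i \<in> J" and A: "A \<in> sets borel" and e: "e > 0"
  obtains K where "compact K" "K \<subseteq> A" "measure (P J) {w \<in> space (P J). w i \<in> A - K} < e"
proof -
  have "inner_regular_wrt (distr (P J) borel (\<lambda>w. w i)) (Collect compact) A"
    using distr_P_coordinate[OF i] regular[of i A] i J(2) A by auto
  then obtain K where K: "compact K" "K \<subseteq> A" "measure (distr (P J) borel (\<lambda>w. w i)) (A - K) < e"
    using e by (rule inner_regular_wrtE) simp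
  have "measure (distr (P J) borel (\<lambda>w. w i)) (A - K) =
      measure (P J) {w \<in> space (P J). w i \<in> A - K}"
    using A compact_borel[OF K(1)]
    by (subst measure_distr[OF coordinate_measurable_P[OF i]])
      (auto simp: vimage_def Int_def conj_commute)
  with K show thesis by (intro that) auto
qed

lemma PiE_compact_in_measurable_compacts:
  assumes "\<And>i. i \<in> J \<Longrightarrow> compact (K i)" shows "(\<Pi>\<^sub>E i\<in>J. K i) \<in> measurable_compacts J"
  using assms J(1) compact_borel
  by (auto simp: measurable_compacts_def compactin_PiE intro!: sets_PiM_I_finite)

lemma compact_box_approx:
  assumes e: "e > 0"
  obtains C where "C \<in> measurable_compacts J" "measure (P J) (space (P J) - C) < e"
proof -
  define d where "d = e / (real (card J) + 1)"
  have d: "d > 0" "real (card J) * d < e" using e by (auto simp: d_def field_simps)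
  have "\<forall>i\<in>J. \<exists>K. compact K \<and> measure (P J) {w \<in> space (P J). w i \<in> UNIV - K} < d"
    by (rule ballI, rule coordinate_compact_approx[OF _ _ d(1), of _ UNIV]) auto
  from bchoice[OF this] obtain K where K: "\<And>i. i \<in> J \<Longrightarrow> compact (K i)"
    "\<And>i. i \<in> J \<Longrightarrow> measure (P J) {w \<in> space (P J). w i \<in> UNIV - K i} < d" by blast
  have sets: "{w \<in> space (P J). w i \<in> UNIV - K i} \<in> sets (P J)" if "i \<in> J" for i
    using compact_borel[OF K(1)[OF that]] that by measurable
  have "measure (P J) (space (P J) - (\<Pi>\<^sub>E i\<in>J. K i)) \<le>
      measure (P J) (\<Union>i\<in>J. {w \<in> space (P J). w i \<in> UNIV - K i})"
    using sets J(1) by (intro PJ.finite_measure_mono) (auto simp: space_P_PiE[OF J] PiE_iff)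
  also have "\<dots> \<le> (\<Sum>i\<in>J. measure (P J) {w \<in> space (P J). w i \<in> UNIV - K i})"
    using sets J(1) by (intro PJ.finite_measure_subadditive_finite) auto
  also have "\<dots> \<le> (\<Sum>i\<in>J. d)" by (intro sum_mono less_imp_le K)
  also have "\<dots> < e" using d by simp
  finally show thesis using PiE_compact_in_measurable_compacts[OF K(1)] by (intro that)
qed

lemma paving_measurable_compacts: "paving (P J) (measurable_compacts J)"
proof unfold_locales
  show "measurable_compacts J \<subseteq> sets (P J)" by (auto simp: measurable_compacts_def sets_P[OF J])
  show "{} \<in> measurable_compacts J" by (simp add: measurable_compacts_def)
  show "A \<union> B \<in> measurable_compacts J"
    if "A \<in> measurable_compacts J" "B \<in> measurable_compacts J" for A B
    using that by (auto simp: measurable_compacts_def intro: compactin_Un)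
  fix C :: "nat \<Rightarrow> ('i \<Rightarrow> 'a) set" assume "range C \<subseteq> measurable_compacts J"
  then have "C n \<in> sets (borel_PiM J)" "compactin (powertop J) (C n)" for n
    by (auto simp: measurable_compacts_def)
  then show "(\<Inter>n. C n) \<in> measurable_compacts J"
    using compactin_imp_closedin[OF Hausdorff_powertop[OF Hausdorff]]
    by (auto simp: measurable_compacts_def
        intro!: sets.countable_INT' closed_compactin_Inter[of _ "C 0"])
qed

lemma cylinder_inner_regular:
  assumes i: "i \<in> J" and A: "A \<in> sets borel"
  shows "inner_regular_wrt (P J) (measurable_compacts J) {w \<in> space (P J). w i \<in> A}"
proof (rule inner_regular_wrtI)
  fix e :: real assume "e > 0"
  then have e2: "e / 2 > 0" by simp
  obtain C where C: "C \<in> measurable_compacts J" "measure (P J) (space (P J) - C) < e / 2"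
    using compact_box_approx[OF e2] by blast
  obtain K where K: "compact K" "K \<subseteq> A" "measure (P J) {w \<in> space (P J). w i \<in> A - K} < e / 2"
    using coordinate_compact_approx[OF i A e2] by blast
  define D where "D = {w \<in> space (P J). w i \<in> K}"
  have [measurable]: "K \<in> sets borel" "A - K \<in> sets borel" "C \<in> sets (P J)"
    using compact_borel[OF K(1)] A C(1) by (auto simp: measurable_compacts_def sets_P[OF J])
  have sets: "D \<in> sets (P J)" "{w \<in> space (P J). w i \<in> A - K} \<in> sets (P J)"
    "space (P J) - C \<in> sets (P J)"
    unfolding D_def using i by measurable
  have "closedin (powertop J) {w \<in> topspace (powertop J). w i \<in> K}"
    using Hausdorff_compact_imp_closed[OF Hausdorff K(1)] i
    by (intro closedin_continuous_map_preimage[OF continuous_map_product_projection]) auto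
  then have "C \<inter> D \<in> measurable_compacts J"
    using C(1) sets(1) unfolding measurable_compacts_def D_def
    by (auto simp: space_P_PiE[OF J] sets_P[OF J] intro: compact_Int_closedin)
  moreover have "measure (P J) ({w \<in> space (P J). w i \<in> A} - C \<inter> D) < e"
  proof -
    have "measure (P J) ({w \<in> space (P J). w i \<in> A} - C \<inter> D) \<le>
        measure (P J) ((space (P J) - C) \<union> {w \<in> space (P J). w i \<in> A - K})"
      using sets by (intro PJ.finite_measure_mono) (auto simp: D_def)
    also have "\<dots> \<le> measure (P J) (space (P J) - C) + measure (P J) {w \<in> space (P J). w i \<in> A - K}"
      using sets by (intro measure_Un_le)
    also have "\<dots> < e" using C(2) K(3) by simp
    finally show ?thesis .
  qed
  moreover have "C \<inter> D \<subseteq> {w \<in> space (P J). w i \<in> A}" using K(2) by (auto simp: D_def)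
  ultimately show "\<exists>C\<in>measurable_compacts J. C \<subseteq> {w \<in> space (P J). w i \<in> A} \<and>
      measure (P J) ({w \<in> space (P J). w i \<in> A} - C) < e" by blast
qed

lemma inner_regular_P:
  assumes X: "X \<in> sets (borel_PiM J)"
  shows "inner_regular_wrt (P J) (measurable_compacts J) X"
proof -
  interpret paving "P J" "measurable_compacts J" by (rule paving_measurable_compacts)
  let ?cylinders = "{{w\<in>\<Pi>\<^sub>E i\<in>J. UNIV. w i \<in> A} | i A. i \<in> J \<and> A \<in> sets (borel :: 'a measure)}"
  show ?thesis
  proof (rule inner_regular_wrt_sigma_sets[where G = ?cylinders])
    show "sets (P J) = sigma_sets (space (P J)) ?cylinders"
      using sets_PiM_single[of J "\<lambda>_. borel :: 'a measure"]
      by (simp add: sets_P[OF J] space_P_PiE[OF J])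
    show "inner_regular_wrt (P J) (measurable_compacts J) (space (P J))"
    proof (rule inner_regular_wrtI)
      fix e :: real assume "e > 0"
      then obtain C where "C \<in> measurable_compacts J" "measure (P J) (space (P J) - C) < e"
        by (rule compact_box_approx)
      then show "\<exists>C\<in>measurable_compacts J. C \<subseteq> space (P J) \<and> measure (P J) (space (P J) - C) < e"
        using paving_sets sets.sets_into_space by blast
    qed
    fix Y assume "Y \<in> ?cylinders"
    then obtain i A where Y: "Y = {w \<in> space (P J). w i \<in> A}" "i \<in> J" "A \<in> sets borel"
      by (auto simp: space_P_PiE[OF J])
    show "inner_regular_wrt (P J) (measurable_compacts J) Y"
      unfolding Y(1) by (rule cylinder_inner_regular[OF Y(2,3)])
    have "space (P J) - Y = {w \<in> space (P J). w i \<in> - A}" unfolding Y(1) by blast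
    then show "inner_regular_wrt (P J) (measurable_compacts J) (space (P J) - Y)"
      using cylinder_inner_regular[OF Y(2), of "- A"] Y(3) by (simp add: Compl_eq_Diff_UNIV)
  qed (use X in \<open>simp add: sets_P[OF J]\<close>)
qed

end

lemma compact_approximations_consistent:
  fixes J :: "nat \<Rightarrow> 'i set" and X Z :: "nat \<Rightarrow> ('i \<Rightarrow> 'a) set"
  assumes J: "\<And>n. J n \<subseteq> I" "incseq J" "\<And>n. finite (J n)"
    and X: "\<And>n. X n \<in> sets (borel_PiM (J n))" "decseq (\<lambda>n. emb I (J n) (X n))"
    and a: "a > 0" "a \<le> measure (P (J n)) (X n)"
    and Z: "\<And>n. Z n \<in> sets (borel_PiM (J n))"
      "\<And>n. measure (P (J n)) (X n - Z n) \<le> a / 2 * (1/2)^Suc n"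
  shows "\<exists>w. \<forall>m\<le>n. restrict w (J m) \<in> Z m"
proof -
  interpret Pn: prob_space "P (J n)" by (rule prob_space_P[OF J(3,1)])
  have mono: "J m \<subseteq> J n" if "m \<le> n" for m using J(2) that by (auto simp: incseq_def)
  define D where "D m = (if m \<le> n then emb (J n) (J m) (X m - Z m) else {})" for m
  have D_sets: "D m \<in> sets (P (J n))" for m
    unfolding D_def sets_P[OF J(3,1)] using mono[of m] X(1) Z(1)
    by (cases "m \<le> n") (auto intro!: measurable_prod_emb sets.Diff)
  have "measure (P (J n)) (D m) \<le> a / 2 * (1/2)^Suc m" for m
  proof (cases "m \<le> n")
    case True
    then have "D m = emb (J n) (J m) (X m - Z m)" by (simp only: D_def if_True)
    moreover have "emeasure (P (J n)) (emb (J n) (J m) (X m - Z m)) =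
        emeasure (P (J m)) (X m - Z m)"
      by (intro emeasure_P mono[OF True] J sets.Diff X Z)
    ultimately show ?thesis using Z(2)[of m] by (simp only: measure_def)
  qed (use a(1) in \<open>simp add: D_def\<close>)
  then have "measure (P (J n)) (\<Union>m. D m) \<le> a / 2" using D_sets by (intro Pn.measure_UN_le_geometric)
  then have "\<not> X n \<subseteq> (\<Union>m. D m)"
    using a Pn.finite_measure_mono[of "X n" "\<Union>m. D m"] D_sets by auto
  then obtain w where w: "w \<in> X n" "\<And>m. w \<notin> D m" by blast
  have w_ext: "w \<in> extensional (J n)"
    using subsetD[OF sets.sets_into_space[OF X(1)] w(1)] by (simp add: space_PiM PiE_iff)
  then have "w \<in> emb I (J n) (X n)"
    using w(1) J(1)[of n] extensional_restrict[OF w_ext]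
    by (auto simp: prod_emb_def PiE_iff extensional_def)
  then have "w \<in> emb I (J m) (X m)" if "m \<le> n" for m using X(2) that by (auto simp: decseq_def)
  then have "restrict w (J m) \<in> Z m" if "m \<le> n" for m
    using w(2)[of m] w_ext that by (auto simp: D_def prod_emb_def PiE_iff)
  then show ?thesis by blast
qed

lemma emb_Inter_nonempty:
  fixes J :: "nat \<Rightarrow> 'i set" and X :: "nat \<Rightarrow> ('i \<Rightarrow> 'a) set"
  assumes J: "\<And>n. J n \<subseteq> I" "incseq J" "\<And>n. finite (J n)"
    and X: "\<And>n. X n \<in> sets (borel_PiM (J n))" "decseq (\<lambda>n. emb I (J n) (X n))"
    and pos: "0 < (INF n. emeasure (P (J n)) (X n))"
  shows "(\<Inter>n. emb I (J n) (X n)) \<noteq> {}"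
proof -
  obtain b where b: "0 < b" "b < (INF n. emeasure (P (J n)) (X n))" using dense[OF pos] by blast
  define a where "a = enn2real b"
  have a_b: "ennreal a = b"
    unfolding a_def using b(2) by (intro ennreal_enn2real) (auto intro: less_le_trans)
  then have a: "a > 0" using b(1) by (simp add: ennreal_less_zero_iff flip: a_b)
  have a_le: "a \<le> measure (P (J n)) (X n)" for n
  proof -
    interpret prob_space "P (J n)" by (rule prob_space_P[OF J(3,1)])
    have "ennreal a \<le> emeasure (P (J n)) (X n)"
      using less_imp_le[OF b(2)] by (simp add: a_b le_INF_iff)
    then show ?thesis by (simp add: emeasure_eq_measure)
  qed
  have "\<exists>Z. Z \<in> measurable_compacts (J n) \<and> Z \<subseteq> X n \<and>
      measure (P (J n)) (X n - Z) < a / 2 * (1/2)^Suc n" for n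
    by (rule inner_regular_wrtE[OF inner_regular_P[OF J(3,1) X(1)], of "a / 2 * (1/2)^Suc n" n])
      (use a in auto)
  then obtain Z where Z: "\<And>n. Z n \<in> measurable_compacts (J n)" "\<And>n. Z n \<subseteq> X n"
    "\<And>n. measure (P (J n)) (X n - Z n) < a / 2 * (1/2)^Suc n" by metis
  then have Z_sets: "Z n \<in> sets (borel_PiM (J n))"
    and Z_compact: "compactin (powertop (J n)) (Z n)" for n
    by (auto simp: measurable_compacts_def)
  have "\<exists>w. \<forall>m\<le>n. restrict w (J m) \<in> Z m" for n
    by (rule compact_approximations_consistent[OF J X a a_le Z_sets less_imp_le[OF Z(3)]])
  then obtain w where "w \<in> extensional I" "\<And>n. restrict w (J n) \<in> Z n"
    by (rule compact_restrictions_common_point[OF Hausdorff J(1,2) Z_compact]) blast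
  then have "w \<in> emb I (J n) (X n)" for n using Z(2)[of n] by (auto simp: prod_emb_def PiE_iff)
  then show ?thesis by blast
qed

lemma emeasure_lim_emb:
  assumes "finite J" "J \<subseteq> I" "X \<in> sets (borel_PiM J)"
  shows "emeasure lim (emb I J X) = emeasure (P J) X"
  using assms emb_Inter_nonempty by (rule emeasure_lim)

lemma prob_space_lim: "prob_space lim"
proof
  interpret P0: prob_space "P {}" by (rule prob_space_P) auto
  have "emeasure lim (emb I {} (space (borel_PiM {}))) = 1"
    using P0.emeasure_space_1 by (subst emeasure_lim_emb) (auto simp: space_P)
  moreover have "emb I {} (space (borel_PiM {})) = space lim"
    by (auto simp: prod_emb_def space_PiM restrict_def)
  ultimately show "emeasure lim (space lim) = 1" by simp
qed

lemma distr_lim: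
  assumes J: "finite J" "J \<subseteq> I"
  shows "distr lim (borel_PiM J) (\<lambda>w. restrict w J) = P J"
proof (rule measure_eqI)
  fix X assume "X \<in> sets (distr lim (borel_PiM J) (\<lambda>w. restrict w J))"
  then have X: "X \<in> sets (borel_PiM J)" by simp
  then show "emeasure (distr lim (borel_PiM J) (\<lambda>w. restrict w J)) X = emeasure (P J) X"
    using emeasure_lim_emb[OF J X] J
    by (subst emeasure_distr)
      (auto simp: prod_emb_def space_PiM measurable_cong_sets[OF sets_lim refl]
        intro!: measurable_restrict_subset)
qed (simp add: sets_P[OF J])

end

section \<open>Finite-dimensional laws of a transition function\<close>

lemma coordinate_compose_measurable:
  assumes "i \<in> I" "g \<in> borel \<rightarrow>\<^sub>M N"
  shows "(\<lambda>w. g (w i)) \<in> borel_PiM I \<rightarrow>\<^sub>M N"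
  using measurable_compose[OF measurable_component_singleton[OF assms(1)] assms(2)] .

lemma prod_indicator_eq_indicator_PiE:
  assumes "finite J" "w \<in> extensional J"
  shows "(\<Prod>t\<in>J. indicator (A t) (w t)) = (indicator (\<Pi>\<^sub>E t\<in>J. A t) w :: ennreal)"
  using assms by (auto simp: indicator_def PiE_iff prod_zero_iff)

lemma filter_sorted_list_of_set:
  fixes H :: "'a::linorder set"
  assumes "finite H" "J \<subseteq> H"
  shows "filter (\<lambda>t. t \<in> J) (sorted_list_of_set H) = sorted_list_of_set J"
  using assms finite_subset[OF assms(2,1)]
  by (intro sorted_distinct_set_unique) (auto intro: sorted_wrt_filter)

lemma sorted_list_of_set_greatest:
  fixes t :: "'a::linorder"
  assumes "finite H" "t \<in> H" "\<And>r. r \<in> H \<Longrightarrow> r \<le> t"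
  shows "sorted_list_of_set H = sorted_list_of_set (H - {t}) @ [t]"
proof (rule sorted_distinct_set_unique)
  show "sorted (sorted_list_of_set (H - {t}) @ [t])" using assms by (auto simp: sorted_append)
  show "distinct (sorted_list_of_set (H - {t}) @ [t])" using assms by auto
  show "set (sorted_list_of_set H) = set (sorted_list_of_set (H - {t}) @ [t])" using assms by auto
qed (rule sorted_sorted_list_of_set distinct_sorted_list_of_set)+

abbreviation (input) paths :: "(real \<Rightarrow> 'a::topological_space) measure" where
  "paths \<equiv> borel_PiM {0..}"

lemma fun_upd_paths_measurable:
  assumes "0 \<le> t" shows "(\<lambda>(y, w). fun_upd w t y) \<in> borel \<Otimes>\<^sub>M paths \<rightarrow>\<^sub>M paths"
proof -
  have "(\<lambda>p. fun_upd (snd p) t (fst p)) \<in> borel \<Otimes>\<^sub>M paths \<rightarrow>\<^sub>M paths"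
    using assms by (intro measurable_fun_upd[where J = "{0..}"]) auto
  then show ?thesis by (simp add: case_prod_unfold)
qed

definition increasing_times :: "real \<Rightarrow> real list \<Rightarrow> bool" where
  "increasing_times s ts \<longleftrightarrow> 0 \<le> s \<and> sorted_wrt (<) ts \<and> (\<forall>t\<in>set ts. s \<le> t)"

lemma increasing_times_Cons:
  "increasing_times s (t # ts) \<longleftrightarrow> 0 \<le> s \<and> s \<le> t \<and> increasing_times t ts \<and> t \<notin> set ts"
  by (auto simp: increasing_times_def order.strict_iff_order)

lemma increasing_times_filter: "increasing_times s ts \<Longrightarrow> increasing_times s (filter Q ts)"
  by (auto simp: increasing_times_def sorted_wrt_filter)

lemma increasing_times_sorted_list_of_set:
  "finite J \<Longrightarrow> J \<subseteq> {0..} \<Longrightarrow> increasing_times 0 (sorted_list_of_set J)"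
  by (auto simp: increasing_times_def)

locale transition_function =
  fixes \<kappa> :: "real \<Rightarrow> 'a::topological_space \<Rightarrow> 'a measure"
  assumes kernel_measurable: "t \<ge> 0 \<Longrightarrow> \<kappa> t \<in> borel \<rightarrow>\<^sub>M prob_algebra borel"
    and kernel_0: "\<kappa> 0 x = return borel x"
    and chapman_kolmogorov: "s \<ge> 0 \<Longrightarrow> t \<ge> 0 \<Longrightarrow> \<kappa> s x \<bind> \<kappa> t = \<kappa> (s + t) x"
begin

lemma kernel_subprob: "t \<ge> 0 \<Longrightarrow> \<kappa> t \<in> borel \<rightarrow>\<^sub>M subprob_algebra borel"
  by (intro measurable_prob_algebraD kernel_measurable)

lemma sets_kernel: "t \<ge> 0 \<Longrightarrow> sets (\<kappa> t x) = sets borel"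
  and prob_space_kernel: "t \<ge> 0 \<Longrightarrow> prob_space (\<kappa> t x)"
  using measurable_space[OF kernel_measurable, of t x] by (simp_all add: space_prob_algebra)

lemma nn_integral_kernel_measurable:
  assumes "0 \<le> t" "f \<in> borel_measurable borel"
  shows "(\<lambda>x. \<integral>\<^sup>+y. f y \<partial>\<kappa> t x) \<in> borel_measurable borel"
  using measurable_compose[OF kernel_subprob[OF assms(1)]
      nn_integral_measurable_subprob_algebra[OF assms(2)]] .

lemma nn_integral_kernel_kernel:
  assumes "0 \<le> s" "0 \<le> t" "f \<in> borel_measurable borel"
  shows "(\<integral>\<^sup>+y. (\<integral>\<^sup>+z. f z \<partial>\<kappa> t y) \<partial>\<kappa> s x) = (\<integral>\<^sup>+z. f z \<partial>\<kappa> (s + t) x)"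
  unfolding chapman_kolmogorov[OF assms(1,2), symmetric]
  using kernel_subprob[OF assms(2)] assms(3)
  by (intro nn_integral_bind[symmetric])
    (auto simp: measurable_cong_sets[OF sets_kernel[OF assms(1)] refl])

(* Only the coordinates in the list carry meaning: the others hold the state at the last listed
   time. *)
primrec path_law :: "real list \<Rightarrow> real \<Rightarrow> 'a \<Rightarrow> (real \<Rightarrow> 'a) measure" where
  "path_law [] = (\<lambda>s x. return paths (\<lambda>t\<in>{0..}. x))"
| "path_law (t # ts) =
    (\<lambda>s x. \<kappa> (t - s) x \<bind> (\<lambda>y. distr (path_law ts t y) paths (\<lambda>w. fun_upd w t y)))"

primrec iterated_integral :: "(real \<Rightarrow> 'a \<Rightarrow> ennreal) \<Rightarrow> real list \<Rightarrow> real \<Rightarrow> 'a \<Rightarrow> ennreal" where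
  "iterated_integral g [] = (\<lambda>s x. 1)"
| "iterated_integral g (t # ts) = (\<lambda>s x. \<integral>\<^sup>+y. g t y * iterated_integral g ts t y \<partial>\<kappa> (t - s) x)"

lemma path_law_measurable: "increasing_times s ts \<Longrightarrow> path_law ts s \<in> borel \<rightarrow>\<^sub>M prob_algebra paths"
proof (induction ts arbitrary: s)
  case Nil
  have "(\<lambda>x. \<lambda>t\<in>{0..}. x) \<in> borel \<rightarrow>\<^sub>M paths" by (intro measurable_restrict) auto
  from measurable_compose[OF this measurable_return_prob_space] show ?case by simp
next
  case (Cons t ts)
  then have t: "0 \<le> s" "s \<le> t" "increasing_times t ts" by (auto simp: increasing_times_Cons)
  have "(\<lambda>y. distr (path_law ts t y) paths (\<lambda>w. fun_upd w t y)) \<in> borel \<rightarrow>\<^sub>M prob_algebra paths"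
    using t by (intro measurable_distr_prob_space2[OF Cons.IH[OF t(3)]] fun_upd_paths_measurable)
      auto
  from measurable_bind_prob_space[OF kernel_measurable this] show ?case using t by simp
qed

lemma sets_path_law: "increasing_times s ts \<Longrightarrow> sets (path_law ts s x) = sets paths"
  and prob_space_path_law: "increasing_times s ts \<Longrightarrow> prob_space (path_law ts s x)"
  using measurable_space[OF path_law_measurable, of s ts x] by (simp_all add: space_prob_algebra)

lemma nn_integral_path_law_Cons:
  assumes times: "increasing_times s (t # ts)" and F: "F \<in> borel_measurable paths"
  shows "(\<integral>\<^sup>+w. F w \<partial>path_law (t # ts) s x) =
    (\<integral>\<^sup>+y. (\<integral>\<^sup>+w. F (fun_upd w t y) \<partial>path_law ts t y) \<partial>\<kappa> (t - s) x)"
proof -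
  have t: "0 \<le> s" "s \<le> t" "increasing_times t ts" using times by (auto simp: increasing_times_Cons)
  have upd: "(\<lambda>w. fun_upd w t y) \<in> paths \<rightarrow>\<^sub>M paths" for y :: 'a
    using t by (intro measurable_fun_upd[where J = "{0..}"]) auto
  have "(\<lambda>y. distr (path_law ts t y) paths (\<lambda>w. fun_upd w t y)) \<in> borel \<rightarrow>\<^sub>M subprob_algebra paths"
    using t by (intro measurable_prob_algebraD
        measurable_distr_prob_space2[OF path_law_measurable[OF t(3)]] fun_upd_paths_measurable) auto
  then have "(\<integral>\<^sup>+w. F w \<partial>path_law (t # ts) s x) =
    (\<integral>\<^sup>+y. (\<integral>\<^sup>+w. F w \<partial>distr (path_law ts t y) paths (\<lambda>w. fun_upd w t y)) \<partial>\<kappa> (t - s) x)"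
    unfolding path_law.simps using t
    by (intro nn_integral_bind[OF F]) (simp add: measurable_cong_sets[OF sets_kernel refl])
  also have "\<dots> = (\<integral>\<^sup>+y. (\<integral>\<^sup>+w. F (fun_upd w t y) \<partial>path_law ts t y) \<partial>\<kappa> (t - s) x)"
    using F upd by (intro nn_integral_cong nn_integral_distr)
      (auto simp: measurable_cong_sets[OF sets_path_law[OF t(3)] refl])
  finally show ?thesis .
qed

lemma iterated_integral_measurable:
  assumes "increasing_times s ts" "\<And>t. g t \<in> borel_measurable borel"
  shows "iterated_integral g ts s \<in> borel_measurable borel"
  using assms(1)
proof (induction ts arbitrary: s)
  case (Cons t ts)
  then show ?case using assms(2)
    by (auto simp: increasing_times_Cons
        intro!: nn_integral_kernel_measurable borel_measurable_times_ennreal)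
qed simp

lemma nn_integral_path_law:
  assumes "increasing_times s ts" "\<And>t. g t \<in> borel_measurable borel"
  shows "(\<integral>\<^sup>+w. (\<Prod>t\<in>set ts. g t (w t)) \<partial>path_law ts s x) = iterated_integral g ts s x"
  using assms(1)
proof (induction ts arbitrary: s x)
  case Nil
  then show ?case using prob_space.emeasure_space_1[OF prob_space_path_law[OF Nil]] by simp
next
  case (Cons t ts)
  then have t: "0 \<le> s" "s \<le> t" "increasing_times t ts" "t \<notin> set ts"
    by (auto simp: increasing_times_Cons)
  have meas: "(\<lambda>w. g r (w r)) \<in> borel_measurable paths" if "r \<in> set (t # ts)" for r
    using t that by (intro coordinate_compose_measurable assms(2)) (auto simp: increasing_times_def)
  have "(\<integral>\<^sup>+w. (\<Prod>r\<in>set (t # ts). g r (w r)) \<partial>path_law (t # ts) s x) =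
    (\<integral>\<^sup>+y. (\<integral>\<^sup>+w. (\<Prod>r\<in>set (t # ts). g r ((fun_upd w t y) r)) \<partial>path_law ts t y) \<partial>\<kappa> (t - s) x)"
    using meas by (intro nn_integral_path_law_Cons Cons.prems borel_measurable_prod_ennreal)
  also have "\<dots> = (\<integral>\<^sup>+y. g t y * iterated_integral g ts t y \<partial>\<kappa> (t - s) x)"
  proof (intro nn_integral_cong)
    fix y
    have "(\<Prod>r\<in>set ts. g r ((fun_upd w t y) r)) = (\<Prod>r\<in>set ts. g r (w r))" for w
      using t(4) by (intro prod.cong) auto
    then have "(\<integral>\<^sup>+w. (\<Prod>r\<in>set (t # ts). g r ((fun_upd w t y) r)) \<partial>path_law ts t y) =
      (\<integral>\<^sup>+w. g t y * (\<Prod>r\<in>set ts. g r (w r)) \<partial>path_law ts t y)" using t(4) by simp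
    also have "\<dots> = g t y * (\<integral>\<^sup>+w. (\<Prod>r\<in>set ts. g r (w r)) \<partial>path_law ts t y)"
      using meas by (intro nn_integral_cmult borel_measurable_prod_ennreal)
        (auto simp: measurable_cong_sets[OF sets_path_law[OF t(3)] refl])
    finally show "(\<integral>\<^sup>+w. (\<Prod>r\<in>set (t # ts). g r ((fun_upd w t y) r)) \<partial>path_law ts t y) =
      g t y * iterated_integral g ts t y"
      using Cons.IH[OF t(3)] by simp
  qed
  finally show ?case by simp
qed

lemma nn_integral_iterated_integral:
  assumes t: "0 \<le> s" "s \<le> t" "increasing_times t ts" and g: "\<And>t. g t \<in> borel_measurable borel"
  shows "(\<integral>\<^sup>+y. iterated_integral g ts t y \<partial>\<kappa> (t - s) x) = iterated_integral g ts s x"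
proof (cases ts)
  case Nil
  then show ?thesis using prob_space.emeasure_space_1[OF prob_space_kernel, of "t - s" x] t by simp
next
  case (Cons r rs)
  then have r: "t \<le> r" "increasing_times r rs" using t(3) by (auto simp: increasing_times_Cons)
  have "(\<lambda>z. g r z * iterated_integral g rs r z) \<in> borel_measurable borel"
    by (intro borel_measurable_times_ennreal g iterated_integral_measurable r)
  from nn_integral_kernel_kernel[OF _ _ this, of "t - s" "r - t" x] show ?thesis
    using t r by (simp add: Cons)
qed

lemma iterated_integral_filter:
  assumes "increasing_times s ts" and g: "\<And>t. g t \<in> borel_measurable borel"
    and "\<And>t. t \<in> set ts \<Longrightarrow> t \<notin> J \<Longrightarrow> g t = (\<lambda>_. 1)"
  shows "iterated_integral g ts s x = iterated_integral g (filter (\<lambda>t. t \<in> J) ts) s x"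
  using assms(1,3)
proof (induction ts arbitrary: s x)
  case (Cons t ts)
  then have t: "0 \<le> s" "s \<le> t" "increasing_times t ts" by (auto simp: increasing_times_Cons)
  have IH: "iterated_integral g ts t y = iterated_integral g (filter (\<lambda>t. t \<in> J) ts) t y" for y
    using Cons.IH[OF t(3)] Cons.prems(2) by auto
  show ?case
  proof (cases "t \<in> J")
    case False
    then have "g t = (\<lambda>_. 1)" using Cons.prems(2) by auto
    then show ?thesis
      using False nn_integral_iterated_integral[OF t(1,2) increasing_times_filter[OF t(3)] g]
      by (simp add: IH)
  qed (simp add: IH)
qed simp

definition fdd :: "'a measure \<Rightarrow> real set \<Rightarrow> (real \<Rightarrow> 'a) measure" where
  "fdd \<nu> J = distr (\<nu> \<bind> path_law (sorted_list_of_set J) 0) (borel_PiM J) (\<lambda>w. restrict w J)"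

lemma sets_fdd: "sets (fdd \<nu> J) = sets (borel_PiM J)"
  by (simp add: fdd_def)

lemma space_fdd: "space (fdd \<nu> J) = (\<Pi>\<^sub>E t\<in>J. UNIV)"
  by (simp add: fdd_def space_PiM)

context
  fixes \<nu> :: "'a measure" assumes \<nu>: "\<nu> \<in> space (prob_algebra borel)"
begin

lemma
  assumes J: "finite J" "J \<subseteq> {0..}"
  shows prob_space_bind_path_law: "prob_space (\<nu> \<bind> path_law (sorted_list_of_set J) 0)"
    and restrict_measurable_bind_path_law:
      "(\<lambda>w. restrict w J) \<in> (\<nu> \<bind> path_law (sorted_list_of_set J) 0) \<rightarrow>\<^sub>M borel_PiM J"
proof -
  note path_law = path_law_measurable[OF increasing_times_sorted_list_of_set[OF J]]
  show "prob_space (\<nu> \<bind> path_law (sorted_list_of_set J) 0)"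
    by (rule prob_space_bind'[OF \<nu> path_law])
  show "(\<lambda>w. restrict w J) \<in> (\<nu> \<bind> path_law (sorted_list_of_set J) 0) \<rightarrow>\<^sub>M borel_PiM J"
    using measurable_restrict_subset[OF J(2), of "\<lambda>_. borel"]
    by (simp add: measurable_cong_sets[OF sets_bind'[OF \<nu> path_law] refl])
qed

lemma prob_space_fdd: "finite J \<Longrightarrow> J \<subseteq> {0..} \<Longrightarrow> prob_space (fdd \<nu> J)"
  unfolding fdd_def
  by (intro prob_space.prob_space_distr prob_space_bind_path_law restrict_measurable_bind_path_law)

lemma nn_integral_fdd:
  assumes J: "finite J" "J \<subseteq> {0..}" and g: "\<And>t. g t \<in> borel_measurable borel"
  shows "(\<integral>\<^sup>+w. (\<Prod>t\<in>J. g t (w t)) \<partial>fdd \<nu> J) =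
      (\<integral>\<^sup>+x. iterated_integral g (sorted_list_of_set J) 0 x \<partial>\<nu>)"
proof -
  note times = increasing_times_sorted_list_of_set[OF J]
  have measurable_J: "(\<lambda>w. \<Prod>t\<in>J. g t (w t)) \<in> borel_measurable (borel_PiM J)"
    by (intro borel_measurable_prod_ennreal coordinate_compose_measurable g)
  have measurable_paths: "(\<lambda>w. \<Prod>t\<in>J. g t (w t)) \<in> borel_measurable paths"
    using J by (intro borel_measurable_prod_ennreal coordinate_compose_measurable g) auto
  have "(\<integral>\<^sup>+w. (\<Prod>t\<in>J. g t (w t)) \<partial>fdd \<nu> J) =
      (\<integral>\<^sup>+w. (\<Prod>t\<in>J. g t (restrict w J t)) \<partial>(\<nu> \<bind> path_law (sorted_list_of_set J) 0))"
    unfolding fdd_def using measurable_J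
    by (intro nn_integral_distr restrict_measurable_bind_path_law J) simp
  also have "\<dots> = (\<integral>\<^sup>+w. (\<Prod>t\<in>J. g t (w t)) \<partial>(\<nu> \<bind> path_law (sorted_list_of_set J) 0))"
    by (intro nn_integral_cong prod.cong) auto
  also have "\<dots> = (\<integral>\<^sup>+x. (\<integral>\<^sup>+w. (\<Prod>t\<in>J. g t (w t)) \<partial>path_law (sorted_list_of_set J) 0 x) \<partial>\<nu>)"
    using measurable_prob_algebraD[OF path_law_measurable[OF times]] \<nu>
    by (intro nn_integral_bind[OF measurable_paths])
      (simp add: space_prob_algebra measurable_cong_sets[of \<nu> borel])
  also have "\<dots> = (\<integral>\<^sup>+x. iterated_integral g (sorted_list_of_set J) 0 x \<partial>\<nu>)"
    using nn_integral_path_law[OF times g] J(1) by simp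
  finally show ?thesis .
qed

lemma emeasure_fdd:
  assumes J: "finite J" "J \<subseteq> {0..}" and A: "\<And>t. A t \<in> sets borel"
  shows "emeasure (fdd \<nu> J) (\<Pi>\<^sub>E t\<in>J. A t) =
      (\<integral>\<^sup>+x. iterated_integral (\<lambda>t. indicator (A t)) (sorted_list_of_set J) 0 x \<partial>\<nu>)"
proof -
  have "emeasure (fdd \<nu> J) (\<Pi>\<^sub>E t\<in>J. A t) = (\<integral>\<^sup>+w. indicator (\<Pi>\<^sub>E t\<in>J. A t) w \<partial>fdd \<nu> J)"
    using J A by (simp add: sets_fdd)
  also have "\<dots> = (\<integral>\<^sup>+w. (\<Prod>t\<in>J. indicator (A t) (w t)) \<partial>fdd \<nu> J)"
    using J(1) by (intro nn_integral_cong prod_indicator_eq_indicator_PiE[symmetric])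
      (auto simp: space_fdd PiE_iff)
  also have "\<dots> = (\<integral>\<^sup>+x. iterated_integral (\<lambda>t. indicator (A t)) (sorted_list_of_set J) 0 x \<partial>\<nu>)"
    using A by (intro nn_integral_fdd J) auto
  finally show ?thesis .
qed

lemma emeasure_fdd_preimage_restrict:
  assumes "J \<subseteq> H" and H: "finite H" "H \<subseteq> {0..}" and A: "\<And>t. t \<in> J \<Longrightarrow> A t \<in> sets borel"
  shows "emeasure (fdd \<nu> H) ((\<lambda>w. restrict w J) -` (\<Pi>\<^sub>E t\<in>J. A t) \<inter> space (fdd \<nu> H)) =
      emeasure (fdd \<nu> J) (\<Pi>\<^sub>E t\<in>J. A t)"
proof -
  have J: "finite J" "J \<subseteq> {0..}" using assms finite_subset by auto
  define B where "B t = (if t \<in> J then A t else UNIV)" for t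
  have B: "B t \<in> sets borel" for t using A by (simp add: B_def)
  have "(\<lambda>w. restrict w J) -` (\<Pi>\<^sub>E t\<in>J. A t) \<inter> space (fdd \<nu> H) = (\<Pi>\<^sub>E t\<in>H. B t)"
    using subsetD[OF assms(1)] by (auto simp: space_fdd B_def PiE_iff split: if_splits)
  then have "emeasure (fdd \<nu> H) ((\<lambda>w. restrict w J) -` (\<Pi>\<^sub>E t\<in>J. A t) \<inter> space (fdd \<nu> H)) =
      (\<integral>\<^sup>+x. iterated_integral (\<lambda>t. indicator (B t)) (sorted_list_of_set H) 0 x \<partial>\<nu>)"
    using emeasure_fdd[OF H B] by simp
  also have "\<dots> = (\<integral>\<^sup>+x. iterated_integral (\<lambda>t. indicator (B t)) (sorted_list_of_set J) 0 x \<partial>\<nu>)"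
    using B iterated_integral_filter[OF increasing_times_sorted_list_of_set[OF H],
        of "\<lambda>t. indicator (B t)" J]
      filter_sorted_list_of_set[OF H(1) assms(1)] by (simp add: B_def indicator_def)
  also have "\<dots> = emeasure (fdd \<nu> J) (\<Pi>\<^sub>E t\<in>J. B t)"
    by (rule emeasure_fdd[OF J B, symmetric])
  also have "(\<Pi>\<^sub>E t\<in>J. B t) = (\<Pi>\<^sub>E t\<in>J. A t)" by (auto simp: B_def cong: PiE_cong)
  finally show ?thesis .
qed

lemma projective_family_fdd: "projective_family {0..} (fdd \<nu>) (\<lambda>_. borel)"
proof (rule projective_family.intro)
  show "prob_space (fdd \<nu> J)" if "finite J" "J \<subseteq> {0..}" for J
    using that by (rule prob_space_fdd)
  fix J H :: "real set" assume "J \<subseteq> H" and H: "finite H" "H \<subseteq> {0..}"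
  then have J: "finite J" "J \<subseteq> {0..}" using finite_subset by auto
  interpret prob_space "fdd \<nu> J" by (rule prob_space_fdd[OF J])
  show "fdd \<nu> J = distr (fdd \<nu> H) (borel_PiM J) (\<lambda>w. restrict w J)"
  proof (rule measure_eqI_PiM_finite[where A = "\<lambda>_. space (borel_PiM J)"])
    show "range (\<lambda>_. space (borel_PiM J)) \<subseteq> prod_algebra J (\<lambda>_. borel)"
      using J by (auto simp: space_PiM intro!: prod_algebraI_finite)
    show "emeasure (fdd \<nu> J) (Pi\<^sub>E J A) =
        emeasure (distr (fdd \<nu> H) (borel_PiM J) (\<lambda>w. restrict w J)) (Pi\<^sub>E J A)"
      if A: "\<And>i. i \<in> J \<Longrightarrow> A i \<in> sets borel" for A
      using A J measurable_restrict_subset[OF \<open>J \<subseteq> H\<close>, of "\<lambda>_. borel"]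
        emeasure_fdd_preimage_restrict[OF \<open>J \<subseteq> H\<close> H, of A]
      by (subst emeasure_distr) (auto simp: measurable_cong_sets[OF sets_fdd refl])
  qed (auto simp: sets_fdd J(1))
qed

lemma distr_fdd_single:
  assumes t: "0 \<le> t" shows "distr (fdd \<nu> {t}) borel (\<lambda>w. w t) = \<nu> \<bind> \<kappa> t"
proof (rule measure_eqI)
  show "sets (distr (fdd \<nu> {t}) borel (\<lambda>w. w t)) = sets (\<nu> \<bind> \<kappa> t)"
    using sets_bind'[OF \<nu> kernel_measurable[OF t]] by simp
  fix A assume "A \<in> sets (distr (fdd \<nu> {t}) borel (\<lambda>w. w t))"
  then have A: "A \<in> sets borel" by simp
  have "(\<lambda>w. w t) -` A \<inter> space (fdd \<nu> {t}) = (\<Pi>\<^sub>E r\<in>{t}. A)"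
    by (auto simp: space_fdd PiE_iff extensional_def)
  then have "emeasure (distr (fdd \<nu> {t}) borel (\<lambda>w. w t)) A = emeasure (fdd \<nu> {t}) (\<Pi>\<^sub>E r\<in>{t}. A)"
    using A coordinate_compose_measurable[of t "{t}" "\<lambda>x. x" borel]
    by (subst emeasure_distr) (auto simp: measurable_cong_sets[OF sets_fdd refl])
  also have "\<dots> = (\<integral>\<^sup>+x. emeasure (\<kappa> t x) A \<partial>\<nu>)"
    using emeasure_fdd[of "{t}" "\<lambda>_. A"] t A
    by (simp add: sorted_list_of_set_insert_remove sets_kernel)
  also have "\<dots> = emeasure (\<nu> \<bind> \<kappa> t) A"
    by (rule emeasure_bind_prob_algebra[OF \<nu> kernel_measurable[OF t] A, symmetric])
  finally show "emeasure (distr (fdd \<nu> {t}) borel (\<lambda>w. w t)) A = emeasure (\<nu> \<bind> \<kappa> t) A" .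
qed

end

end

locale markov_process = transition_function \<kappa> + prob_space M
  for \<kappa> :: "real \<Rightarrow> 'a::topological_space \<Rightarrow> 'a measure" and M :: "(real \<Rightarrow> 'a) measure" +
  fixes \<nu> :: "'a measure"
  assumes sets_M: "sets M = sets paths"
    and initial: "\<nu> \<in> space (prob_algebra borel)"
    and finite_dimensional: "finite J \<Longrightarrow> J \<subseteq> {0..} \<Longrightarrow>
        distr M (borel_PiM J) (\<lambda>w. restrict w J) = fdd \<nu> J"

lemma (in transition_function) markov_process_exists:
  assumes Hausdorff: "Hausdorff_space (euclidean :: 'a topology)"
    and \<nu>: "\<nu> \<in> space (prob_algebra borel)"
    and regular: "\<And>t A. t \<ge> 0 \<Longrightarrow> A \<in> sets borel \<Longrightarrow> inner_regular_wrt (\<nu> \<bind> \<kappa> t) (Collect compact) A"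
  shows "\<exists>M. markov_process \<kappa> M \<nu>"
proof -
  interpret projective_family "{0..}" "fdd \<nu>" "\<lambda>_. borel" by (rule projective_family_fdd[OF \<nu>])
  interpret regular_projective_family "{0..}" "fdd \<nu>"
    using Hausdorff regular by unfold_locales (auto simp: distr_fdd_single[OF \<nu>])
  have "markov_process \<kappa> lim \<nu>"
    using transition_function_axioms prob_space_lim \<nu> distr_lim
    by (simp add: markov_process_def markov_process_axioms_def)
  then show ?thesis by blast
qed

section \<open>The Markov property for the natural filtration\<close>

context transition_function
begin

lemma iterated_integral_snoc:
  assumes "increasing_times r (ts @ [s, t])"
  shows "iterated_integral (g(t := f)) (ts @ [s, t]) r x =
    iterated_integral (g(s := \<lambda>y. g s y * (\<integral>\<^sup>+z. f z \<partial>\<kappa> (t - s) y))) (ts @ [s]) r x"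
  using assms
proof (induction ts arbitrary: r x)
  case Nil
  then show ?case by (auto simp: increasing_times_Cons)
next
  case (Cons a ts)
  then have "increasing_times a (ts @ [s, t])" "a \<noteq> s" "a \<noteq> t" by (auto simp: increasing_times_Cons)
  then show ?case using Cons.IH by simp
qed

end

context markov_process
begin

lemma coordinate_measurable:
  assumes "0 \<le> t" "g \<in> borel \<rightarrow>\<^sub>M N" shows "(\<lambda>w. g (w t)) \<in> M \<rightarrow>\<^sub>M N"
  unfolding measurable_cong_sets[OF sets_M refl]
  by (rule coordinate_compose_measurable[OF _ assms(2)]) (use assms(1) in simp)

lemma restrict_measurable: "J \<subseteq> {0..} \<Longrightarrow> (\<lambda>w. restrict w J) \<in> M \<rightarrow>\<^sub>M borel_PiM J"
  unfolding measurable_cong_sets[OF sets_M refl] by (rule measurable_restrict_subset)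

lemma nn_integral_prod:
  assumes J: "finite J" "J \<subseteq> {0..}" and g: "\<And>t. g t \<in> borel_measurable borel"
  shows "(\<integral>\<^sup>+w. (\<Prod>t\<in>J. g t (w t)) \<partial>M) = (\<integral>\<^sup>+x. iterated_integral g (sorted_list_of_set J) 0 x \<partial>\<nu>)"
proof -
  have "(\<integral>\<^sup>+w. (\<Prod>t\<in>J. g t (w t)) \<partial>M) = (\<integral>\<^sup>+w. (\<Prod>t\<in>J. g t (restrict w J t)) \<partial>M)"
    by (intro nn_integral_cong prod.cong) auto
  also have "\<dots> = (\<integral>\<^sup>+w. (\<Prod>t\<in>J. g t (w t)) \<partial>distr M (borel_PiM J) (\<lambda>w. restrict w J))"
    using g by (intro nn_integral_distr[symmetric] restrict_measurable J)
      (auto intro!: borel_measurable_prod_ennreal coordinate_compose_measurable)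
  also have "\<dots> = (\<integral>\<^sup>+x. iterated_integral g (sorted_list_of_set J) 0 x \<partial>\<nu>)"
    unfolding finite_dimensional[OF J] by (rule nn_integral_fdd[OF initial J g])
  finally show ?thesis .
qed

lemma distr_coordinate:
  assumes t: "0 \<le> t" shows "distr M borel (\<lambda>w. w t) = \<nu> \<bind> \<kappa> t"
proof -
  have "distr M borel (\<lambda>w. w t) = distr M borel ((\<lambda>w. w t) \<circ> (\<lambda>w. restrict w {t}))"
    by (simp add: comp_def)
  also have "\<dots> = distr (distr M (borel_PiM {t}) (\<lambda>w. restrict w {t})) borel (\<lambda>w. w t)"
    using t by (intro distr_distr[symmetric] restrict_measurable coordinate_compose_measurable) auto
  also have "\<dots> = \<nu> \<bind> \<kappa> t"
    using t finite_dimensional[of "{t}"] by (simp add: distr_fdd_single[OF initial])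
  finally show ?thesis .
qed

lemma distr_initial: "distr M borel (\<lambda>w. w 0) = \<nu>"
proof -
  have "\<kappa> 0 = return borel" using kernel_0 by (intro ext)
  then show ?thesis
    using distr_coordinate[of 0] bind_return''[of \<nu> borel] initial by (simp add: space_prob_algebra)
qed

lemma nn_markov_prod_at:
  assumes s: "s < t" "s \<in> J" and J: "finite J" "J \<subseteq> {0..s}"
    and g: "\<And>r. g r \<in> borel_measurable borel" and f: "f \<in> borel_measurable borel"
  shows "(\<integral>\<^sup>+w. f (w t) * (\<Prod>r\<in>J. g r (w r)) \<partial>M) =
    (\<integral>\<^sup>+w. (\<integral>\<^sup>+z. f z \<partial>\<kappa> (t - s) (w s)) * (\<Prod>r\<in>J. g r (w r)) \<partial>M)"
proof -
  define Kf where "Kf y = (\<integral>\<^sup>+z. f z \<partial>\<kappa> (t - s) y)" for y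
  have Kf: "Kf \<in> borel_measurable borel"
    unfolding Kf_def using s f by (intro nn_integral_kernel_measurable) auto
  have tJ: "t \<notin> J" "insert t J \<subseteq> {0..}" "J \<subseteq> {0..}" using s J(2) by auto
  define us where "us = sorted_list_of_set (J - {s})"
  have sorted_J: "sorted_list_of_set J = us @ [s]"
    unfolding us_def using J s(2) by (intro sorted_list_of_set_greatest) auto
  then have sorted_tJ: "sorted_list_of_set (insert t J) = us @ [s, t]"
    using sorted_list_of_set_greatest[of "insert t J" t] J tJ(1) s(1)
    by (force simp del: sorted_list_of_set_insert_remove)
  have "(\<integral>\<^sup>+w. f (w t) * (\<Prod>r\<in>J. g r (w r)) \<partial>M) = (\<integral>\<^sup>+w. (\<Prod>r\<in>insert t J. (g(t := f)) r (w r)) \<partial>M)"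
  proof (intro nn_integral_cong)
    fix w :: "real \<Rightarrow> 'a"
    have "(\<Prod>r\<in>J. (g(t := f)) r (w r)) = (\<Prod>r\<in>J. g r (w r))" using tJ(1) by (intro prod.cong) auto
    then show "f (w t) * (\<Prod>r\<in>J. g r (w r)) = (\<Prod>r\<in>insert t J. (g(t := f)) r (w r))"
      using tJ(1) J(1) by simp
  qed
  also have "\<dots> = (\<integral>\<^sup>+x. iterated_integral (g(t := f)) (sorted_list_of_set (insert t J)) 0 x \<partial>\<nu>)"
    using J(1) tJ g f by (intro nn_integral_prod) auto
  also have "\<dots> = (\<integral>\<^sup>+x. iterated_integral (g(s := \<lambda>y. g s y * Kf y)) (sorted_list_of_set J) 0 x \<partial>\<nu>)"
    using increasing_times_sorted_list_of_set[OF _ tJ(2)] J(1)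
    by (simp add: sorted_J sorted_tJ iterated_integral_snoc Kf_def
        del: sorted_list_of_set_insert_remove)
  also have "\<dots> = (\<integral>\<^sup>+w. (\<Prod>r\<in>J. (g(s := \<lambda>y. g s y * Kf y)) r (w r)) \<partial>M)"
    using g Kf by (intro nn_integral_prod[symmetric] J tJ) auto
  also have "\<dots> = (\<integral>\<^sup>+w. Kf (w s) * (\<Prod>r\<in>J. g r (w r)) \<partial>M)"
  proof (intro nn_integral_cong)
    fix w :: "real \<Rightarrow> 'a"
    have "(\<Prod>r\<in>J - {s}. (g(s := \<lambda>y. g s y * Kf y)) r (w r)) = (\<Prod>r\<in>J - {s}. g r (w r))"
      by (intro prod.cong) auto
    then show "(\<Prod>r\<in>J. (g(s := \<lambda>y. g s y * Kf y)) r (w r)) = Kf (w s) * (\<Prod>r\<in>J. g r (w r))"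
      using J(1) s(2) by (simp add: prod.remove[of J s] mult_ac)
  qed
  finally show ?thesis by (simp add: Kf_def)
qed

lemma nn_markov_prod:
  assumes s: "0 \<le> s" "s \<le> t" and J: "finite J" "J \<subseteq> {0..s}"
    and g: "\<And>r. g r \<in> borel_measurable borel" and f: "f \<in> borel_measurable borel"
  shows "(\<integral>\<^sup>+w. f (w t) * (\<Prod>r\<in>J. g r (w r)) \<partial>M) =
    (\<integral>\<^sup>+w. (\<integral>\<^sup>+z. f z \<partial>\<kappa> (t - s) (w s)) * (\<Prod>r\<in>J. g r (w r)) \<partial>M)"
proof (cases "s = t")
  case True
  then show ?thesis using f by (simp add: kernel_0 nn_integral_return)
next
  case False
  define h where "h = (if s \<in> J then g else g(s := \<lambda>_. 1))"
  have "h r \<in> borel_measurable borel" for r using g by (simp add: h_def)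
  moreover have "(\<Prod>r\<in>insert s J. h r (w r)) = (\<Prod>r\<in>J. g r (w r))" for w
  proof (cases "s \<in> J")
    case False
    then have "(\<Prod>r\<in>J. h r (w r)) = (\<Prod>r\<in>J. g r (w r))" by (intro prod.cong) (auto simp: h_def)
    then show ?thesis using False J(1) by (simp add: h_def)
  qed (simp add: h_def insert_absorb)
  ultimately show ?thesis
    using nn_markov_prod_at[of s t "insert s J" h f] s False J f by auto
qed

definition natural_filtration :: "real \<Rightarrow> (real \<Rightarrow> 'a) measure" where
  "natural_filtration s = vimage_algebra (space M) (\<lambda>w. restrict w {0..s}) (borel_PiM {0..s})"

lemma space_natural[simp]: "space (natural_filtration s) = space M"
  by (simp add: natural_filtration_def)

lemma restrict_measurable_natural:
  assumes "r \<le> s" shows "(\<lambda>w. restrict w {0..r}) \<in> natural_filtration s \<rightarrow>\<^sub>M borel_PiM {0..r}"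
proof -
  have "(\<lambda>w. restrict w {0..s}) \<in> natural_filtration s \<rightarrow>\<^sub>M borel_PiM {0..s}"
    unfolding natural_filtration_def by (rule measurable_vimage_algebra1) (auto simp: space_PiM)
  from measurable_compose[OF this measurable_restrict_subset[of "{0..r}" "{0..s}" "\<lambda>_. borel"]]
  show ?thesis using assms by (simp add: restrict_restrict Int_absorb1)
qed

lemma natural_mono: "s \<le> t \<Longrightarrow> sets (natural_filtration s) \<subseteq> sets (natural_filtration t)"
  unfolding natural_filtration_def[of s]
  by (intro sets_image_in_sets restrict_measurable_natural) simp_all

lemma subalgebra_natural: "subalgebra M (natural_filtration s)"
  unfolding subalgebra_def natural_filtration_def
  using sets_image_in_sets[OF refl restrict_measurable[of "{0..s}"]] by auto

lemma coordinate_measurable_natural: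
  assumes "0 \<le> r" "r \<le> s" "g \<in> borel \<rightarrow>\<^sub>M N" shows "(\<lambda>w. g (w r)) \<in> natural_filtration s \<rightarrow>\<^sub>M N"
proof -
  have "(\<lambda>w. g (w r)) \<in> borel_PiM {0..s} \<rightarrow>\<^sub>M N"
    using assms by (intro coordinate_compose_measurable) auto
  from measurable_compose[OF restrict_measurable_natural[OF order_refl] this]
  show ?thesis using assms by simp
qed

lemma nn_integral_eq_on_natural_if_eq_on_cylinders:
  assumes X: "X \<in> borel_measurable M" and Y: "Y \<in> borel_measurable M" and fin: "(\<integral>\<^sup>+w. X w \<partial>M) < \<infinity>"
    and eq: "\<And>J B. finite J \<Longrightarrow> J \<subseteq> {0..s} \<Longrightarrow> (\<And>r. B r \<in> sets borel) \<Longrightarrow>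
      (\<integral>\<^sup>+w. X w * (\<Prod>r\<in>J. indicator (B r) (w r)) \<partial>M) =
          (\<integral>\<^sup>+w. Y w * (\<Prod>r\<in>J. indicator (B r) (w r)) \<partial>M)"
    and A: "A \<in> sets (natural_filtration s)"
  shows "(\<integral>\<^sup>+w. X w * indicator A w \<partial>M) = (\<integral>\<^sup>+w. Y w * indicator A w \<partial>M)"
proof -
  define R where "R w = restrict w {0..s}" for w :: "real \<Rightarrow> 'a"
  have R: "R \<in> M \<rightarrow>\<^sub>M borel_PiM {0..s}" unfolding R_def by (rule restrict_measurable) auto
  have emeasure: "emeasure (distr (density M Z) (borel_PiM {0..s}) R) B =
      (\<integral>\<^sup>+w. Z w * indicator (R -` B \<inter> space M) w \<partial>M)"
    if "Z \<in> borel_measurable M" "B \<in> sets (borel_PiM {0..s})" for Z B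
    using R that by (subst emeasure_distr) (auto intro!: emeasure_density)
  have "distr (density M X) (borel_PiM {0..s}) R = distr (density M Y) (borel_PiM {0..s}) R"
  proof (rule measure_eqI_PiM_infinite)
    have "emeasure (density M X) (space M) < \<infinity>" using fin X by (simp add: emeasure_density)
    then show "finite_measure (distr (density M X) (borel_PiM {0..s}) R)"
      using R by (intro finite_measure.finite_measure_distr finite_measureI) auto
    fix B J assume J: "finite J" "J \<subseteq> {0..s}" and B: "\<And>r. r \<in> J \<Longrightarrow> B r \<in> sets (borel :: 'a measure)"
    define C where "C = prod_emb {0..s} (\<lambda>_. borel :: 'a measure) J (Pi\<^sub>E J B)"
    have C: "C \<in> sets (borel_PiM {0..s})" unfolding C_def using J B by (intro sets_PiM_I) auto
    define B' where "B' r = (if r \<in> J then B r else UNIV)" for r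
    have "indicator (R -` C \<inter> space M) w = (\<Prod>r\<in>J. indicator (B' r) (w r) :: ennreal)"
      if "w \<in> space M" for w
    proof -
      have "w \<in> R -` C \<longleftrightarrow> (\<forall>r\<in>J. w r \<in> B' r)" using J
        by (auto simp: C_def R_def prod_emb_def B'_def PiE_iff space_PiM restrict_restrict
            Int_absorb1)
      then show ?thesis using that J(1) by (auto simp: indicator_def prod_zero_iff)
    qed
    then show "emeasure (distr (density M X) (borel_PiM {0..s}) R) C =
        emeasure (distr (density M Y) (borel_PiM {0..s}) R) C"
      using eq[OF J, of B'] B by (simp add: emeasure X Y C B'_def cong: nn_integral_cong)
  qed simp_all
  moreover obtain B where "B \<in> sets (borel_PiM {0..s})" "A = R -` B \<inter> space M"
    using A sets_vimage_algebra2[of R "space M" "borel_PiM {0..s}"]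
    by (auto simp: natural_filtration_def R_def[abs_def] space_PiM)
  ultimately show ?thesis using emeasure[OF X] emeasure[OF Y] by simp
qed

lemma nn_markov_natural:
  assumes s: "0 \<le> s" "s \<le> t" and f: "f \<in> borel_measurable borel"
    and fin: "(\<integral>\<^sup>+w. f (w t) \<partial>M) < \<infinity>" and A: "A \<in> sets (natural_filtration s)"
  shows "(\<integral>\<^sup>+w. f (w t) * indicator A w \<partial>M) =
    (\<integral>\<^sup>+w. (\<integral>\<^sup>+z. f z \<partial>\<kappa> (t - s) (w s)) * indicator A w \<partial>M)"
proof (rule nn_integral_eq_on_natural_if_eq_on_cylinders[OF _ _ fin _ A])
  show "(\<lambda>w. f (w t)) \<in> borel_measurable M" using f s by (intro coordinate_measurable) auto
  show "(\<lambda>w. \<integral>\<^sup>+z. f z \<partial>\<kappa> (t - s) (w s)) \<in> borel_measurable M"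
    using f s by (intro coordinate_measurable nn_integral_kernel_measurable) auto
qed (intro nn_markov_prod s f; simp)

lemma sigma_finite_subalgebra_natural: "sigma_finite_subalgebra M (natural_filtration s)"
proof -
  interpret finite_measure_subalgebra M "natural_filtration s"
    using subalgebra_natural by unfold_locales
  show ?thesis by (rule sigma_finite_subalgebra_axioms)
qed

lemma nn_cond_exp_natural:
  assumes s: "0 \<le> s" "s \<le> t" and f: "f \<in> borel_measurable borel" and fin: "(\<integral>\<^sup>+w. f (w t) \<partial>M) < \<infinity>"
  shows "AE w in M. (\<integral>\<^sup>+z. f z \<partial>\<kappa> (t - s) (w s)) =
      nn_cond_exp M (natural_filtration s) (\<lambda>w. f (w t)) w"
proof (rule sigma_finite_subalgebra.nn_cond_exp_charact[OF sigma_finite_subalgebra_natural])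
  show "(\<lambda>w. f (w t)) \<in> borel_measurable M" using s f by (intro coordinate_measurable) auto
  show "(\<lambda>w. \<integral>\<^sup>+z. f z \<partial>\<kappa> (t - s) (w s)) \<in> borel_measurable (natural_filtration s)"
    using s f by (intro coordinate_measurable_natural nn_integral_kernel_measurable) auto
qed (rule nn_markov_natural[OF s f fin])

end

section \<open>The right-continuous completion of a filtration\<close>

lemma (in finite_measure) integrable_completion_mult_indicator:
  fixes X :: "'a \<Rightarrow> real"
  assumes "integrable M X" "A \<in> sets (completion M)"
  shows "integrable (completion M) (\<lambda>w. X w * indicator A w)"
proof -
  have "integrable (completion M) X"
    using assms(1) by (simp add: integrable_completion[OF borel_measurable_integrable])
  from integrable_mult_indicator[OF assms(2) this] show ?thesis by (simp add: mult.commute)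
qed

lemma (in finite_measure) integral_indicator_diff_le:
  fixes X Y :: "'a \<Rightarrow> real"
  assumes X: "integrable M X" and Y: "integrable M Y" and A: "A \<in> sets (completion M)"
  shows "\<bar>(\<integral>w. X w * indicator A w \<partial>completion M) - (\<integral>w. Y w * indicator A w \<partial>completion M)\<bar>
    \<le> (\<integral>w. \<bar>X w - Y w\<bar> \<partial>M)"
proof -
  have int: "integrable M (\<lambda>w. \<bar>X w - Y w\<bar>)" using X Y by simp
  have "(\<integral>w. X w * indicator A w \<partial>completion M) - (\<integral>w. Y w * indicator A w \<partial>completion M) =
    (\<integral>w. (X w - Y w) * indicator A w \<partial>completion M)"
    using integrable_completion_mult_indicator[OF X A] integrable_completion_mult_indicator[OF Y A]
    by (simp add: left_diff_distrib)
  also have "\<bar>\<dots>\<bar> \<le> (\<integral>w. \<bar>(X w - Y w) * indicator A w\<bar> \<partial>completion M)"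
    by (rule integral_abs_bound)
  also have "\<dots> \<le> (\<integral>w. \<bar>X w - Y w\<bar> \<partial>completion M)"
  proof (rule integral_mono)
    show "integrable (completion M) (\<lambda>w. \<bar>(X w - Y w) * indicator A w\<bar>)"
      by (intro integrable_abs integrable_completion_mult_indicator
          Bochner_Integration.integrable_diff X Y A)
    show "integrable (completion M) (\<lambda>w. \<bar>X w - Y w\<bar>)"
      using int by (simp add: integrable_completion[OF borel_measurable_integrable])
  qed (simp add: indicator_def)
  also have "\<dots> = (\<integral>w. \<bar>X w - Y w\<bar> \<partial>M)"
    using borel_measurable_integrable[OF int] by (rule integral_completion)
  finally show ?thesis .
qed

locale filtered_prob_space = prob_space M for M :: "'a measure" +
  fixes F :: "'t::{dense_linorder, no_top} \<Rightarrow> 'a measure"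
  assumes subalgebra: "subalgebra M (F t)"
    and mono: "s \<le> t \<Longrightarrow> sets (F s) \<subseteq> sets (F t)"
begin

lemma space_F: "space (F t) = space M" and sets_F: "sets (F t) \<subseteq> sets M"
  using subalgebra by (simp_all add: subalgebra_def)

definition completed_sets :: "'t \<Rightarrow> 'a set set" where
  "completed_sets t = {A \<in> sets (completion M). \<exists>B\<in>sets (F t). AE w in M. w \<in> A \<longleftrightarrow> w \<in> B}"

definition augmented_sets :: "'t \<Rightarrow> 'a set set" where
  "augmented_sets s = (\<Inter>u\<in>{s<..}. completed_sets u)"

definition augmented_filtration :: "'t \<Rightarrow> 'a measure" where
  "augmented_filtration s = sigma (space M) (augmented_sets s)"

lemma completed_setsI:
  "A \<in> sets (completion M) \<Longrightarrow> B \<in> sets (F t) \<Longrightarrow> AE w in M. w \<in> A \<longleftrightarrow> w \<in> B \<Longrightarrow> A \<in> completed_sets t"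
  by (auto simp: completed_sets_def)

lemma completed_setsE:
  assumes "A \<in> completed_sets t"
  obtains B where "A \<in> sets (completion M)" "B \<in> sets (F t)" "AE w in M. w \<in> A \<longleftrightarrow> w \<in> B"
  using assms by (auto simp: completed_sets_def)

lemma sigma_algebra_completed_sets: "sigma_algebra (space M) (completed_sets t)"
  unfolding sigma_algebra_iff2
proof (intro conjI ballI allI impI)
  show "completed_sets t \<subseteq> Pow (space M)"
    using sets.sets_into_space[of _ "completion M"] by (auto simp: completed_sets_def)
  show "{} \<in> completed_sets t" by (rule completed_setsI[of _ "{}"]) auto
  fix A assume "A \<in> completed_sets t"
  then obtain B where A: "A \<in> sets (completion M)" and B: "B \<in> sets (F t)"
    "AE w in M. w \<in> A \<longleftrightarrow> w \<in> B"
    by (rule completed_setsE)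
  show "space M - A \<in> completed_sets t"
  proof (rule completed_setsI)
    show "space M - A \<in> sets (completion M)" using sets.compl_sets[OF A] by simp
    show "space M - B \<in> sets (F t)" using sets.compl_sets[OF B(1)] by (simp add: space_F)
    show "AE w in M. w \<in> space M - A \<longleftrightarrow> w \<in> space M - B" using B(2) by eventually_elim auto
  qed
next
  fix A :: "nat \<Rightarrow> _" assume "range A \<subseteq> completed_sets t"
  then have "\<forall>i. \<exists>B. A i \<in> sets (completion M) \<and> B \<in> sets (F t) \<and> (AE w in M. w \<in> A i \<longleftrightarrow> w \<in> B)"
    unfolding completed_sets_def by blast
  from choice[OF this] obtain B where A: "\<And>i. A i \<in> sets (completion M)"
    and B: "\<And>i. B i \<in> sets (F t)"
    and eq: "\<And>i. AE w in M. w \<in> A i \<longleftrightarrow> w \<in> B i" by blast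
  show "(\<Union>i. A i) \<in> completed_sets t"
  proof (rule completed_setsI)
    show "(\<Union>i. A i) \<in> sets (completion M)" using A by blast
    show "(\<Union>i. B i) \<in> sets (F t)" using B by blast
    have "AE w in M. \<forall>i. w \<in> A i \<longleftrightarrow> w \<in> B i" using eq by (simp add: AE_all_countable)
    then show "AE w in M. w \<in> (\<Union>i. A i) \<longleftrightarrow> w \<in> (\<Union>i. B i)" by eventually_elim auto
  qed
qed

lemma augmented_setsI: "(\<And>u. s < u \<Longrightarrow> A \<in> completed_sets u) \<Longrightarrow> A \<in> augmented_sets s"
  by (simp add: augmented_sets_def)

lemma augmented_setsD: "A \<in> augmented_sets s \<Longrightarrow> s < u \<Longrightarrow> A \<in> completed_sets u"
  by (simp add: augmented_sets_def)

lemma augmented_sets_subset_completion: "augmented_sets s \<subseteq> sets (completion M)"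
  using gt_ex[of s] augmented_setsD[of _ s] by (auto simp: completed_sets_def)

lemma sigma_algebra_augmented_sets: "sigma_algebra (space M) (augmented_sets s)"
  unfolding sigma_algebra_iff2
proof (intro conjI ballI allI impI augmented_setsI)
  show "augmented_sets s \<subseteq> Pow (space M)"
    using augmented_sets_subset_completion[of s] sets.space_closed[of "completion M"] by simp
  fix u assume u: "s < u"
  interpret U: sigma_algebra "space M" "completed_sets u" by (rule sigma_algebra_completed_sets)
  show "{} \<in> completed_sets u" by (rule U.empty_sets)
  show "space M - A \<in> completed_sets u" if "A \<in> augmented_sets s" for A
    by (rule U.compl_sets[OF augmented_setsD[OF that u]])
  show "(\<Union>i. A i) \<in> completed_sets u" if "range A \<subseteq> augmented_sets s" for A :: "nat \<Rightarrow> _"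
    using that augmented_setsD[OF _ u] by (intro U.countable_UN) blast
qed

lemma sets_augmented: "sets (augmented_filtration s) = augmented_sets s"
  and space_augmented: "space (augmented_filtration s) = space M"
  using sigma_algebra.sets_measure_of_eq[OF sigma_algebra_augmented_sets]
    sigma_algebra.space_measure_of_eq[OF sigma_algebra_augmented_sets]
  by (simp_all add: augmented_filtration_def)

lemma subalgebra_augmented: "subalgebra (completion M) (augmented_filtration s)"
  using augmented_sets_subset_completion[of s]
  by (simp add: subalgebra_def space_augmented sets_augmented)

lemma augmented_mono: "s \<le> t \<Longrightarrow> sets (augmented_filtration s) \<subseteq> sets (augmented_filtration t)"
  unfolding sets_augmented by (auto simp: augmented_sets_def)

lemma augmented_right_continuous:
  "sets (augmented_filtration t) = (\<Inter>u\<in>{t<..}. sets (augmented_filtration u))"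
proof
  show "sets (augmented_filtration t) \<subseteq> (\<Inter>u\<in>{t<..}. sets (augmented_filtration u))"
    by (intro INT_greatest augmented_mono) simp
  show "(\<Inter>u\<in>{t<..}. sets (augmented_filtration u)) \<subseteq> sets (augmented_filtration t)"
  proof
    fix A assume A: "A \<in> (\<Inter>u\<in>{t<..}. sets (augmented_filtration u))"
    have "A \<in> completed_sets v" if v: "t < v" for v
    proof -
      obtain u where "t < u" "u < v" using dense[OF v] by blast
      then show ?thesis using A by (auto simp: sets_augmented intro: augmented_setsD[of A u])
    qed
    then show "A \<in> sets (augmented_filtration t)" unfolding sets_augmented by (rule augmented_setsI)
  qed
qed

lemma null_sets_augmented: "null_sets (completion M) \<subseteq> sets (augmented_filtration s)"
proof
  fix N assume N: "N \<in> null_sets (completion M)"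
  have "AE w in M. w \<in> N \<longleftrightarrow> w \<in> {}" using AE_not_in[OF N] by (simp add: AE_completion_iff)
  then have "N \<in> completed_sets u" for u
    using null_setsD2[OF N] by (intro completed_setsI[of N "{}"]) auto
  then show "N \<in> sets (augmented_filtration s)" unfolding sets_augmented by (rule augmented_setsI)
qed

lemma sets_F_subset_augmented: "sets (F s) \<subseteq> sets (augmented_filtration s)"
proof
  fix A assume A: "A \<in> sets (F s)"
  have "A \<in> completed_sets u" if "s < u" for u
    using A mono[OF less_imp_le[OF that]] sets_F by (intro completed_setsI[of A A]) auto
  then show "A \<in> sets (augmented_filtration s)" unfolding sets_augmented by (rule augmented_setsI)
qed

lemma measurable_augmented: "f \<in> F s \<rightarrow>\<^sub>M N \<Longrightarrow> f \<in> augmented_filtration s \<rightarrow>\<^sub>M N"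
  using sets_F_subset_augmented[of s] by (auto simp: measurable_def space_F space_augmented)

lemma integral_completed_set_eq:
  fixes X Y :: "'a \<Rightarrow> real"
  assumes XY: "X \<in> borel_measurable M" "Y \<in> borel_measurable M" and A: "A \<in> completed_sets t"
    and eq: "\<And>B. B \<in> sets (F t) \<Longrightarrow> (\<integral>w. X w * indicator B w \<partial>M) = (\<integral>w. Y w * indicator B w \<partial>M)"
  shows "(\<integral>w. X w * indicator A w \<partial>completion M) = (\<integral>w. Y w * indicator A w \<partial>completion M)"
proof -
  obtain B where A: "A \<in> sets (completion M)" and B: "B \<in> sets (F t)" "AE w in M. w \<in> A \<longleftrightarrow> w \<in> B"
    using A by (rule completed_setsE)
  have "B \<in> sets M" using B(1) sets_F by blast
  have "(\<integral>w. Z w * indicator A w \<partial>completion M) = (\<integral>w. Z w * indicator B w \<partial>M)"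
    if Z: "Z \<in> borel_measurable M" for Z :: "'a \<Rightarrow> real"
  proof -
    have "(\<integral>w. Z w * indicator A w \<partial>completion M) = (\<integral>w. Z w * indicator B w \<partial>completion M)"
    proof (rule integral_cong_AE)
      show "AE w in completion M. Z w * indicator A w = Z w * indicator B w"
        using AE_completion[OF B(2)] by eventually_elim (auto simp: indicator_def)
    qed (use measurable_completion[OF Z] A \<open>B \<in> sets M\<close> in
        \<open>auto intro!: borel_measurable_times borel_measurable_indicator\<close>)
    also have "\<dots> = (\<integral>w. Z w * indicator B w \<partial>M)"
      using Z \<open>B \<in> sets M\<close> by (intro integral_completion) auto
    finally show ?thesis .
  qed
  with eq[OF B(1)] XY show ?thesis by simp
qed

(* A set of the augmented sigma-algebra at time s is almost surely in F u for every u > s, so the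
   conditional expectations at times u n > s already determine the one at s. *)
lemma real_cond_exp_augmented_limit:
  fixes X Y :: "'a \<Rightarrow> real" and u :: "nat \<Rightarrow> 't"
  assumes X: "integrable M X" and Y: "integrable M Y" "Y \<in> borel_measurable (F s)"
    and u: "\<And>n. s < u n" and Y_limit: "(\<lambda>n. \<integral>w. \<bar>real_cond_exp M (F (u n)) X w - Y w\<bar> \<partial>M) \<longlonglongrightarrow> 0"
  shows "AE w in completion M. real_cond_exp (completion M) (augmented_filtration s) X w = Y w"
proof -
  interpret C: prob_space "completion M" by (rule prob_space_completion)
  interpret C: finite_measure_subalgebra "completion M" "augmented_filtration s"
    using subalgebra_augmented by unfold_locales
  show ?thesis
  proof (rule C.real_cond_exp_charact)
    show "integrable (completion M) X" "integrable (completion M) Y"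
      using X Y(1) by (simp_all add: integrable_completion[OF borel_measurable_integrable])
    show "Y \<in> borel_measurable (augmented_filtration s)" by (rule measurable_augmented[OF Y(2)])
    fix A assume "A \<in> sets (augmented_filtration s)"
    then have A: "A \<in> augmented_sets s" "A \<in> sets (completion M)"
      using augmented_sets_subset_completion by (auto simp: sets_augmented)
    have "\<bar>(\<integral>w. X w * indicator A w \<partial>completion M) - (\<integral>w. Y w * indicator A w \<partial>completion M)\<bar>
        \<le> (\<integral>w. \<bar>real_cond_exp M (F (u n)) X w - Y w\<bar> \<partial>M)" for n
    proof -
      interpret Fn: finite_measure_subalgebra M "F (u n)" using subalgebra by unfold_locales
      have Z: "integrable M (real_cond_exp M (F (u n)) X)" using X by (rule Fn.real_cond_exp_int)
      have "(\<integral>w. X w * indicator A w \<partial>completion M) =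
          (\<integral>w. real_cond_exp M (F (u n)) X w * indicator A w \<partial>completion M)"
        using Fn.real_cond_exp_intA[OF X]
        by (intro integral_completed_set_eq[OF _ _ augmented_setsD[OF A(1) u]]
            borel_measurable_integrable X Z)
          (simp add: set_lebesgue_integral_def mult.commute)
      then show ?thesis using integral_indicator_diff_le[OF Z Y(1) A(2)] by simp
    qed
    then have "\<bar>(\<integral>w. X w * indicator A w \<partial>completion M) -
        (\<integral>w. Y w * indicator A w \<partial>completion M)\<bar> \<le> 0"
      by (intro LIMSEQ_le_const[OF Y_limit]) blast
    then show "(\<integral>w\<in>A. X w \<partial>completion M) = (\<integral>w\<in>A. Y w \<partial>completion M)"
      by (simp add: set_lebesgue_integral_def mult.commute)
  qed
qed

end

section \<open>Left approximation of the semigroup in norm\<close>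

lemma compact_factor_uniformly_continuous:
  fixes \<Phi> :: "'a::topological_space \<Rightarrow> 'b::metric_space" and f :: "'a \<Rightarrow> real"
  assumes K: "compact K" and \<Phi>: "continuous_on K \<Phi>" and f: "continuous_on K f"
    and factor: "\<And>x y. x \<in> K \<Longrightarrow> y \<in> K \<Longrightarrow> \<Phi> x = \<Phi> y \<Longrightarrow> f x = f y" and \<eta>: "\<eta> > 0"
  shows "\<exists>\<delta>>0. \<forall>x\<in>K. \<forall>y\<in>K. dist (\<Phi> x) (\<Phi> y) < \<delta> \<longrightarrow> \<bar>f x - f y\<bar> < \<eta>"
proof -
  define S where "S = (K \<times> K) \<inter> (\<lambda>p. \<bar>f (fst p) - f (snd p)\<bar>) -` {\<eta>..}"
  have "continuous_on (K \<times> K) (\<lambda>p. \<bar>f (fst p) - f (snd p)\<bar>)"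
    by (intro continuous_intros continuous_on_compose2[OF f]) auto
  then have "closedin (top_of_set (K \<times> K)) S"
    unfolding S_def by (intro continuous_closedin_preimage closed_atLeast)
  then have "compact S" by (intro closedin_compact[OF compact_Times[OF K K]])
  moreover have "continuous_on S (\<lambda>p. dist (\<Phi> (fst p)) (\<Phi> (snd p)))"
    by (intro continuous_intros continuous_on_compose2[OF \<Phi>]) (auto simp: S_def)
  ultimately consider (empty) "S = {}" |
    (minimum) p where "p \<in> S"
      "\<And>q. q \<in> S \<Longrightarrow> dist (\<Phi> (fst p)) (\<Phi> (snd p)) \<le> dist (\<Phi> (fst q)) (\<Phi> (snd q))"
    using continuous_attains_inf[of S "\<lambda>p. dist (\<Phi> (fst p)) (\<Phi> (snd p))"] by blast
  then show ?thesis
  proof cases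
    case empty
    then have "\<bar>f x - f y\<bar> < \<eta>" if "x \<in> K" "y \<in> K" for x y using that by (auto simp: S_def)
    then show ?thesis by (intro exI[of _ 1]) simp
  next
    case minimum
    define \<delta> where "\<delta> = dist (\<Phi> (fst p)) (\<Phi> (snd p))"
    have "f (fst p) \<noteq> f (snd p)" "fst p \<in> K" "snd p \<in> K" using minimum(1) \<eta> by (auto simp: S_def)
    then have "\<delta> > 0" using factor[of "fst p" "snd p"] by (auto simp: \<delta>_def)
    moreover have "\<bar>f x - f y\<bar> < \<eta>" if "x \<in> K" "y \<in> K" "dist (\<Phi> x) (\<Phi> y) < \<delta>" for x y
      using minimum(2)[of "(x, y)"] that by (force simp: S_def \<delta>_def)
    ultimately show ?thesis by blast
  qed
qed

lemma compact_image_finite_net: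
  fixes \<Phi> :: "'a::topological_space \<Rightarrow> 'b::metric_space"
  assumes "compact K" "continuous_on K \<Phi>" "\<epsilon> > 0"
  shows "\<exists>as. set as \<subseteq> K \<and> (\<forall>x\<in>K. \<exists>a\<in>set as. dist (\<Phi> x) (\<Phi> a) < \<epsilon>)"
proof -
  have "\<Phi> ` K \<subseteq> (\<Union>a\<in>K. ball (\<Phi> a) \<epsilon>)" using assms(3) by auto
  then obtain D where D: "D \<subseteq> K" "finite D" "\<Phi> ` K \<subseteq> (\<Union>a\<in>D. ball (\<Phi> a) \<epsilon>)"
    using compactE_image[OF compact_continuous_image[OF assms(2,1)], of K "\<lambda>a. ball (\<Phi> a) \<epsilon>"]
    by auto
  obtain as where "set as = D" using finite_list[OF D(2)] by blast
  then show ?thesis using D by (intro exI[of _ as]) (auto simp: dist_commute image_subset_iff)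
qed

(* The functions on K factoring through a metric space form a separable subset of C(K). The label
   of f consists of a mesh controlling its oscillation and its rounded values on a net of that
   mesh. *)
lemma compact_factor_labels:
  fixes \<Phi> :: "'a::topological_space \<Rightarrow> 'b::metric_space" and f :: "'i \<Rightarrow> 'a \<Rightarrow> real"
  assumes K: "compact K" and \<Phi>: "continuous_on K \<Phi>" and f: "\<And>i. i \<in> I \<Longrightarrow> continuous_on K (f i)"
    and factor: "\<And>i x y. i \<in> I \<Longrightarrow> x \<in> K \<Longrightarrow> y \<in> K \<Longrightarrow> \<Phi> x = \<Phi> y \<Longrightarrow> f i x = f i y" and \<eta>: "\<eta> > 0"
  obtains c :: "'i \<Rightarrow> nat" where
    "\<And>i j x. i \<in> I \<Longrightarrow> j \<in> I \<Longrightarrow> c i = c j \<Longrightarrow> x \<in> K \<Longrightarrow> \<bar>f i x - f j x\<bar> \<le> 3 * \<eta>"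
proof -
  have "\<exists>as. set as \<subseteq> K \<and> (\<forall>x\<in>K. \<exists>a\<in>set as. dist (\<Phi> x) (\<Phi> a) < 1 / real (Suc m))" for m
    by (intro compact_image_finite_net K \<Phi>) simp
  then obtain net where net: "\<And>m. set (net m) \<subseteq> K"
    "\<And>m x. x \<in> K \<Longrightarrow> \<exists>a\<in>set (net m). dist (\<Phi> x) (\<Phi> a) < 1 / real (Suc m)" by metis
  have "\<exists>m. \<forall>x\<in>K. \<forall>y\<in>K. dist (\<Phi> x) (\<Phi> y) < 1 / real (Suc m) \<longrightarrow> \<bar>f i x - f i y\<bar> < \<eta>"
    if i: "i \<in> I" for i
  proof -
    obtain \<delta> where "\<delta> > 0" "\<forall>x\<in>K. \<forall>y\<in>K. dist (\<Phi> x) (\<Phi> y) < \<delta> \<longrightarrow> \<bar>f i x - f i y\<bar> < \<eta>"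
      using compact_factor_uniformly_continuous[OF K \<Phi> f[OF i] factor[OF i] \<eta>] by blast
    moreover obtain m where "1 / real (Suc m) < \<delta>"
      using reals_Archimedean[OF \<open>\<delta> > 0\<close>] by (auto simp: inverse_eq_divide)
    ultimately show ?thesis by (intro exI[of _ m]) (meson less_trans)
  qed
  then obtain mesh where mesh: "\<And>i x y. i \<in> I \<Longrightarrow> x \<in> K \<Longrightarrow> y \<in> K \<Longrightarrow>
      dist (\<Phi> x) (\<Phi> y) < 1 / real (Suc (mesh i)) \<Longrightarrow> \<bar>f i x - f i y\<bar> < \<eta>" by metis
  define c where "c i = to_nat (mesh i, map (\<lambda>a. \<lfloor>f i a / \<eta>\<rfloor>) (net (mesh i)))" for i
  have "\<bar>f i x - f j x\<bar> \<le> 3 * \<eta>" if ij: "i \<in> I" "j \<in> I" "c i = c j" and x: "x \<in> K" for i j x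
  proof -
    have same: "mesh i = mesh j" "\<And>a. a \<in> set (net (mesh i)) \<Longrightarrow> \<lfloor>f i a / \<eta>\<rfloor> = \<lfloor>f j a / \<eta>\<rfloor>"
      using ij(3) by (auto simp: c_def)
    obtain a where a: "a \<in> set (net (mesh i))" "dist (\<Phi> x) (\<Phi> a) < 1 / real (Suc (mesh i))"
      using net(2)[OF x] by blast
    have "a \<in> K" using a(1) net(1) by blast
    then have "\<bar>f i x - f i a\<bar> < \<eta>" "\<bar>f j x - f j a\<bar> < \<eta>" using mesh ij x a(2) same(1) by auto
    moreover have "\<bar>f i a - f j a\<bar> \<le> \<eta>"
    proof -
      have "\<bar>f i a / \<eta> - f j a / \<eta>\<bar> \<le> 1" using same(2)[OF a(1)] by linarith
      then show ?thesis using \<eta> by (simp add: diff_divide_distrib[symmetric] abs_divide)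
    qed
    ultimately show ?thesis by linarith
  qed
  then show thesis by (rule that)
qed

lemma right_limits_eq_if_eq_on_rationals:
  fixes f g :: "real \<Rightarrow> real"
  assumes "(f \<longlongrightarrow> a) (at_right r)" "(g \<longlongrightarrow> b) (at_right r)"
    and eq: "\<And>q. q \<in> \<rat> \<Longrightarrow> r < q \<Longrightarrow> f q = g q"
  shows "a = b"
proof (rule ccontr)
  assume "a \<noteq> b"
  then have "\<forall>\<^sub>F t in at_right r. f t - g t \<noteq> 0"
    by (intro tendsto_imp_eventually_ne[OF tendsto_diff[OF assms(1,2)]]) simp
  then obtain u where u: "r < u" "\<And>t. r < t \<Longrightarrow> t < u \<Longrightarrow> f t \<noteq> g t"
    unfolding eventually_at_right_field by auto
  obtain q where "q \<in> \<rat>" "r < q" "q < u" using Rats_dense_in_real[OF u(1)] by blast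
  with u(2) eq show False by blast
qed

lemma right_continuous_family_labels:
  fixes f :: "real \<Rightarrow> 'a::topological_space \<Rightarrow> real"
  assumes K: "compact K" and f: "\<And>t. 0 \<le> t \<Longrightarrow> continuous_on K (f t)"
    and right: "\<And>t x. 0 \<le> t \<Longrightarrow> ((\<lambda>u. f u x) \<longlongrightarrow> f t x) (at_right t)" and \<eta>: "\<eta> > 0"
  obtains c :: "real \<Rightarrow> nat" where
    "\<And>s t x. 0 \<le> s \<Longrightarrow> 0 \<le> t \<Longrightarrow> c s = c t \<Longrightarrow> x \<in> K \<Longrightarrow> \<bar>f s x - f t x\<bar> \<le> 3 * \<eta>"
proof -
  define \<Phi> where "\<Phi> x = (\<lambda>q::rat. f \<bar>of_rat q\<bar> x)" for x
  have continuous: "continuous_on K \<Phi>"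
    unfolding \<Phi>_def by (intro continuous_on_coordinatewise_then_product f) simp
  have factor: "f t x = f t y" if "t \<in> {0..}" "\<Phi> x = \<Phi> y" for t x y
  proof (rule right_limits_eq_if_eq_on_rationals)
    show "((\<lambda>u. f u x) \<longlongrightarrow> f t x) (at_right t)" "((\<lambda>u. f u y) \<longlongrightarrow> f t y) (at_right t)"
      using that(1) by (auto intro: right)
    fix q :: real assume "q \<in> \<rat>" "t < q"
    then obtain p where p: "q = of_rat p" by (auto elim: Rats_cases)
    have "0 < q" using \<open>t < q\<close> that(1) by simp
    then have "0 < p" by (simp only: p zero_less_of_rat_iff)
    then show "f q x = f q y" using fun_cong[OF that(2), of p] by (simp add: \<Phi>_def p)
  qed
  show thesis
  proof (rule compact_factor_labels[OF K continuous, of "{0..}" f \<eta>])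
    fix c :: "real \<Rightarrow> nat"
    assume c: "\<And>s t x. s \<in> {0..} \<Longrightarrow> t \<in> {0..} \<Longrightarrow> c s = c t \<Longrightarrow> x \<in> K \<Longrightarrow> \<bar>f s x - f t x\<bar> \<le> 3 * \<eta>"
    show thesis by (rule that[of c]) (rule c; simp)
  next
    show "continuous_on K (f t)" if "t \<in> {0..}" for t using f that by simp
    show "f t x = f t y" if "t \<in> {0..}" "\<Phi> x = \<Phi> y" for t x y using that by (rule factor)
  qed (rule \<eta>)
qed

lemma uncountable_label_collision:
  fixes c :: "real \<Rightarrow> 'a::countable"
  assumes "a < b" obtains r s where "a < r" "r < s" "s < b" "c r = c s"
proof -
  have "\<not> inj_on c {a<..<b}"
    using uncountable_open_interval[of a b] assms countable_image_inj_on[of c "{a<..<b}"] by auto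
  then obtain x y where "x \<in> {a<..<b}" "y \<in> {a<..<b}" "x \<noteq> y" "c x = c y"
    unfolding inj_on_def by blast
  then show thesis using that[of x y] that[of y x] by (cases x y rule: linorder_cases) auto
qed

context feller
begin

lemma P_tendsto_at_right:
  assumes "0 \<le> t" "f \<in> Brho \<rho>" shows "((\<lambda>u. P u f x) \<longlongrightarrow> P t f x) (at_right t)"
proof -
  have "((\<lambda>h. P h (P t f) x) \<longlongrightarrow> P t f x) (at_right 0)" by (rule P_tendsto_at_0[OF P_Brho[OF assms]])
  moreover have "\<forall>\<^sub>F h in at_right 0. P h (P t f) x = P (h + t) f x"
    using P_semigroup[OF assms] by (auto simp: eventually_at_filter add.commute)
  ultimately show ?thesis
    unfolding filterlim_at_right_to_0[of _ _ t] by (rule Lim_transform_eventually)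
qed

lemma P_small_on_superlevel:
  assumes f: "f \<in> Brho \<rho>" and e: "e > 0"
  obtains R where "\<And>t x. t \<in> {0..T} \<Longrightarrow> R \<le> \<rho> x \<Longrightarrow> \<bar>P t f x\<bar> \<le> e * \<rho> x"
proof -
  obtain C where C: "\<And>t. t \<in> {0..T} \<Longrightarrow> operator_bound t C"
    by (rule operator_bound_Icc[where T = T]) blast
  define C' where "C' = max 0 C"
  define d where "d = e / (2 * (C' + 1))"
  have d: "d > 0" "C' * d \<le> e / 2" using e by (auto simp: d_def C'_def field_simps)
  obtain g where g: "g \<in> Cb" "\<And>x. \<bar>f x - g x\<bar> \<le> d * \<rho> x" using Brho_approx[OF f d(1)] by blast
  obtain B where B: "B > 0" "\<And>x. \<bar>g x\<bar> \<le> B" using Cb_boundedE[OF g(1)] by blast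
  have "\<bar>P t f x\<bar> \<le> e * \<rho> x" if t: "t \<in> {0..T}" and x: "2 * B / e \<le> \<rho> x" for t x
  proof -
    have "\<bar>P t f x - P t g x\<bar> \<le> C * d * \<rho> x"
      using t d(1) by (intro P_diff_le_weight C f Cb_Brho g) auto
    also have "\<dots> = C' * d * \<rho> x" using C[OF t] by (simp add: C'_def operator_bound_def)
    also have "\<dots> \<le> e / 2 * \<rho> x" using d(2) rho_nonneg by (rule mult_right_mono)
    finally have "\<bar>P t f x - P t g x\<bar> \<le> e / 2 * \<rho> x" .
    moreover have "\<bar>P t g x\<bar> \<le> B" using t by (intro P_bounded Cb_Brho g B) simp
    moreover have "B \<le> e / 2 * \<rho> x" using x e by (simp add: field_simps)
    ultimately show ?thesis by linarith
  qed
  then show thesis by (rule that)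
qed

lemma P_orbit_labels:
  assumes f: "f \<in> Brho \<rho>" and e: "e > 0"
  obtains c :: "real \<Rightarrow> nat" where
    "\<And>s t x. s \<in> {0..T} \<Longrightarrow> t \<in> {0..T} \<Longrightarrow> c s = c t \<Longrightarrow> \<bar>P s f x - P t f x\<bar> \<le> e * \<rho> x"
proof -
  obtain R where R: "\<And>t x. t \<in> {0..T} \<Longrightarrow> R \<le> \<rho> x \<Longrightarrow> \<bar>P t f x\<bar> \<le> e / 2 * \<rho> x"
    by (rule P_small_on_superlevel[OF f half_gt_zero[OF e]]) blast
  have cont: "continuous_on {x. \<rho> x \<le> R} (P t f)" if "0 \<le> t" for t
    using Brho_sublevel_continuous[OF P_Brho[OF that f]] by (simp add: sublevel_continuous_def)
  have \<eta>: "e * rho_min / 3 > 0" using e rho_min_pos by simp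
  obtain c :: "real \<Rightarrow> nat" where c: "\<And>s t x. 0 \<le> s \<Longrightarrow> 0 \<le> t \<Longrightarrow> c s = c t \<Longrightarrow> x \<in> {x. \<rho> x \<le> R} \<Longrightarrow>
      \<bar>P s f x - P t f x\<bar> \<le> 3 * (e * rho_min / 3)"
    by (rule right_continuous_family_labels[OF compact_sublevel cont P_tendsto_at_right[OF _ f] \<eta>])
      blast+
  have "\<bar>P s f x - P t f x\<bar> \<le> e * \<rho> x" if st: "s \<in> {0..T}" "t \<in> {0..T}" "c s = c t" for s t x
  proof (cases "\<rho> x \<le> R")
    case True
    then have "\<bar>P s f x - P t f x\<bar> \<le> e * rho_min" using c[of s t x] st by simp
    also have "\<dots> \<le> e * \<rho> x" using e rho_min_le by (intro mult_left_mono) auto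
    finally show ?thesis .
  next
    case False
    then show ?thesis using R[OF st(1), of x] R[OF st(2), of x] by simp
  qed
  then show thesis by (rule that)
qed

(* An orbit has a countable partition into norm-small pieces, so every interval to the left of T
   contains two times r < s with P r f close to P s f; the bounded operator P (T - s) carries this
   to time T. *)
lemma P_left_approx:
  assumes f: "f \<in> Brho \<rho>" and T: "T > 0" and e: "e > 0" and d: "d > 0"
  shows "\<exists>h. 0 < h \<and> h < d \<and> h < T \<and> (\<forall>x. \<bar>P (T - h) f x - P T f x\<bar> \<le> e * \<rho> x)"
proof -
  obtain C where C: "\<And>t. t \<in> {0..T} \<Longrightarrow> operator_bound t C"
    by (rule operator_bound_Icc[where T = T]) blast
  have C0: "C \<ge> 0" using C[of 0] T by (simp add: operator_bound_def)
  have tolerance: "e / (C + 1) > 0" "C * (e / (C + 1)) \<le> e" using e C0 by (auto simp: field_simps)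
  obtain c :: "real \<Rightarrow> nat" where c: "\<And>s t x. s \<in> {0..T} \<Longrightarrow> t \<in> {0..T} \<Longrightarrow> c s = c t \<Longrightarrow>
      \<bar>P s f x - P t f x\<bar> \<le> e / (C + 1) * \<rho> x"
    by (rule P_orbit_labels[OF f tolerance(1)]) blast
  have "max 0 (T - d) < T" using T d by simp
  then obtain r s where rs: "max 0 (T - d) < r" "r < s" "s < T" "c r = c s"
    by (rule uncountable_label_collision[where c = c])
  define h where "h = s - r"
  have r0: "0 \<le> r" and s0: "0 \<le> s" and Ts: "0 \<le> T - s" using rs by auto
  have "\<bar>P (T - h) f x - P T f x\<bar> \<le> e * \<rho> x" for x
  proof -
    have "P (T - h) f = P (T - s) (P r f)" "P T f = P (T - s) (P s f)"
      using P_semigroup[OF r0 f Ts] P_semigroup[OF s0 f Ts] by (simp_all add: h_def algebra_simps)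
    then have "\<bar>P (T - h) f x - P T f x\<bar> \<le> C * (e / (C + 1)) * \<rho> x"
      using P_diff_le_weight[OF Ts C P_Brho[OF r0 f] P_Brho[OF s0 f] _ c[OF _ _ rs(4)]]
        rs s0 r0 e C0 by simp
    also have "\<dots> \<le> e * \<rho> x" using tolerance(2) rho_nonneg by (rule mult_right_mono)
    finally show ?thesis .
  qed
  then show ?thesis using rs by (intro exI[of _ h]) (auto simp: h_def)
qed

lemma P_left_approx_sequence:
  assumes f: "f \<in> Brho \<rho>" and T: "T > 0"
  obtains h where "\<And>n. 0 < h n" "\<And>n. h n < T" "h \<longlonglongrightarrow> 0"
    "\<And>n x. \<bar>P (T - h n) f x - P T f x\<bar> \<le> 1 / real (Suc n) * \<rho> x"
proof -
  have "\<forall>n. \<exists>h. 0 < h \<and> h < 1 / real (Suc n) \<and> h < T \<and>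
      (\<forall>x. \<bar>P (T - h) f x - P T f x\<bar> \<le> 1 / real (Suc n) * \<rho> x)"
    by (intro allI P_left_approx[OF f T]) auto
  from choice[OF this] obtain h where h: "\<And>n. 0 < h n" "\<And>n. h n < 1 / real (Suc n)" "\<And>n. h n < T"
    "\<And>n x. \<bar>P (T - h n) f x - P T f x\<bar> \<le> 1 / real (Suc n) * \<rho> x" by blast
  have "h \<longlonglongrightarrow> 0"
    using h(1,2) by (intro tendsto_sandwich[OF _ _ tendsto_const LIMSEQ_Suc[OF lim_1_over_n]])
      (auto intro!: always_eventually less_imp_le)
  with h(1,3) show thesis using h(4) by (rule that)
qed

sublocale transition: transition_function kernel
  by unfold_locales (rule kernel_measurable kernel_0 chapman_kolmogorov; assumption)+

end

section \<open>The Markov property of a generalized Feller process\<close>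

sublocale markov_process \<subseteq> filtered_prob_space M natural_filtration
  by unfold_locales (rule subalgebra_natural, rule natural_mono)

locale feller_process = feller \<rho> P + markov_process kernel M \<nu>
  for \<rho> :: "'a::topological_space \<Rightarrow> real" and P and M :: "(real \<Rightarrow> 'a) measure"
    and \<nu> :: "'a measure" +
  assumes prob_in_Mrho_nu: "prob_in_Mrho \<rho> \<nu>"
begin

lemma weighted_prob_distr_coordinate: "0 \<le> t \<Longrightarrow> weighted_prob \<rho> (distr M borel (\<lambda>w. w t))"
  unfolding distr_coordinate by (rule weighted_prob_bind_kernel[OF prob_in_Mrho_nu])

lemma coordinate_borel: "0 \<le> t \<Longrightarrow> (\<lambda>w. w t) \<in> M \<rightarrow>\<^sub>M borel"
  using coordinate_measurable[of t "\<lambda>x. x" borel] by simp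

lemma Brho_coordinate_measurable: "0 \<le> t \<Longrightarrow> f \<in> Brho \<rho> \<Longrightarrow> (\<lambda>w. f (w t)) \<in> borel_measurable M"
  by (intro coordinate_measurable Brho_borel)

lemma integrable_coordinate:
  assumes t: "0 \<le> t" and f: "f \<in> Brho \<rho>" shows "integrable M (\<lambda>w. f (w t))"
  using weighted_prob.Brho_integrable[OF weighted_prob_distr_coordinate[OF t] f]
  by (simp add: integrable_distr_eq[OF coordinate_borel[OF t] Brho_borel[OF f]])

lemma integral_abs_diff_coordinate_le:
  assumes t: "0 \<le> t" and f: "f \<in> Brho \<rho>" "g \<in> Brho \<rho>" and C: "operator_bound t C"
    and \<epsilon>: "\<epsilon> \<ge> 0" "\<And>x. \<bar>f x - g x\<bar> \<le> \<epsilon> * \<rho> x"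
  shows "(\<integral>w. \<bar>f (w t) - g (w t)\<bar> \<partial>M) \<le> \<epsilon> * (C * (\<integral>x. \<rho> x \<partial>\<nu>))"
proof -
  have "(\<lambda>x. \<bar>f x - g x\<bar>) \<in> borel_measurable borel"
    using Brho_borel[OF f(1)] Brho_borel[OF f(2)] by measurable
  then have "(\<integral>w. \<bar>f (w t) - g (w t)\<bar> \<partial>M) = (\<integral>x. \<bar>f x - g x\<bar> \<partial>distr M borel (\<lambda>w. w t))"
    by (rule integral_distr[OF coordinate_borel[OF t], symmetric])
  also have "\<dots> \<le> \<epsilon> * (\<integral>x. \<rho> x \<partial>distr M borel (\<lambda>w. w t))"
    by (rule weighted_prob.integral_abs_diff_le[OF weighted_prob_distr_coordinate[OF t] f \<epsilon>(2)])
  also have "\<dots> \<le> \<epsilon> * (C * (\<integral>x. \<rho> x \<partial>\<nu>))"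
    unfolding distr_coordinate[OF t]
    by (intro mult_left_mono integral_rho_bind_kernel_le prob_in_Mrho_nu t C \<epsilon>(1))
  finally show ?thesis .
qed

lemma real_cond_exp_natural:
  assumes s: "0 \<le> s" "s \<le> t" and f: "f \<in> Brho \<rho>"
  shows "AE w in M. real_cond_exp M (natural_filtration s) (\<lambda>w. f (w t)) w = P (t - s) f (w s)"
proof -
  have ts: "0 \<le> t - s" "0 \<le> t" using s by auto
  have pos_part: "AE w in M. nn_cond_exp M (natural_filtration s) (\<lambda>w. ennreal (g (w t))) w =
      ennreal (P (t - s) (\<lambda>x. max 0 (g x)) (w s))" if g: "g \<in> Brho \<rho>" for g
  proof -
    have "(\<integral>\<^sup>+w. ennreal (g (w t)) \<partial>M) \<le> (\<integral>\<^sup>+w. ennreal (norm (g (w t))) \<partial>M)"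
      by (intro nn_integral_mono ennreal_leI) simp
    also have "\<dots> < \<infinity>" using integrable_coordinate[OF ts(2) g] by (simp add: integrable_iff_bounded)
    finally have "AE w in M. (\<integral>\<^sup>+z. ennreal (g z) \<partial>kernel (t - s) (w s)) =
        nn_cond_exp M (natural_filtration s) (\<lambda>w. ennreal (g (w t))) w"
      using Brho_borel[OF g] by (intro nn_cond_exp_natural[OF s]) auto
    then show ?thesis
    proof eventually_elim
      case (elim w)
      have "(\<integral>\<^sup>+z. ennreal (g z) \<partial>kernel (t - s) (w s)) =
          ennreal (P (t - s) (\<lambda>x. max 0 (g x)) (w s))"
        using nn_integral_kernel_Brho[OF ts(1) Brho_pos_part[OF g], of "w s"] by simp
      with elim show ?case by simp
    qed
  qed
  have neg: "(\<lambda>x. - f x) \<in> Brho \<rho>" using Brho_cmult[OF f, of "-1"] by simp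
  have "P (t - s) (\<lambda>x. max 0 (f x)) x - P (t - s) (\<lambda>x. max 0 (- f x)) x = P (t - s) f x" for x
    using P_diff[OF ts(1) Brho_pos_part[OF f] Brho_pos_part[OF neg], of x]
    by (simp add: max_def if_distrib cong: if_cong)
  then show ?thesis
    using pos_part[OF f] pos_part[OF neg]
    by (auto simp: real_cond_exp_def P_nonneg[OF ts(1)] Brho_pos_part f neg elim!: eventually_elim2)
qed

lemma integral_coordinate_mult:
  assumes s: "0 \<le> s" "s \<le> t" and f: "f \<in> Cb" and g: "g \<in> Cb"
  shows "(\<integral>w. g (w s) * f (w t) \<partial>M) = (\<integral>w. g (w s) * P (t - s) f (w s) \<partial>M)"
proof -
  interpret natural: sigma_finite_subalgebra M "natural_filtration s"
    by (rule sigma_finite_subalgebra_natural)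
  have t: "0 \<le> t" "0 \<le> t - s" using s by auto
  obtain A where A: "\<And>x. \<bar>f x\<bar> \<le> A" by (rule Cb_boundedE[OF f]) blast
  obtain B where B: "\<And>x. \<bar>g x\<bar> \<le> B" by (rule Cb_boundedE[OF g]) blast
  have "\<bar>g x * f y\<bar> \<le> B * A" for x y
    unfolding abs_mult using A[of y] B[of x] by (intro mult_mono) auto
  then have int: "integrable M (\<lambda>w. g (w s) * f (w t))"
    using Brho_coordinate_measurable[OF s(1) Cb_Brho[OF g]]
        Brho_coordinate_measurable[OF t(1) Cb_Brho[OF f]]
    by (intro integrable_const_bound[of _ "B * A"]) auto
  have "(\<integral>w. g (w s) * f (w t) \<partial>M) =
      (\<integral>w. g (w s) * real_cond_exp M (natural_filtration s) (\<lambda>w. f (w t)) w \<partial>M)"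
    using int Brho_coordinate_measurable[OF t(1) Cb_Brho[OF f]]
    by (intro natural.real_cond_exp_intg(2)[symmetric]
        coordinate_measurable_natural[OF s(1) order_refl] Brho_borel Cb_Brho g)
  also have "\<dots> = (\<integral>w. g (w s) * P (t - s) f (w s) \<partial>M)"
  proof (rule integral_cong_AE)
    show "AE w in M. g (w s) * real_cond_exp M (natural_filtration s) (\<lambda>w. f (w t)) w =
        g (w s) * P (t - s) f (w s)"
      using real_cond_exp_natural[OF s Cb_Brho[OF f]] by eventually_elim simp
  qed (use Brho_coordinate_measurable[OF s(1)] Cb_Brho[OF g] P_Brho[OF t(2) Cb_Brho[OF f]] in auto)
  finally show ?thesis .
qed

lemma integral_square_diff_coordinate:
  assumes s: "0 \<le> s" "s \<le> t" and g: "g \<in> Cb"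
  shows "(\<integral>w. (g (w t) - g (w s))\<^sup>2 \<partial>M) =
    (\<integral>w. P (t - s) (\<lambda>x. (g x)\<^sup>2) (w s) - 2 * (g (w s) * P (t - s) g (w s)) + (g (w s))\<^sup>2 \<partial>M)"
proof -
  have t: "0 \<le> t" "0 \<le> t - s" using s by auto
  obtain B where B: "\<And>x. \<bar>g x\<bar> \<le> B" by (rule Cb_boundedE[OF g]) blast
  have g2: "(\<lambda>x. (g x)\<^sup>2) \<in> Brho \<rho>" by (intro Cb_Brho Cb_power2 g)
  have int_mult: "integrable M (\<lambda>w. g (w s) * f (w u))"
    if f: "f \<in> Brho \<rho>" "\<And>x. \<bar>f x\<bar> \<le> B" and u: "0 \<le> u" for f u
  proof (rule integrable_const_bound[of _ "B * B"])
    have "\<bar>g x * f y\<bar> \<le> B * B" for x y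
      unfolding abs_mult using B[of x] f(2)[of y] by (intro mult_mono) auto
    then show "AE w in M. norm (g (w s) * f (w u)) \<le> B * B" by simp
  qed (intro borel_measurable_times Brho_coordinate_measurable s(1) Cb_Brho g f u)
  have int: "integrable M (\<lambda>w. (g (w t))\<^sup>2)" "integrable M (\<lambda>w. (g (w s))\<^sup>2)"
    "integrable M (\<lambda>w. P (t - s) (\<lambda>x. (g x)\<^sup>2) (w s))"
    "integrable M (\<lambda>w. g (w s) * g (w t))" "integrable M (\<lambda>w. g (w s) * P (t - s) g (w s))"
    by (intro integrable_coordinate int_mult P_Brho P_bounded Cb_Brho g g2 B t s)+
  have "(\<integral>w. (g (w t) - g (w s))\<^sup>2 \<partial>M) =
      (\<integral>w. (g (w t))\<^sup>2 - 2 * (g (w s) * g (w t)) + (g (w s))\<^sup>2 \<partial>M)"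
    by (intro Bochner_Integration.integral_cong) (auto simp: power2_diff)
  also have "\<dots> = (\<integral>w. (g (w t))\<^sup>2 \<partial>M) - 2 * (\<integral>w. g (w s) * g (w t) \<partial>M) + (\<integral>w. (g (w s))\<^sup>2 \<partial>M)"
    using int by simp
  also have "(\<integral>w. (g (w t))\<^sup>2 \<partial>M) = (\<integral>w. P (t - s) (\<lambda>x. (g x)\<^sup>2) (w s) \<partial>M)"
    using integral_coordinate_mult[OF s Cb_power2[OF g] Cb_const[of 1]] by simp
  also have "(\<integral>w. g (w s) * g (w t) \<partial>M) = (\<integral>w. g (w s) * P (t - s) g (w s) \<partial>M)"
    by (rule integral_coordinate_mult[OF s g g])
  finally show ?thesis using int by simp
qed

lemma right_L2_continuous_Cb:
  assumes s: "0 \<le> s" and g: "g \<in> Cb" and h: "\<And>n. 0 < h n" "h \<longlonglongrightarrow> 0"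
  shows "(\<lambda>n. \<integral>w. (g (w (s + h n)) - g (w s))\<^sup>2 \<partial>M) \<longlonglongrightarrow> 0"
proof -
  define \<phi> where "\<phi> n x = P (h n) (\<lambda>x. (g x)\<^sup>2) x - 2 * (g x * P (h n) g x) + (g x)\<^sup>2" for n x
  obtain B where B: "\<And>x. \<bar>g x\<bar> \<le> B" by (rule Cb_boundedE[OF g]) blast
  have gB: "g \<in> Brho \<rho>" "(\<lambda>x. (g x)\<^sup>2) \<in> Brho \<rho>" by (intro Cb_Brho Cb_power2 g)+
  have square: "\<bar>(g x)\<^sup>2\<bar> \<le> B\<^sup>2" for x
    using B[of x]
    by (simp add: abs_le_square_iff order_trans[OF _ abs_ge_self] flip: abs_le_square_iff)
  have hn: "0 \<le> h n" for n using h(1)[of n] by simp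
  have h_right: "filterlim h (at_right 0) sequentially"
    using h by (auto simp: filterlim_at less_imp_neq[symmetric])
  have "(\<lambda>n. \<integral>w. \<phi> n (w s) \<partial>M) \<longlonglongrightarrow> (\<integral>w. 0 \<partial>M)"
  proof (rule integral_dominated_convergence[where w = "\<lambda>_. 4 * B\<^sup>2"])
    show "(\<lambda>w. \<phi> n (w s)) \<in> borel_measurable M" for n
      unfolding \<phi>_def
      using Brho_coordinate_measurable[OF s] gB P_Brho[OF hn gB(1)] P_Brho[OF hn gB(2)]
      by measurable
    show "AE w in M. norm (\<phi> n (w s)) \<le> 4 * B\<^sup>2" for n
    proof (intro AE_I2)
      fix w
      have "\<bar>g (w s) * P (h n) g (w s)\<bar> \<le> B * B"
        unfolding abs_mult using B[of "w s"] P_bounded[OF hn gB(1) B, of n "w s"]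
        by (intro mult_mono) auto
      then show "norm (\<phi> n (w s)) \<le> 4 * B\<^sup>2"
        using P_bounded[OF hn gB(2) square, of n "w s"] square[of "w s"]
        unfolding \<phi>_def real_norm_def power2_eq_square by linarith
    qed
    show "AE w in M. (\<lambda>n. \<phi> n (w s)) \<longlonglongrightarrow> 0"
    proof (intro AE_I2)
      fix w
      have "(\<lambda>n. \<phi> n (w s)) \<longlonglongrightarrow> (g (w s))\<^sup>2 - 2 * (g (w s) * g (w s)) + (g (w s))\<^sup>2"
        unfolding \<phi>_def
        by (intro tendsto_intros filterlim_compose[OF P_tendsto_at_0 h_right] gB)
      then show "(\<lambda>n. \<phi> n (w s)) \<longlonglongrightarrow> 0" by (simp add: power2_eq_square)
    qed
  qed auto
  then show ?thesis
    using integral_square_diff_coordinate[OF s _ g] hn by (simp add: \<phi>_def)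
qed

lemma right_L1_continuous_Cb:
  assumes s: "0 \<le> s" and g: "g \<in> Cb" and h: "\<And>n. 0 < h n" "h \<longlonglongrightarrow> 0"
  shows "(\<lambda>n. \<integral>w. \<bar>g (w (s + h n)) - g (w s)\<bar> \<partial>M) \<longlonglongrightarrow> 0"
proof (rule tendsto_sandwich[OF _ _ tendsto_const])
  obtain B where B: "\<And>x. \<bar>g x\<bar> \<le> B" by (rule Cb_boundedE[OF g]) blast
  have "(\<integral>w. \<bar>g (w (s + h n)) - g (w s)\<bar> \<partial>M) \<le> sqrt (\<integral>w. (g (w (s + h n)) - g (w s))\<^sup>2 \<partial>M)" for n
  proof -
    define D where "D w = g (w (s + h n)) - g (w s)" for w
    have u: "0 \<le> s + h n" using s h(1)[of n] by simp
    have int: "integrable M D"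
      unfolding D_def
      by (intro Bochner_Integration.integrable_diff integrable_coordinate Cb_Brho g u s)
    have "\<bar>D w\<bar> \<le> \<bar>2 * B\<bar>" for w
      using B[of "w (s + h n)"] B[of "w s"] unfolding D_def by linarith
    then have "(D w)\<^sup>2 \<le> (2 * B)\<^sup>2" for w by (simp only: abs_le_square_iff)
    then have int2: "integrable M (\<lambda>w. \<bar>D w\<bar>\<^sup>2)"
      using borel_measurable_integrable[OF int]
      by (intro integrable_const_bound[of _ "(2 * B)\<^sup>2"]) auto
    have "(expectation (\<lambda>w. \<bar>D w\<bar>))\<^sup>2 \<le> expectation (\<lambda>w. \<bar>D w\<bar>\<^sup>2)"
      using variance_positive[of "\<lambda>w. \<bar>D w\<bar>"] variance_eq[OF integrable_abs[OF int] int2] by simp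
    then have "expectation (\<lambda>w. \<bar>D w\<bar>) \<le> sqrt (expectation (\<lambda>w. (D w)\<^sup>2))"
      by (intro real_le_rsqrt) simp
    then show ?thesis by (simp add: D_def)
  qed
  then show "\<forall>\<^sub>F n in sequentially. (\<integral>w. \<bar>g (w (s + h n)) - g (w s)\<bar> \<partial>M) \<le>
      sqrt (\<integral>w. (g (w (s + h n)) - g (w s))\<^sup>2 \<partial>M)"
    by simp
  show "(\<lambda>n. sqrt (\<integral>w. (g (w (s + h n)) - g (w s))\<^sup>2 \<partial>M)) \<longlonglongrightarrow> 0"
    using tendsto_real_sqrt[OF right_L2_continuous_Cb[OF assms]] by simp
qed simp

lemma integral_abs_diff_triangle:
  assumes s: "0 \<le> s" and u: "0 \<le> u" and f: "f \<in> Brho \<rho>" and g: "g \<in> Brho \<rho>"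
  shows "(\<integral>w. \<bar>f (w u) - f (w s)\<bar> \<partial>M) \<le>
    (\<integral>w. \<bar>f (w u) - g (w u)\<bar> \<partial>M) + (\<integral>w. \<bar>g (w u) - g (w s)\<bar> \<partial>M) + (\<integral>w. \<bar>f (w s) - g (w s)\<bar> \<partial>M)"
proof -
  note int = integrable_coordinate[OF u f] integrable_coordinate[OF u g]
    integrable_coordinate[OF s f] integrable_coordinate[OF s g]
  have "(\<integral>w. \<bar>f (w u) - f (w s)\<bar> \<partial>M) \<le>
      (\<integral>w. \<bar>f (w u) - g (w u)\<bar> + \<bar>g (w u) - g (w s)\<bar> + \<bar>f (w s) - g (w s)\<bar> \<partial>M)"
    using int by (intro integral_mono) auto
  then show ?thesis using int by simp
qed

lemma right_L1_continuous:
  assumes s: "0 \<le> s" and f: "f \<in> Brho \<rho>" and h: "\<And>n. 0 < h n" "\<And>n. h n < d" "h \<longlonglongrightarrow> 0"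
  shows "(\<lambda>n. \<integral>w. \<bar>f (w (s + h n)) - f (w s)\<bar> \<partial>M) \<longlonglongrightarrow> 0"
proof (rule tendstoI)
  fix e :: real assume e: "e > 0"
  interpret \<nu>: weighted_prob \<rho> \<nu> by (rule weighted_prob_if_prob_in_Mrho[OF prob_in_Mrho_nu])
  obtain C where C: "\<And>t. t \<in> {0..s + d} \<Longrightarrow> operator_bound t C"
    by (rule operator_bound_Icc[where T = "s + d"]) blast
  define D where "D = C * (\<integral>x. \<rho> x \<partial>\<nu>)"
  have d: "d > 0" using h(1,2)[of 0] by simp
  have D: "D \<ge> 0"
    using C[of 0] s d \<nu>.integral_rho_nonneg by (auto simp: D_def operator_bound_def)
  define \<epsilon> where "\<epsilon> = e / (4 * (D + 1))"
  have \<epsilon>: "\<epsilon> > 0" "\<epsilon> * D \<le> e / 4" using e D by (auto simp: \<epsilon>_def field_simps)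
  obtain g where g: "g \<in> Cb" "\<And>x. \<bar>f x - g x\<bar> \<le> \<epsilon> * \<rho> x" using Brho_approx[OF f \<epsilon>(1)] by blast
  have gB: "g \<in> Brho \<rho>" by (rule Cb_Brho[OF g(1)])
  have near: "(\<integral>w. \<bar>f (w u) - g (w u)\<bar> \<partial>M) \<le> e / 4" if "0 \<le> u" "u \<le> s + d" for u
    using integral_abs_diff_coordinate_le[OF that(1) f gB C less_imp_le[OF \<epsilon>(1)] g(2)] that \<epsilon>(2)
    by (simp add: D_def)
  have "\<forall>\<^sub>F n in sequentially. (\<integral>w. \<bar>g (w (s + h n)) - g (w s)\<bar> \<partial>M) < e / 2"
    using e by (intro order_tendstoD(2)[OF right_L1_continuous_Cb[OF s g(1) h(1,3)]]) simp
  then show "\<forall>\<^sub>F n in sequentially. dist (\<integral>w. \<bar>f (w (s + h n)) - f (w s)\<bar> \<partial>M) 0 < e"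
  proof eventually_elim
    case (elim n)
    have u: "0 \<le> s + h n" "s + h n \<le> s + d" using s h(1,2)[of n] by auto
    show ?case
      using integral_abs_diff_triangle[OF s u(1) f gB] near[OF u] near[OF s] d elim
      by (simp add: dist_real_def)
  qed
qed

lemma real_cond_exp_natural_diff_le:
  assumes s: "0 \<le> s" and u: "0 \<le> u" "u \<le> t" and f: "f \<in> Brho \<rho>" and g: "g \<in> Brho \<rho>"
    and C: "operator_bound u C" and \<epsilon>: "\<epsilon> \<ge> 0" "\<And>x. \<bar>P (t - u) f x - g x\<bar> \<le> \<epsilon> * \<rho> x"
  shows "(\<integral>w. \<bar>real_cond_exp M (natural_filtration u) (\<lambda>w. f (w t)) w - g (w s)\<bar> \<partial>M)
    \<le> \<epsilon> * (C * (\<integral>x. \<rho> x \<partial>\<nu>)) + (\<integral>w. \<bar>g (w u) - g (w s)\<bar> \<partial>M)"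
proof -
  define k where "k = P (t - u) f"
  have k: "k \<in> Brho \<rho>" unfolding k_def using u by (intro P_Brho f) simp
  note int = integrable_coordinate[OF u(1) k] integrable_coordinate[OF u(1) g]
      integrable_coordinate[OF s g]
  have "(\<integral>w. \<bar>real_cond_exp M (natural_filtration u) (\<lambda>w. f (w t)) w - g (w s)\<bar> \<partial>M) =
      (\<integral>w. \<bar>k (w u) - g (w s)\<bar> \<partial>M)"
  proof (rule integral_cong_AE)
    show "AE w in M. \<bar>real_cond_exp M (natural_filtration u) (\<lambda>w. f (w t)) w - g (w s)\<bar> =
        \<bar>k (w u) - g (w s)\<bar>"
      using real_cond_exp_natural[OF u f] by eventually_elim (simp add: k_def)
  qed (use int[THEN borel_measurable_integrable] in simp_all)
  also have "\<dots> \<le> (\<integral>w. \<bar>k (w u) - g (w u)\<bar> + \<bar>g (w u) - g (w s)\<bar> \<partial>M)"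
    using int by (intro integral_mono) auto
  also have "\<dots> = (\<integral>w. \<bar>k (w u) - g (w u)\<bar> \<partial>M) + (\<integral>w. \<bar>g (w u) - g (w s)\<bar> \<partial>M)"
    using int by simp
  also have "(\<integral>w. \<bar>k (w u) - g (w u)\<bar> \<partial>M) \<le> \<epsilon> * (C * (\<integral>x. \<rho> x \<partial>\<nu>))"
    using \<epsilon> by (intro integral_abs_diff_coordinate_le u k g C) (simp_all add: k_def)
  finally show ?thesis by simp
qed

lemma real_cond_exp_natural_left_limit:
  assumes s: "0 \<le> s" "s < t" and f: "f \<in> Brho \<rho>"
  obtains h where "\<And>n. 0 < h n"
    "(\<lambda>n. \<integral>w. \<bar>real_cond_exp M (natural_filtration (s + h n)) (\<lambda>w. f (w t)) w -
        P (t - s) f (w s)\<bar> \<partial>M) \<longlonglongrightarrow> 0"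
proof -
  define g where "g = P (t - s) f"
  have g: "g \<in> Brho \<rho>" unfolding g_def using s by (intro P_Brho f) simp
  have "0 < t - s" using s by simp
  then obtain h where h: "\<And>n. 0 < h n" "\<And>n. h n < t - s" "h \<longlonglongrightarrow> 0"
    "\<And>n x. \<bar>P (t - s - h n) f x - g x\<bar> \<le> 1 / real (Suc n) * \<rho> x"
    unfolding g_def by (rule P_left_approx_sequence[OF f]) blast
  obtain C where C: "\<And>u. u \<in> {0..t} \<Longrightarrow> operator_bound u C"
    by (rule operator_bound_Icc[where T = t]) blast
  define D where "D = C * (\<integral>x. \<rho> x \<partial>\<nu>)"
  have bound: "(\<integral>w. \<bar>real_cond_exp M (natural_filtration (s + h n)) (\<lambda>w. f (w t)) w - g (w s)\<bar> \<partial>M)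
      \<le> 1 / real (Suc n) * D + (\<integral>w. \<bar>g (w (s + h n)) - g (w s)\<bar> \<partial>M)" for n
  proof -
    have u: "0 \<le> s + h n" "s + h n \<le> t" using s h(1,2)[of n] by auto
    show ?thesis
      unfolding D_def using h(4)[of n] u s
      by (intro real_cond_exp_natural_diff_le f g C) (simp_all add: diff_diff_eq)
  qed
  have "(\<lambda>n. 1 / real (Suc n) * D + (\<integral>w. \<bar>g (w (s + h n)) - g (w s)\<bar> \<partial>M)) \<longlonglongrightarrow> 0 * D + 0"
    by (intro tendsto_intros LIMSEQ_Suc[OF lim_1_over_n] right_L1_continuous[OF s(1) g h(1-3)])
  then have limit: "(\<lambda>n. 1 / real (Suc n) * D + (\<integral>w. \<bar>g (w (s + h n)) - g (w s)\<bar> \<partial>M)) \<longlonglongrightarrow> 0"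
    by simp
  have "(\<lambda>n. \<integral>w. \<bar>real_cond_exp M (natural_filtration (s + h n)) (\<lambda>w. f (w t)) w - g (w s)\<bar> \<partial>M) \<longlonglongrightarrow> 0"
    by (rule tendsto_sandwich[OF _ _ tendsto_const limit])
      (simp, intro always_eventually allI bound)
  from this[unfolded g_def] show thesis by (rule that[OF h(1)])
qed

theorem real_cond_exp_augmented:
  assumes s: "0 \<le> s" "s \<le> t" and f: "f \<in> Brho \<rho>"
  shows "AE w in completion M.
    real_cond_exp (completion M) (augmented_filtration s) (\<lambda>w. f (w t)) w = P (t - s) f (w s)"
proof (cases "s = t")
  case True
  interpret C: prob_space "completion M" by (rule prob_space_completion)
  interpret C: finite_measure_subalgebra "completion M" "augmented_filtration s"
    using subalgebra_augmented by unfold_locales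
  have "integrable M (\<lambda>w. f (w t))" by (rule integrable_coordinate[OF order_trans[OF s] f])
  then have "integrable (completion M) (\<lambda>w. f (w t))"
    by (simp add: integrable_completion[OF borel_measurable_integrable])
  moreover have "(\<lambda>w. f (w t)) \<in> borel_measurable (augmented_filtration s)"
    using s by (intro measurable_augmented coordinate_measurable_natural Brho_borel f)
      (simp_all add: True)
  ultimately have "AE w in completion M.
      real_cond_exp (completion M) (augmented_filtration s) (\<lambda>w. f (w t)) w = f (w t)"
    by (rule C.real_cond_exp_F_meas)
  then show ?thesis by (simp add: True P_0[OF f])
next
  case False
  then have "s < t" "0 \<le> t - s" "0 \<le> t" using s by auto
  obtain h where h: "\<And>n. 0 < h n"
    "(\<lambda>n. \<integral>w. \<bar>real_cond_exp M (natural_filtration (s + h n)) (\<lambda>w. f (w t)) w -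
        P (t - s) f (w s)\<bar> \<partial>M) \<longlonglongrightarrow> 0"
    by (rule real_cond_exp_natural_left_limit[OF s(1) \<open>s < t\<close> f]) blast
  show ?thesis
  proof (rule real_cond_exp_augmented_limit[OF _ _ _ _ h(2)])
    show "integrable M (\<lambda>w. f (w t))" by (rule integrable_coordinate[OF \<open>0 \<le> t\<close> f])
    show "integrable M (\<lambda>w. P (t - s) f (w s))"
      by (intro integrable_coordinate s P_Brho f \<open>0 \<le> t - s\<close>)
    show "(\<lambda>w. P (t - s) f (w s)) \<in> borel_measurable (natural_filtration s)"
      using s \<open>0 \<le> t - s\<close> by (intro coordinate_measurable_natural Brho_borel P_Brho f) auto
  qed (use h(1) in simp)
qed

lemma coordinate_measurable_augmented:
  assumes "0 \<le> r" "r \<le> t" shows "(\<lambda>w. w r) \<in> augmented_filtration t \<rightarrow>\<^sub>M borel"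
  using coordinate_measurable_natural[OF assms, of "\<lambda>x. x" borel]
  by (intro measurable_augmented) simp

lemma generated_sets_subset_augmented:
  "sigma_sets (space M) (\<Union>r\<in>{0..t}. {(\<lambda>w. w r) -` B \<inter> space M | B. B \<in> sets borel}) \<subseteq>
      sets (augmented_filtration t)"
proof -
  have "(\<lambda>w. w r) -` B \<inter> space M \<in> sets (augmented_filtration t)"
    if "r \<in> {0..t}" "B \<in> sets borel" for r B
    using measurable_sets[OF coordinate_measurable_augmented that(2), of r t] that(1)
    by (simp add: space_augmented)
  then have "(\<Union>r\<in>{0..t}. {(\<lambda>w. w r) -` B \<inter> space M | B. B \<in> sets borel}) \<subseteq>
      sets (augmented_filtration t)" by auto
  from sets.sigma_sets_subset[OF this] show ?thesis by (simp add: space_augmented)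
qed

end

lemma (in feller) feller_process_exists:
  assumes "prob_in_Mrho \<rho> \<nu>" shows "\<exists>M. feller_process \<rho> P M \<nu>"
proof -
  interpret weighted_prob \<rho> \<nu> by (rule weighted_prob_if_prob_in_Mrho[OF assms])
  have "\<nu> \<in> space (prob_algebra borel)"
    using prob_space_axioms sets_nu by (simp add: space_prob_algebra)
  moreover have "inner_regular_wrt (\<nu> \<bind> kernel t) (Collect compact) A"
    if "t \<ge> 0" "A \<in> sets borel" for t A
    using that by (intro inner_regular_if_prob_in_Mrho[OF prob_in_Mrho_bind_kernel[OF assms]])
  ultimately obtain M where "markov_process kernel M \<nu>"
    using transition.markov_process_exists[OF Hausdorff] by blast
  then have "feller_process \<rho> P M \<nu>"
    using assms feller_axioms by (simp add: feller_process_def feller_process_axioms_def)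
  then show ?thesis by blast
qed

theorem mainTheorem5:
  fixes \<rho> :: "'a::topological_space \<Rightarrow> real"
    and P :: "real \<Rightarrow> ('a \<Rightarrow> real) \<Rightarrow> ('a \<Rightarrow> real)"
    and \<nu> :: "'a measure"
  assumes "weighted_space \<rho>"
    and "gen_feller_semigroup \<rho> P"
    and "\<forall>t\<ge>0. P t (\<lambda>x. 1) = (\<lambda>x. 1)"
    and "prob_in_Mrho \<rho> \<nu>"
  shows "\<exists>(Pnu :: (real \<Rightarrow> 'a) measure) (F :: real \<Rightarrow> (real \<Rightarrow> 'a) measure).
     prob_space Pnu \<and>
     sets Pnu = sets (\<Pi>\<^sub>M t\<in>{0::real..}. (borel :: 'a measure)) \<and>
     \<comment> \<open>filtration of sub-sigma-algebras of the completed measure\<close>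
     (\<forall>t\<ge>0. subalgebra (completion Pnu) (F t)) \<and>
     (\<forall>s t. 0 \<le> s \<and> s \<le> t \<longrightarrow> sets (F s) \<subseteq> sets (F t)) \<and>
     \<comment> \<open>complete\<close>
     (\<forall>t\<ge>0. null_sets (completion Pnu) \<subseteq> sets (F t)) \<and>
     \<comment> \<open>right-continuous\<close>
     (\<forall>t\<ge>0. sets (F t) = (\<Inter>u\<in>{t<..}. sets (F u))) \<and>
     \<comment> \<open>contains the natural filtration of the coordinate process\<close>
     (\<forall>t\<ge>0. sigma_sets (space Pnu) (\<Union>r\<in>{0..t}. {(\<lambda>\<omega>. \<omega> r) -` B \<inter> space Pnu | B. B \<in> sets borel})
              \<subseteq> sets (F t)) \<and>
     \<comment> \<open>adapted\<close>
     (\<forall>t\<ge>0. (\<lambda>\<omega>. \<omega> t) \<in> measurable (F t) borel) \<and>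
     \<comment> \<open>initial law\<close>
     distr Pnu borel (\<lambda>\<omega>. \<omega> 0) = \<nu> \<and>
     \<comment> \<open>Markov property\<close>
     (\<forall>s t f. 0 \<le> s \<and> s \<le> t \<and> f \<in> Brho \<rho> \<longrightarrow>
        integrable (completion Pnu) (\<lambda>\<omega>. f (\<omega> t)) \<and>
        (AE \<omega> in completion Pnu.
           real_cond_exp (completion Pnu) (F s) (\<lambda>\<omega>. f (\<omega> t)) \<omega> = P (t - s) f (\<omega> s)))"
proof -
  interpret feller \<rho> P
    using assms(1-3) by unfold_locales auto
  obtain M where "feller_process \<rho> P M \<nu>" using feller_process_exists[OF assms(4)] by blast
  then interpret feller_process \<rho> P M \<nu> .
  have "integrable (completion M) (\<lambda>w. f (w t))" if "0 \<le> t" "f \<in> Brho \<rho>" for t f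
    using integrable_coordinate[OF that]
    by (simp add: integrable_completion[OF borel_measurable_integrable])
  then show ?thesis
    by (intro exI[of _ M] exI[of _ augmented_filtration] conjI allI impI prob_space_axioms sets_M
        subalgebra_augmented augmented_mono null_sets_augmented augmented_right_continuous
        generated_sets_subset_augmented coordinate_measurable_augmented distr_initial
        real_cond_exp_augmented) auto
qed

end
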